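(* Let $(w_i)_{i\ge0}$ be a sequence of nonnegative numbers with $w_0>0$, let $\Phi(z):=\sum_{i\ge0}w_iz^i$, and let $\mathcal{T}_n$ be the simply generated tree of size $n$ with generator $\Phi$. Let $R_\Phi\le\infty$ be the radius of convergence of $\Phi(z)$. Assume that $R_\Phi>0$ and that $$\lim_{z\nearrow R_\Phi}\frac{z\Phi'(z)}{\Phi(z)}>1,\qquad \Phi'(R_\Phi):=\lim_{z\nearrow R_\Phi}\Phi'(z)=\infty .$$ Let $R(T)$ denote the number of root subtrees of a rooted tree $T$. Then there exist sequences of numbers $\gamma_m>0$ ($m\ge1$) and $1<\tau_1<\tau_2<\cdots$ such that for any fixed $m\ge1$, as $n\to\infty$, $$\mathbb{E}\,R(\mathcal{T}_n)^m=\bigl(1+O(n^{-1})\bigr)\gamma_m\tau_m^n .$$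
   Context: All trees are rooted, ordered and finite; $|T|$ is the number of nodes of $T$, and $D_+(v)$ is the number of children of a node $v$. A root subtree of $T$ is a connected subset of the node set of $T$ that contains the root of $T$; $R(T)$ is the number of root subtrees of $T$. Given the weight sequence $(w_i)$, the weight of a tree is $w(T)=\prod_{v\in T}w_{D_+(v)}$. The simply generated tree $\mathcal{T}_n$ with generator $\Phi$ is the random ordered tree of size $n$ with $\mathbb{P}(\mathcal{T}_n=T)=w(T)/\sum_{T':|T'|=n}w(T')$ for every ordered tree $T$ with $|T|=n$. Only those $n$ for which $\mathcal{T}_n$ exists, i.e. $\sum_{T':|T'|=n}w(T')>0$, are considered. *)

theory Defs
  imports "HOL-Probability.Probability" "HOL-Library.Landau_Symbols"
begin

section \<open>Rooted ordered finite trees\<close>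

datatype otree = Node (children: "otree list")

text \<open>
  Nodes are identified by their Ulam--Harris addresses: the root is \<open>[]\<close>, and \<open>v @ [i]\<close> is the
  \<open>i\<close>-th child (counted from \<open>0\<close>) of \<open>v\<close>.
\<close>

lemma size_nth_less [termination_simp]:
  "i < length ts \<Longrightarrow> size (ts ! i) < Suc (size_list size ts)"
  by (auto simp: less_Suc_eq_le intro: size_list_estimation' nth_mem)

fun nodes :: "otree \<Rightarrow> nat list set" where
  "nodes (Node ts) = insert [] (\<Union>i\<in>{..<length ts}. (#) i ` nodes (ts ! i))"

definition tree_size :: "otree \<Rightarrow> nat" where
  "tree_size T = card (nodes T)"

definition outdegree :: "otree \<Rightarrow> nat list \<Rightarrow> nat" where
  "outdegree T v = card {u \<in> nodes T. \<exists>i. u = v @ [i]}"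

definition adjacent :: "nat list \<Rightarrow> nat list \<Rightarrow> bool" where
  "adjacent u v \<longleftrightarrow> (\<exists>i. v = u @ [i] \<or> u = v @ [i])"

definition connected_nodes :: "nat list set \<Rightarrow> bool" where
  "connected_nodes S \<longleftrightarrow>
     (\<forall>u\<in>S. \<forall>v\<in>S. (\<lambda>a b. a \<in> S \<and> b \<in> S \<and> adjacent a b)\<^sup>*\<^sup>* u v)"

definition root_subtrees :: "otree \<Rightarrow> nat list set set" where
  "root_subtrees T = {S. S \<subseteq> nodes T \<and> [] \<in> S \<and> connected_nodes S}"

definition num_root_subtrees :: "otree \<Rightarrow> nat" where
  "num_root_subtrees T = card (root_subtrees T)"


section \<open>Simply generated trees\<close>

definition tree_weight :: "(nat \<Rightarrow> real) \<Rightarrow> otree \<Rightarrow> real" where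
  "tree_weight w T = (\<Prod>v\<in>nodes T. w (outdegree T v))"

definition partition_fun :: "(nat \<Rightarrow> real) \<Rightarrow> nat \<Rightarrow> real" where
  "partition_fun w n = (\<Sum>T | tree_size T = n. tree_weight w T)"

text \<open>
  The law of the simply generated tree of size \<open>n\<close>. It is meaningful only if
  \<open>partition_fun w n > 0\<close>; see \<open>pmf_simply_generated_tree\<close> below.
\<close>

definition simply_generated_tree :: "(nat \<Rightarrow> real) \<Rightarrow> nat \<Rightarrow> otree pmf" where
  "simply_generated_tree w n =
     embed_pmf (\<lambda>T. if tree_size T = n then tree_weight w T / partition_fun w n else 0)"

text \<open>The limit \<open>n \<rightarrow> \<infinity>\<close> along those \<open>n\<close> for which the simply generated tree of size \<open>n\<close> exists.\<close>

definition admissible_at_top :: "(nat \<Rightarrow> real) \<Rightarrow> nat filter" where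
  "admissible_at_top w = inf sequentially (principal {n. partition_fun w n > 0})"


section \<open>The generator\<close>

definition generator :: "(nat \<Rightarrow> real) \<Rightarrow> real \<Rightarrow> real" where
  "generator w z = (\<Sum>i. w i * z ^ i)"

text \<open>The filter of real \<open>z\<close> increasing to \<open>R\<close>, which may be infinite.\<close>

definition from_below :: "ereal \<Rightarrow> real filter" where
  "from_below R = (if R = \<infinity> then at_top else at_left (real_of_ereal R))"


section \<open>The law of the simply generated tree is well defined\<close>

lemma finite_nodes: "finite (nodes T)"
  by (induction T rule: nodes.induct) auto

lemma length_children_le: "length ts \<le> tree_size (Node ts)"
proof -
  have e: "[] \<in> nodes t" for t by (cases t) auto
  have "length ts = card ((\<lambda>i. [i]) ` {..<length ts})"
    by (subst card_image) (auto simp: inj_on_def)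
  also have "\<dots> \<le> card (nodes (Node ts))"
    by (intro card_mono finite_nodes) (use e in auto)
  finally show ?thesis by (simp add: tree_size_def)
qed

lemma tree_size_child_less:
  assumes "t \<in> set ts"
  shows "tree_size t < tree_size (Node ts)"
proof -
  obtain i where i: "i < length ts" "t = ts ! i"
    using assms by (auto simp: in_set_conv_nth)
  have "tree_size t = card ((#) i ` nodes t)"
    by (simp add: tree_size_def card_image)
  also have "\<dots> < card (nodes (Node ts))"
    by (intro psubset_card_mono finite_nodes) (use i in auto)
  finally show ?thesis by (simp add: tree_size_def)
qed

lemma finite_trees_le: "finite {T. tree_size T \<le> n}"
proof (induction n)
  case 0
  have "tree_size T \<noteq> 0" for T
    using finite_nodes[of T] by (cases T) (auto simp: tree_size_def)
  then have "{T. tree_size T \<le> 0} = {}" by simp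
  then show ?case by (metis finite.emptyI)
next
  case (Suc n)
  have "{T. tree_size T \<le> Suc n} \<subseteq>
          Node ` {ts. set ts \<subseteq> {T. tree_size T \<le> n} \<and> length ts \<le> Suc n}"
  proof
    fix T assume T: "T \<in> {T. tree_size T \<le> Suc n}"
    obtain ts where ts: "T = Node ts" by (cases T)
    have "length ts \<le> Suc n"
      using length_children_le[of ts] T ts by auto
    moreover have "set ts \<subseteq> {T. tree_size T \<le> n}"
      using tree_size_child_less[of _ ts] T ts by fastforce
    ultimately show "T \<in> Node ` {ts. set ts \<subseteq> {T. tree_size T \<le> n} \<and> length ts \<le> Suc n}"
      using ts by blast
  qed
  moreover have "finite {ts. set ts \<subseteq> {T. tree_size T \<le> n} \<and> length ts \<le> Suc n}"
    by (rule finite_lists_length_le[OF Suc.IH])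
  ultimately show ?case
    by (meson finite_imageI finite_subset)
qed

lemma finite_trees: "finite {T. tree_size T = n}"
  by (rule finite_subset[OF _ finite_trees_le[of n]]) auto

lemma pmf_simply_generated_tree:
  assumes w: "\<And>i. w i \<ge> 0" and pos: "partition_fun w n > 0"
  shows "pmf (simply_generated_tree w n) T =
           (if tree_size T = n then tree_weight w T / partition_fun w n else 0)"
proof -
  let ?f = "\<lambda>T. if tree_size T = n then tree_weight w T / partition_fun w n else 0"
  have nn: "?f T \<ge> 0" for T
    using w pos by (auto simp: tree_weight_def intro!: prod_nonneg divide_nonneg_pos)
  have "(\<integral>\<^sup>+T. ennreal (?f T) \<partial>count_space UNIV) = (\<Sum>T | tree_size T = n. ennreal (?f T))"
    by (rule nn_integral_count_space') (auto intro: finite_trees)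
  also have "\<dots> = ennreal (\<Sum>T | tree_size T = n. ?f T)"
    by (rule sum_ennreal) (rule nn)
  also have "(\<Sum>T | tree_size T = n. ?f T) = partition_fun w n / partition_fun w n"
    by (simp add: partition_fun_def flip: sum_divide_distrib)
  also have "\<dots> = 1" using pos by simp
  finally have "(\<integral>\<^sup>+T. ennreal (?f T) \<partial>count_space UNIV) = 1" by simp
  then show ?thesis
    unfolding simply_generated_tree_def by (intro pmf_embed_pmf nn)
qed

end

theory Submission
  imports Defs "HOL-Complex_Analysis.Complex_Analysis"
begin

text \<open>
  Write \<open>H\<^sub>m(z) = \<Sum>\<^sub>T w(T) (1 + R(T))\<^sup>m z\<^bsup>|T|\<^esup>\<close> and \<open>F\<^sub>m(z) = \<Sum>\<^sub>T w(T) R(T)\<^sup>m z\<^bsup>|T|\<^esup>\<close>, so that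
  the \<open>m\<close>-th moment of \<open>R(\<T>\<^sub>n)\<close> is the quotient of the \<open>n\<close>-th coefficients of \<open>F\<^sub>m\<close> and \<open>F\<^sub>0\<close>. A root
  subtree consists of the root and, for every child, either nothing or a root subtree of the branch
  at that child. Hence \<open>R(T) = \<Prod>\<^sub>i (1 + R(T\<^sub>i))\<close> over the branches \<open>T\<^sub>i\<close>, and summing over all trees gives
  \<open>F\<^sub>m = z \<Phi>(H\<^sub>m)\<close>. With \<open>G\<^sub>m = H\<^sub>m - F\<^sub>m\<close> this is the functional equation
  \<open>H\<^sub>m = G\<^sub>m + z \<Phi>(H\<^sub>m)\<close> (\<open>moment_fps_eq\<close>), where \<open>G\<^sub>m\<close> is dominated by a multiple of \<open>H\<^bsub>m-1\<^esub>\<close>, because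
  \<open>(1 + x)\<^sup>m - x\<^sup>m \<le> m (1 + x)\<^bsup>m-1\<^esup>\<close>.

  The series \<open>H\<^sub>m\<close> ceases to be analytic where the equation stops being solvable for \<open>H\<^sub>m\<close>, at the point
  \<open>\<rho>\<^sub>m > 0\<close> with \<open>\<rho>\<^sub>m \<Phi>'(H\<^sub>m(\<rho>\<^sub>m)) = 1\<close>. Such a point exists because \<open>\<Phi>'\<close> is unbounded, which also
  keeps \<open>H\<^sub>m(\<rho>\<^sub>m)\<close> strictly inside the disc of convergence of \<open>\<Phi>\<close> (\<open>singularity_exists\<close>). Since \<open>H\<^sub>m\<close> is
  strictly larger than \<open>H\<^bsub>m-1\<^esub>\<close> on the positive axis, it meets this condition earlier:
  \<open>\<rho>\<^sub>m < \<rho>\<^bsub>m-1\<^esub>\<close> (\<open>less_singularity\<close>). Consequently \<open>G\<^sub>m\<close> is still analytic at \<open>\<rho>\<^sub>m\<close>, and the induction on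
  \<open>m\<close> goes through.

  Near \<open>\<rho>\<^sub>m\<close> the solution branches like a square root: it is an analytic function of
  \<open>\<surd>(1 - z/\<rho>\<^sub>m)\<close> (\<open>square_root_singularity\<close>). If \<open>d\<close> is the greatest common divisor of the indices with
  positive weight, then \<open>H\<^sub>m(z)/z\<close> is a series in \<open>z\<^sup>d\<close>, and the singularities on the circle
  \<open>|z| = \<rho>\<^sub>m\<close> are exactly the rotations of \<open>\<rho>\<^sub>m\<close> by the \<open>d\<close>-th roots of unity
  (\<open>characteristic_eq_imp_root_of_unity\<close>). After the terms \<open>\<surd>(1 - z/\<rho>\<^sub>m)\<close> and \<open>(\<surd>(1 - z/\<rho>\<^sub>m))\<^sup>3\<close> have been
  subtracted at all of them, the third derivative of the rest grows at most like the inverse square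
  root of the distance to the circle, so Cauchy's inequality on a circle at relative distance
  \<open>1/n\<close> bounds its \<open>n\<close>-th coefficient by \<open>O(\<rho>\<^sub>m\<^bsup>-n\<^esup> n\<^bsup>-5/2\<^esup>)\<close>. This leaves, for \<open>n\<close> congruent to 1
  modulo \<open>d\<close>, the \<open>n\<close>-th coefficient of \<open>F\<^sub>m\<close> equal to
  \<open>\<kappa>\<^sub>m \<rho>\<^sub>m\<^bsup>-n\<^esup> b\<^sub>n (1 + O(1/n))\<close>, where the \<open>b\<^sub>n\<close> are, up to sign, the binomial coefficients of
  exponent \<open>1/2\<close> (\<open>moment_sum_asymptotics\<close>). They do not depend on \<open>m\<close> and cancel in the quotient,
  which gives the theorem with \<open>\<gamma>\<^sub>m = \<kappa>\<^sub>m/\<kappa>\<^sub>0\<close> and \<open>\<tau>\<^sub>m = \<rho>\<^sub>0/\<rho>\<^sub>m\<close>.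
\<close>

section \<open>A holomorphic implicit function theorem\<close>

text \<open>
  Newton's iteration with the derivative kept at the base point is a contraction near the base point,
  uniformly in \<open>x\<close>. Its iterates are holomorphic in \<open>x\<close> and converge uniformly, so their limit is
  holomorphic. Joint holomorphy of \<open>P\<close> enters only through the assumption that substituting a
  holomorphic function for \<open>y\<close> gives a holomorphic function; concrete equations satisfy it by
  composition.
\<close>

lemma holomorphic_implicit_function:
  fixes P P' :: "complex \<Rightarrow> complex \<Rightarrow> complex"
  assumes r: "r > 0"
    and deriv: "\<And>x y. x \<in> ball x0 r \<Longrightarrow> y \<in> ball y0 r \<Longrightarrow> (P x has_field_derivative P' x y) (at y)"
    and cont: "isCont (\<lambda>(x, y). P' x y) (x0, y0)"
    and hol: "\<And>f S. open S \<Longrightarrow> S \<subseteq> ball x0 r \<Longrightarrow> f holomorphic_on S \<Longrightarrow> f ` S \<subseteq> ball y0 r \<Longrightarrow>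
                (\<lambda>x. P x (f x)) holomorphic_on S"
    and zero: "P x0 y0 = 0" and nonzero: "P' x0 y0 \<noteq> 0"
  obtains f \<delta> \<epsilon> where "\<delta> > 0" "\<delta> \<le> r" "\<epsilon> > 0" "\<epsilon> \<le> r" "f holomorphic_on ball x0 \<delta>"
    "f ` ball x0 \<delta> \<subseteq> ball y0 \<epsilon>"
    "\<And>x y. x \<in> ball x0 \<delta> \<Longrightarrow> y \<in> ball y0 \<epsilon> \<Longrightarrow> P x y = 0 \<longleftrightarrow> y = f x"
proof -
  define c where "c = P' x0 y0"
  have c: "norm c > 0" using nonzero by (simp add: c_def)
  obtain \<epsilon>0 where \<epsilon>0: "\<epsilon>0 > 0"
    "\<And>q. dist q (x0, y0) < \<epsilon>0 \<Longrightarrow> dist ((\<lambda>(x, y). P' x y) q) c < norm c / 2"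
    using cont[unfolded continuous_at_eps_delta, rule_format, of "norm c / 2"] c
    by (auto simp: c_def)
  define \<epsilon> where "\<epsilon> = min (\<epsilon>0 / 4) (r / 2)"
  have \<epsilon>: "\<epsilon> > 0" "\<epsilon> < r" "\<epsilon> \<le> \<epsilon>0 / 4" using \<epsilon>0 r by (auto simp: \<epsilon>_def)
  have cP: "(\<lambda>x. P x y0) holomorphic_on ball x0 r"
    by (rule hol) (use r in auto)
  then have "isCont (\<lambda>x. P x y0) x0"
    using r by (meson centre_in_ball continuous_on_eq_continuous_at holomorphic_on_imp_continuous_on open_ball)
  then obtain \<delta>0 where \<delta>0: "\<delta>0 > 0" "\<And>x. dist x x0 < \<delta>0 \<Longrightarrow> norm (P x y0) < \<epsilon> / 4 * norm c"
    unfolding continuous_at_eps_delta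
    using \<epsilon> c zero by (metis divide_pos_pos dist_0_norm dist_commute mult_pos_pos zero_less_numeral)
  define \<delta> where "\<delta> = min \<epsilon> \<delta>0"
  have \<delta>: "\<delta> > 0" "\<delta> \<le> \<delta>0" "\<delta> \<le> \<epsilon>" using \<epsilon> \<delta>0 by (auto simp: \<delta>_def)
  \<comment> \<open>Newton's map with the derivative kept at its value \<open>c\<close> at the base point\<close>
  define T where "T x y = y - P x y / c" for x y
  have P'near: "norm (P' x y - c) \<le> norm c / 2" if "x \<in> ball x0 \<delta>" "y \<in> cball y0 \<epsilon>" for x y
  proof -
    have "dist (x, y) (x0, y0) \<le> dist x x0 + dist y y0"
      by (simp add: dist_Pair_Pair sqrt_sum_squares_le_sum)
    also have "\<dots> < \<epsilon>0" using that \<delta> \<epsilon> by (auto simp: dist_commute)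
    finally show ?thesis using \<epsilon>0(2)[of "(x, y)"] by (simp add: dist_norm)
  qed
  have T_contr: "norm (T x y - T x y') \<le> 1 / 2 * norm (y - y')"
    if "x \<in> ball x0 \<delta>" "y \<in> cball y0 \<epsilon>" "y' \<in> cball y0 \<epsilon>" for x y y'
  proof (rule field_differentiable_bound[of "cball y0 \<epsilon>" "T x" "\<lambda>y. 1 - P' x y / c"])
    fix u assume u: "u \<in> cball y0 \<epsilon>"
    have "(P x has_field_derivative P' x u) (at u)"
      using deriv[of x u] that u \<epsilon> \<delta> by auto
    from DERIV_diff[OF DERIV_ident DERIV_cdivide[OF this]]
    show "(T x has_field_derivative 1 - P' x u / c) (at u within cball y0 \<epsilon>)"
      unfolding T_def by (rule has_field_derivative_at_within)
    have "1 - P' x u / c = - (P' x u - c) / c" using c by (auto simp: field_simps)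
    then have "norm (1 - P' x u / c) = norm (P' x u - c) / norm c"
      by (simp only: norm_divide norm_minus_cancel)
    also have "\<dots> \<le> 1 / 2" using P'near[OF that(1) u] c by (simp add: field_simps)
    finally show "norm (1 - P' x u / c) \<le> 1 / 2" .
  qed (use that in auto)
  have T_maps: "dist (T x y) y0 < \<epsilon>" if "x \<in> ball x0 \<delta>" "y \<in> cball y0 \<epsilon>" for x y
  proof -
    have "norm (P x y0 / c) < \<epsilon> / 4"
      using \<delta>0(2)[of x] that \<delta> c by (auto simp: norm_divide field_simps dist_commute)
    then have "norm (T x y0 - y0) < \<epsilon> / 4" by (simp add: T_def)
    moreover have "norm (T x y - T x y0) \<le> 1 / 2 * norm (y - y0)"
      using T_contr[of x y y0] that \<epsilon> by auto
    moreover have "norm (y - y0) \<le> \<epsilon>" using that by (auto simp: dist_norm norm_minus_commute)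
    moreover have "norm (T x y - y0) \<le> norm (T x y - T x y0) + norm (T x y0 - y0)"
      by norm
    ultimately show ?thesis using \<epsilon> by (simp add: dist_norm)
  qed
  have "\<exists>!y. y \<in> cball y0 \<epsilon> \<and> T x y = y" if "x \<in> ball x0 \<delta>" for x
  proof (rule Banach_fix[of _ "1/2"])
    show "T x ` cball y0 \<epsilon> \<subseteq> cball y0 \<epsilon>"
      using T_maps[OF that] by (force simp: dist_commute)
    show "\<And>u v. u \<in> cball y0 \<epsilon> \<Longrightarrow> v \<in> cball y0 \<epsilon> \<Longrightarrow> dist (T x u) (T x v) \<le> 1 / 2 * dist u v"
      using T_contr[OF that] by (simp add: dist_norm)
  qed (use \<epsilon> in \<open>auto simp: complete_eq_closed\<close>)
  then obtain f where f: "\<And>x. x \<in> ball x0 \<delta> \<Longrightarrow> f x \<in> cball y0 \<epsilon> \<and> T x (f x) = f x"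
    and f_unique: "\<And>x y. x \<in> ball x0 \<delta> \<Longrightarrow> y \<in> cball y0 \<epsilon> \<Longrightarrow> T x y = y \<Longrightarrow> y = f x"
    by metis
  have f_ball: "f x \<in> ball y0 \<epsilon>" if "x \<in> ball x0 \<delta>" for x
    using T_maps[of x "f x"] f[OF that] that by (auto simp: dist_commute)
  define F where "F n x = (T x ^^ n) y0" for n x
  have F_maps: "F n x \<in> ball y0 \<epsilon>" if "x \<in> ball x0 \<delta>" for n x
  proof (induction n)
    case (Suc n)
    then show ?case using T_maps[OF that, of "F n x"] by (auto simp: F_def dist_commute less_imp_le)
  qed (use \<epsilon> in \<open>auto simp: F_def\<close>)
  have F_hol: "F n holomorphic_on ball x0 \<delta>" for n
  proof (induction n)
    case 0 then show ?case by (simp add: F_def)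
  next
    case (Suc n)
    have "F n x \<in> ball y0 r" if "x \<in> ball x0 \<delta>" for x
      using F_maps[OF that, of n] \<epsilon> by auto
    then have "(\<lambda>x. P x (F n x)) holomorphic_on ball x0 \<delta>"
      by (intro hol) (use Suc \<epsilon> \<delta> in auto)
    with Suc show ?case
      unfolding F_def T_def using c by (auto intro!: holomorphic_intros)
  qed
  have F_lim: "norm (F n x - f x) \<le> (1 / 2) ^ n * \<epsilon>" if "x \<in> ball x0 \<delta>" for n x
  proof (induction n)
    case 0 then show ?case using f_ball[OF that] by (simp add: F_def dist_norm)
  next
    case (Suc n)
    have "norm (F (Suc n) x - f x) = norm (T x (F n x) - T x (f x))"
      using f[OF that] by (simp add: F_def)
    also have "\<dots> \<le> 1 / 2 * norm (F n x - f x)"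
      using T_contr[OF that, of "F n x" "f x"] F_maps[OF that, of n] f_ball[OF that] by auto
    finally show ?case using Suc by simp
  qed
  have ulim: "uniform_limit (ball x0 \<delta>) F f sequentially"
  proof (rule uniform_limitI)
    fix e :: real assume e: "e > 0"
    have "(\<lambda>n. (1 / 2) ^ n * \<epsilon>) \<longlonglongrightarrow> 0 * \<epsilon>"
      by (intro tendsto_intros LIMSEQ_power_zero) auto
    then have "\<forall>\<^sub>F n in sequentially. (1 / 2) ^ n * \<epsilon> < e"
      using e by (auto dest: order_tendstoD)
    then show "\<forall>\<^sub>F n in sequentially. \<forall>x\<in>ball x0 \<delta>. dist (F n x) (f x) < e"
      by eventually_elim (auto simp: dist_norm intro!: le_less_trans[OF F_lim])
  qed
  have "f holomorphic_on ball x0 \<delta>"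
  proof (rule holomorphic_uniform_sequence[of _ F])
    fix x assume "x \<in> ball x0 \<delta>"
    then obtain d where "d > 0" "cball x d \<subseteq> ball x0 \<delta>"
      using open_contains_cball[of "ball x0 \<delta>"] by blast
    then show "\<exists>d>0. cball x d \<subseteq> ball x0 \<delta> \<and> uniform_limit (cball x d) F f sequentially"
      using uniform_limit_on_subset[OF ulim] by blast
  qed (use F_hol in auto)
  moreover have "P x y = 0 \<longleftrightarrow> y = f x" if "x \<in> ball x0 \<delta>" "y \<in> ball y0 \<epsilon>" for x y
  proof -
    have "T x y = y \<longleftrightarrow> P x y = 0" for y using c by (auto simp: T_def)
    then show ?thesis using f[OF that(1)] f_unique[OF that(1), of y] that(2) by auto
  qed
  ultimately show ?thesis
    by (intro that[of \<delta> \<epsilon> f]) (use \<delta> \<epsilon> f_ball in \<open>auto simp del: mem_ball\<close>)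
qed

section \<open>Square-root branching of the solution\<close>

text \<open>
  The principal root of a point in the right half-plane has argument at most \<open>\<pi>/4\<close> in absolute
  value, so its real part is comparable to its modulus. This later decides which of the two square
  roots describes the solution.
\<close>

lemma csqrt_half_plane:
  assumes "Re z > 0"
  shows "norm (csqrt z) \<le> 2 * Re (csqrt z)" "csqrt z \<noteq> 0"
proof -
  have nz: "z \<noteq> 0" using assms by auto
  have R: "Re (csqrt z) \<ge> 0" using csqrt_principal[of z] by auto
  have "Re ((csqrt z)\<^sup>2) > 0" using assms by simp
  then have "(Im (csqrt z))\<^sup>2 < (Re (csqrt z))\<^sup>2" by (simp add: power2_eq_square)
  moreover have four: "(2::real)\<^sup>2 = 4" by simp
  ultimately have "(norm (csqrt z))\<^sup>2 \<le> (2 * Re (csqrt z))\<^sup>2"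
    using cmod_power2[of "csqrt z"] zero_le_power2[of "Re (csqrt z)"]
    unfolding power_mult_distrib four by linarith
  then show "norm (csqrt z) \<le> 2 * Re (csqrt z)"
    by (rule power2_le_imp_le) (use R in simp)
  show "csqrt z \<noteq> 0" using nz by simp
qed

text \<open>
  At \<open>(1, \<eta>)\<close> the equation \<open>h = G z + z \<Phi> h\<close> cannot be solved for \<open>h\<close>, because \<open>\<Phi>' \<eta> = 1\<close>. Put
  \<open>z = 1 - s\<^sup>2\<close> and \<open>h = \<eta> - s y\<close>. All terms of the equation are then divisible by \<open>s\<^sup>2\<close>, and the
  quotient equation at \<open>s = 0\<close> reads \<open>a y\<^sup>2 = p\<close>. Its root \<open>y = \<surd>(p/a)\<close> is simple, so the implicit
  function theorem yields \<open>y\<close>, and with it \<open>h\<close>, as a holomorphic function of \<open>s\<close>. Solutions with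
  \<open>Re h \<le> Re \<eta>\<close> belong to this root and not to its negative.
\<close>

lemma square_root_singularity:
  fixes G \<Phi> :: "complex \<Rightarrow> complex" and \<eta> :: complex and p a :: real
  assumes r: "r > 0"
    and G: "G holomorphic_on ball 1 r" and \<Phi>: "\<Phi> holomorphic_on ball \<eta> r"
    and fix1: "\<eta> = G 1 + \<Phi> \<eta>"
    and d1: "deriv \<Phi> \<eta> = 1" and d2: "deriv (deriv \<Phi>) \<eta> = of_real (2 * a)" and a: "a > 0"
    and p: "deriv G 1 + \<Phi> \<eta> = of_real p" "p > 0"
  obtains K \<delta> \<epsilon> where "\<delta> > 0" "\<epsilon> > 0" "K holomorphic_on ball 0 \<delta>" "deriv K 0 = - of_real (sqrt (p / a))"
    "\<And>z h. dist z 1 < \<epsilon> \<Longrightarrow> norm z < 1 \<Longrightarrow> dist h \<eta> < \<epsilon> \<Longrightarrow> Re h \<le> Re \<eta> \<Longrightarrow>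
       h = G z + z * \<Phi> h \<Longrightarrow> csqrt (1 - z) \<in> ball 0 \<delta> \<and> h = K (csqrt (1 - z))"
proof -
  define g where "g z = (if z = 1 then deriv G 1 else (G z - G 1) / (z - 1))" for z
  define \<phi>1 where "\<phi>1 h = (if h = \<eta> then deriv \<Phi> \<eta> else (\<Phi> h - \<Phi> \<eta>) / (h - \<eta>))" for h
  define \<phi> where "\<phi> h = (if h = \<eta> then deriv \<phi>1 \<eta> else (\<phi>1 h - \<phi>1 \<eta>) / (h - \<eta>))" for h
  have g_hol: "g holomorphic_on ball 1 r"
    unfolding g_def by (rule pole_lemma_open[OF G]) auto
  have \<phi>1_hol: "\<phi>1 holomorphic_on ball \<eta> r"
    unfolding \<phi>1_def by (rule pole_lemma_open[OF \<Phi>]) auto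
  have \<phi>_hol: "\<phi> holomorphic_on ball \<eta> r"
    unfolding \<phi>_def by (rule pole_lemma_open[OF \<phi>1_hol]) auto
  have G1: "G 1 = \<eta> - \<Phi> \<eta>" by (subst fix1) simp
  have G_eq: "G z = G 1 + (z - 1) * g z" for z by (simp add: g_def)
  have \<Phi>_eq: "\<Phi> h = \<Phi> \<eta> + (h - \<eta>) + (h - \<eta>)\<^sup>2 * \<phi> h" for h
  proof -
    have "(h - \<eta>) * \<phi>1 h = \<Phi> h - \<Phi> \<eta>" by (simp add: \<phi>1_def)
    moreover have "(h - \<eta>) * \<phi> h = \<phi>1 h - 1" using d1 by (simp add: \<phi>_def) (simp add: \<phi>1_def)
    ultimately have "(h - \<eta>)\<^sup>2 * \<phi> h = (\<Phi> h - \<Phi> \<eta>) - (h - \<eta>)"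
      using d1 by (simp only: power2_eq_square mult.assoc) (simp add: algebra_simps)
    then show ?thesis by simp
  qed
  have \<phi>_\<eta>: "\<phi> \<eta> = of_real a"
  proof -
    have d\<Phi>: "1 + 2 * (h - \<eta>) * \<phi> h + (h - \<eta>)\<^sup>2 * deriv \<phi> h = deriv \<Phi> h" if "h \<in> ball \<eta> r" for h
    proof -
      have *: "(\<phi> has_field_derivative deriv \<phi> h) (at h)"
        using that \<phi>_hol by (meson holomorphic_derivI open_ball)
      have "((\<lambda>h. \<Phi> \<eta> + (h - \<eta>) + (h - \<eta>)\<^sup>2 * \<phi> h) has_field_derivative
              1 + 2 * (h - \<eta>) * \<phi> h + (h - \<eta>)\<^sup>2 * deriv \<phi> h) (at h)"
        by (rule derivative_eq_intros * refl)+ simp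
      moreover have "(\<lambda>h. \<Phi> \<eta> + (h - \<eta>) + (h - \<eta>)\<^sup>2 * \<phi> h) = \<Phi>"
        by (rule ext, rule \<Phi>_eq[symmetric])
      ultimately have "(\<Phi> has_field_derivative 1 + 2 * (h - \<eta>) * \<phi> h + (h - \<eta>)\<^sup>2 * deriv \<phi> h) (at h)"
        by simp
      then show ?thesis by (rule DERIV_imp_deriv[symmetric])
    qed
    have "((\<lambda>h. 1 + 2 * (h - \<eta>) * \<phi> h + (h - \<eta>)\<^sup>2 * deriv \<phi> h) has_field_derivative
              2 * \<phi> \<eta>) (at \<eta>)"
    proof -
      have 1: "(\<phi> has_field_derivative deriv \<phi> \<eta>) (at \<eta>)"
        using r \<phi>_hol by (intro holomorphic_derivI[of _ "ball \<eta> r"]) auto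
      have 2: "(deriv \<phi> has_field_derivative deriv (deriv \<phi>) \<eta>) (at \<eta>)"
        using r \<phi>_hol by (intro holomorphic_derivI[of _ "ball \<eta> r"] holomorphic_deriv) auto
      show ?thesis by (rule derivative_eq_intros 1 2 refl)+ simp
    qed
    then have "(deriv \<Phi> has_field_derivative 2 * \<phi> \<eta>) (at \<eta>)"
      by (rule has_field_derivative_transform_within_open[OF _ open_ball[of \<eta> r]]) (use d\<Phi> r in auto)
    then show ?thesis using d2 DERIV_imp_deriv by fastforce
  qed
  define k where "k = sqrt (p / a)"
  have k: "k > 0" "k\<^sup>2 * a = p" using a p by (simp_all add: k_def)
  have g1: "g 1 + \<Phi> \<eta> = (of_real k)\<^sup>2 * of_real a"
    using k(2) p(1) by (simp add: g_def flip: of_real_power of_real_mult)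
  \<comment> \<open>the equation \<open>h = G z + z \<Phi> h\<close> with \<open>z = 1 - s\<^sup>2\<close> and \<open>h = \<eta> - s y\<close>, divided by \<open>s\<^sup>2\<close>\<close>
  define E where "E s y = (1 - s\<^sup>2) * y\<^sup>2 * \<phi> (\<eta> - s * y) + s * y - g (1 - s\<^sup>2) - \<Phi> \<eta>" for s y
  define E' where "E' s y = (1 - s\<^sup>2) * (2 * y * \<phi> (\<eta> - s * y) - y\<^sup>2 * s * deriv \<phi> (\<eta> - s * y)) + s" for s y
  define r' where "r' = min (min 1 (r / 2)) (r / (2 * (k + 2)))"
  have r': "r' > 0" "r' \<le> 1" "r' \<le> r / 2" and "r' \<le> r / (2 * (k + 2))"
    unfolding r'_def using r k by (simp, linarith+)
  then have "r' * (k + 2) \<le> r / (2 * (k + 2)) * (k + 2)"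
    using k by (intro mult_right_mono) auto
  moreover have halve: "r / (2 * D) * D = r / 2" if "D > 0" for D :: real using that by simp
  have "r / (2 * (k + 2)) * (k + 2) = r / 2" by (rule halve) (use k in simp)
  ultimately have r'4: "r' * (k + 2) \<le> r / 2" by (simp only:)
  have in1: "1 - s\<^sup>2 \<in> ball 1 r" if "s \<in> ball 0 r'" for s :: complex
  proof -
    have "norm s * norm s \<le> 1 * norm s" using that r' by (intro mult_right_mono) auto
    then have "norm (s\<^sup>2) < r" using that r' r by (simp add: norm_mult power2_eq_square)
    then show ?thesis by (simp add: dist_norm)
  qed
  have in2: "\<eta> - s * y \<in> ball \<eta> r" if "s \<in> ball 0 r'" "y \<in> ball (of_real k) r'" for s y :: complex
  proof -
    have "norm y \<le> norm (of_real k :: complex) + norm (y - of_real k)" by norm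
    also have "\<dots> \<le> k + 2" using that r' k by (auto simp: dist_norm norm_minus_commute)
    finally have "norm s * norm y \<le> r' * (k + 2)" using that r' by (intro mult_mono) auto
    then show ?thesis using r'4 r by (simp add: dist_norm norm_mult)
  qed
  have der: "(E s has_field_derivative E' s y) (at y)"
    if "s \<in> ball 0 r'" "y \<in> ball (of_real k) r'" for s y
  proof -
    have *: "(\<phi> has_field_derivative deriv \<phi> (\<eta> - s * y)) (at (\<eta> - s * y))"
      using in2[OF that] \<phi>_hol by (meson holomorphic_derivI open_ball)
    have **: "((\<lambda>y. \<eta> - s * y) has_field_derivative - s) (at y)"
      by (rule derivative_eq_intros refl)+ simp
    note *** = DERIV_chain2[OF * **]
    show ?thesis
      unfolding E_def E'_def
      by (rule derivative_eq_intros *** refl)+ (simp add: algebra_simps power2_eq_square)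
  qed
  have cont_\<phi>: "isCont \<phi> \<eta>" "isCont (deriv \<phi>) \<eta>"
    using \<phi>_hol r holomorphic_deriv[OF \<phi>_hol open_ball]
    by (auto dest!: holomorphic_on_imp_continuous_on simp: continuous_on_eq_continuous_at)
  obtain Y \<delta> \<epsilon> where Y: "\<delta> > 0" "\<delta> \<le> r'" "\<epsilon> > 0" "Y holomorphic_on ball 0 \<delta>"
    "\<And>s y. s \<in> ball 0 \<delta> \<Longrightarrow> y \<in> ball (of_real k) \<epsilon> \<Longrightarrow> E s y = 0 \<longleftrightarrow> y = Y s"
  proof (rule holomorphic_implicit_function[of r' 0 "of_real k" E E'])
    show "isCont (\<lambda>(s, y). E' s y) (0, of_real k)"
    proof -
      have "isCont (\<lambda>q. \<eta> - fst q * snd q) (0, complex_of_real k)" by (intro continuous_intros)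
      then have "isCont (\<lambda>q. \<phi> (\<eta> - fst q * snd q)) (0, complex_of_real k)"
        "isCont (\<lambda>q. deriv \<phi> (\<eta> - fst q * snd q)) (0, complex_of_real k)"
        using isCont_o2[of "(0, complex_of_real k)" "\<lambda>q. \<eta> - fst q * snd q"] cont_\<phi> by auto
      then show ?thesis
        unfolding E'_def case_prod_unfold by (intro continuous_intros)
    qed
    show "(\<lambda>s. E s (f s)) holomorphic_on S"
      if "open S" "S \<subseteq> ball 0 r'" "f holomorphic_on S" "f ` S \<subseteq> ball (of_real k) r'" for f S
    proof -
      have "s \<in> ball 0 r'" "f s \<in> ball (of_real k) r'" if "s \<in> S" for s
        using that \<open>S \<subseteq> _\<close> \<open>f ` S \<subseteq> _\<close> by blast+
      then have im: "(\<lambda>s. \<eta> - s * f s) ` S \<subseteq> ball \<eta> r" "(\<lambda>s. 1 - s\<^sup>2) ` S \<subseteq> ball 1 r"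
        using in1 in2 by blast+
      have "(\<lambda>s. \<phi> (\<eta> - s * f s)) holomorphic_on S"
        by (rule holomorphic_on_compose_gen[of _ S \<phi> "ball \<eta> r", unfolded o_def])
           (use that im \<phi>_hol in \<open>auto intro!: holomorphic_intros\<close>)
      moreover have "(\<lambda>s. g (1 - s\<^sup>2)) holomorphic_on S"
        by (rule holomorphic_on_compose_gen[of _ S g "ball 1 r", unfolded o_def])
           (use that im g_hol in \<open>auto intro!: holomorphic_intros\<close>)
      ultimately show ?thesis
        unfolding E_def using that by (intro holomorphic_intros)
    qed
    show "E 0 (of_real k) = 0"
      using g1 by (simp add: E_def \<phi>_\<eta> diff_diff_eq)
    show "E' 0 (of_real k) \<noteq> 0"
      using k a by (simp add: E'_def \<phi>_\<eta>)
  qed (use r' der in auto)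
  have Y0: "Y 0 = of_real k"
    using Y(5)[of 0 "of_real k"] Y(1,3) g1 by (simp add: E_def \<phi>_\<eta> diff_diff_eq)
  define K where "K s = \<eta> - s * Y s" for s
  have "(Y has_field_derivative deriv Y 0) (at 0)"
    using Y by (intro holomorphic_derivI[of _ "ball 0 \<delta>"]) auto
  then have "(K has_field_derivative - of_real k) (at 0)"
    unfolding K_def by (auto intro!: derivative_eq_intros simp: Y0)
  then have K': "deriv K 0 = - of_real k" by (rule DERIV_imp_deriv)
  \<comment> \<open>The square of \<open>y\<close> will be \<open>q z h\<close>, which is close to \<open>k\<^sup>2\<close> near \<open>(1, \<eta>)\<close>; so \<open>y\<close> is close to \<open>k\<close>
    or to \<open>- k\<close>.\<close>
  define q where "q z h = (g z + \<Phi> \<eta> - (\<eta> - h)) / (z * \<phi> h)" for z h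
  have "isCont g 1" using g_hol r
    by (auto dest!: holomorphic_on_imp_continuous_on simp: continuous_on_eq_continuous_at)
  then have "isCont (\<lambda>u. g (fst u)) (1, \<eta>)" "isCont (\<lambda>u. \<phi> (snd u)) (1, \<eta>)"
    using cont_\<phi> isCont_o2[of "(1, \<eta>)" fst g] isCont_o2[of "(1, \<eta>)" snd \<phi>]
    by (auto intro!: continuous_intros)
  then have "isCont (\<lambda>u. q (fst u) (snd u)) (1, \<eta>)"
    unfolding q_def by (intro continuous_intros) (use \<phi>_\<eta> a in auto)
  moreover have "q 1 \<eta> = of_real (k\<^sup>2)"
    using a g1 by (simp add: q_def \<phi>_\<eta>)
  moreover have "\<epsilon> * k / 2 > 0" using Y k by simp
  ultimately obtain \<delta>1 where \<delta>1: "\<delta>1 > 0"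
    "\<And>u. dist u (1, \<eta>) < \<delta>1 \<Longrightarrow> dist (q (fst u) (snd u)) (of_real (k\<^sup>2)) < \<epsilon> * k / 2"
    unfolding continuous_at_eps_delta by (metis fst_conv snd_conv)
  have "((\<lambda>h. \<phi> h) \<longlongrightarrow> \<phi> \<eta>) (nhds \<eta>)" using cont_\<phi>(1)
    by (simp add: isCont_def continuous_at tendsto_at_iff_tendsto_nhds)
  then have "\<forall>\<^sub>F h in nhds \<eta>. \<phi> h \<noteq> 0"
    by (rule tendsto_imp_eventually_ne) (use \<phi>_\<eta> a in auto)
  then obtain \<delta>2 where \<delta>2: "\<delta>2 > 0" "\<And>h. dist h \<eta> < \<delta>2 \<Longrightarrow> \<phi> h \<noteq> 0"
    unfolding eventually_nhds_metric by blast
  define \<delta>' where "\<delta>' = Min {\<delta>, \<delta>\<^sup>2, \<delta>1 / 2, \<delta>2, 1}"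
  have \<delta>': "\<delta>' > 0" "\<delta>' \<le> \<delta>" "\<delta>' \<le> \<delta>\<^sup>2" "\<delta>' \<le> \<delta>1 / 2" "\<delta>' \<le> \<delta>2" "\<delta>' \<le> 1"
    using Y \<delta>1 \<delta>2 by (auto simp: \<delta>'_def)
  have main: "csqrt (1 - z) \<in> ball 0 \<delta> \<and> h = K (csqrt (1 - z))"
    if z: "dist z 1 < \<delta>'" "norm z < 1" and h: "dist h \<eta> < \<delta>'" "Re h \<le> Re \<eta>" "h = G z + z * \<Phi> h" for z h
  proof -
    define s where "s = csqrt (1 - z)"
    define X where "X = \<eta> - h"
    define y where "y = X / s"
    have "Re (1 - z) > 0" using z(2) complex_Re_le_cmod[of z] by simp
    note s = csqrt_half_plane[OF this, folded s_def]
    have s2: "s\<^sup>2 = 1 - z" by (simp add: s_def)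
    have z0: "z \<noteq> 0" using z \<delta>' by auto
    have ds: "s \<in> ball 0 \<delta>"
    proof -
      have "(norm s)\<^sup>2 < \<delta>\<^sup>2" using s2 z \<delta>' by (simp add: dist_norm norm_minus_commute flip: norm_power)
      then show ?thesis using Y(1) by (simp add: power2_less_imp_less)
    qed
    have Xs: "X = s * y" "h = \<eta> - s * y" using s by (auto simp: y_def X_def)
    have "G z + z * \<Phi> h - h = 0" using h(3) by simp
    then have "(z - 1) * (g z + \<Phi> \<eta>) + (1 - z) * X + z * X\<^sup>2 * \<phi> h = 0"
      unfolding G_eq[of z] \<Phi>_eq[of h] X_def G1 by (simp add: algebra_simps power2_eq_square)
    moreover have "z - 1 = - s\<^sup>2" "1 - z = s\<^sup>2" using s2 by simp_all
    ultimately have "(- s\<^sup>2) * (g z + \<Phi> \<eta>) + s\<^sup>2 * X + z * (s * y)\<^sup>2 * \<phi> h = 0"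
      using Xs(1) by simp
    then have "s\<^sup>2 * (z * y\<^sup>2 * \<phi> h + X - g z - \<Phi> \<eta>) = 0"
      by (simp add: algebra_simps power2_eq_square)
    then have eq': "z * y\<^sup>2 * \<phi> h + X - g z - \<Phi> \<eta> = 0" using s by simp
    have E0: "E s y = 0"
      using eq' unfolding E_def Xs(2)[symmetric] s2 by (simp add: Xs)
    have "y\<^sup>2 = q z h"
      using eq' z0 \<delta>2(2)[of h] h(1) \<delta>' by (simp add: q_def X_def field_simps)
    moreover have "dist (z, h) (1, \<eta>) < \<delta>1"
    proof -
      have "dist (z, h) (1, \<eta>) \<le> dist z 1 + dist h \<eta>"
        by (simp add: dist_Pair_Pair sqrt_sum_squares_le_sum)
      then show ?thesis using z(1) h(1) \<delta>' by linarith
    qed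
    ultimately have "norm (y\<^sup>2 - of_real (k\<^sup>2)) < \<epsilon> * k / 2"
      using \<delta>1(2)[of "(z, h)"] by (simp add: dist_norm)
    then have "norm (y - of_real k) * norm (y + of_real k) < \<epsilon> * k / 2"
      by (simp add: power2_eq_square flip: norm_mult) (simp add: algebra_simps)
    \<comment> \<open>\<open>Re X \<ge> 0\<close> and \<open>Re s \<ge> |s|/2\<close> keep \<open>y = X/s\<close> away from \<open>- k\<close>.\<close>
    moreover have "k / 2 \<le> norm (y + of_real k)"
    proof -
      have "k / 2 * norm s \<le> k * Re s" using mult_left_mono[OF s(1), of "k / 2"] k by simp
      also have "\<dots> \<le> Re (X + of_real k * s)" using h(2) by (simp add: X_def)
      also have "\<dots> \<le> norm (X + of_real k * s)" by (rule complex_Re_le_cmod)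
      also have "X + of_real k * s = (y + of_real k) * s" by (simp add: Xs algebra_simps)
      finally show ?thesis using s by (simp add: norm_mult)
    qed
    ultimately have "norm (y - of_real k) * (k / 2) < \<epsilon> * (k / 2)"
      by (smt (verit) mult_left_mono norm_ge_zero times_divide_eq_right)
    then have "norm (y - of_real k) < \<epsilon>" using k by simp
    then have "y = Y s" using Y(5)[OF ds, of y] E0 by (simp add: dist_norm norm_minus_commute)
    then show ?thesis using ds Xs unfolding K_def s_def by simp
  qed
  have Khol: "K holomorphic_on ball 0 \<delta>"
    unfolding K_def using Y by (intro holomorphic_intros) auto
  show ?thesis
    by (rule that[of \<delta> \<delta>' K]) (use Y \<delta>' Khol K' main in \<open>auto simp: k_def\<close>)
qed

section \<open>Coefficient bounds from the growth of the third derivative\<close>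

text \<open>
  The exponent \<open>-1/2\<close> is the one that a term \<open>(1 - z)\<^bsup>5/2\<^esup>\<close> produces in the third derivative, and
  it is mild enough for Cauchy's inequality to give coefficients of order \<open>n\<^bsup>-5/2\<^esup>\<close>. The
  condition is local, so each singularity on the circle can be treated on its own.
\<close>

definition d3_bounded_near :: "(complex \<Rightarrow> complex) \<Rightarrow> complex \<Rightarrow> bool" where
  "d3_bounded_near f z0 \<longleftrightarrow> (\<exists>\<epsilon>>0. \<exists>C. f holomorphic_on ball z0 \<epsilon> \<inter> ball 0 1 \<and>
     (\<forall>z \<in> ball z0 \<epsilon> \<inter> ball 0 1. norm ((deriv ^^ 3) f z) \<le> C / sqrt (1 - norm z)))"

lemma d3_bounded_near_cong:
  assumes "d3_bounded_near f z0" "\<epsilon>' > 0" "\<And>z. z \<in> ball z0 \<epsilon>' \<inter> ball 0 1 \<Longrightarrow> f z = g z"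
  shows "d3_bounded_near g z0"
proof -
  obtain \<epsilon> C where \<epsilon>: "\<epsilon> > 0" "f holomorphic_on ball z0 \<epsilon> \<inter> ball 0 1"
    "\<And>z. z \<in> ball z0 \<epsilon> \<inter> ball 0 1 \<Longrightarrow> norm ((deriv ^^ 3) f z) \<le> C / sqrt (1 - norm z)"
    using assms(1) unfolding d3_bounded_near_def by blast
  define V where "V = ball z0 (min \<epsilon> \<epsilon>') \<inter> ball 0 1"
  have V: "open V" "\<And>z. z \<in> V \<Longrightarrow> f z = g z" "V \<subseteq> ball z0 \<epsilon> \<inter> ball 0 1"
    using assms(3) by (auto simp: V_def)
  have fhol: "f holomorphic_on V" using \<epsilon>(2) V(3) by (rule holomorphic_on_subset)
  then have ghol: "g holomorphic_on V" using V(2) holomorphic_transform by blast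
  have "norm ((deriv ^^ 3) g z) \<le> C / sqrt (1 - norm z)" if "z \<in> V" for z
    using higher_deriv_transform_within_open[OF fhol ghol V(1) that V(2), of 3] \<epsilon>(3)[of z] V(3) that
    by (metis subsetD)
  then show ?thesis
    unfolding d3_bounded_near_def using \<epsilon>(1) assms(2) ghol
    by (intro exI[of _ "min \<epsilon> \<epsilon>'"] conjI exI[of _ C] ballI) (auto simp: V_def)
qed

lemma d3_bounded_near_add:
  assumes "d3_bounded_near f z0" "d3_bounded_near g z0"
  shows "d3_bounded_near (\<lambda>z. f z + g z) z0"
proof -
  obtain \<epsilon> C where \<epsilon>: "\<epsilon> > 0" "f holomorphic_on ball z0 \<epsilon> \<inter> ball 0 1"
    "\<And>z. z \<in> ball z0 \<epsilon> \<inter> ball 0 1 \<Longrightarrow> norm ((deriv ^^ 3) f z) \<le> C / sqrt (1 - norm z)"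
    using assms(1) unfolding d3_bounded_near_def by blast
  obtain \<epsilon>' C' where \<epsilon>': "\<epsilon>' > 0" "g holomorphic_on ball z0 \<epsilon>' \<inter> ball 0 1"
    "\<And>z. z \<in> ball z0 \<epsilon>' \<inter> ball 0 1 \<Longrightarrow> norm ((deriv ^^ 3) g z) \<le> C' / sqrt (1 - norm z)"
    using assms(2) unfolding d3_bounded_near_def by blast
  define V where "V = ball z0 (min \<epsilon> \<epsilon>') \<inter> ball 0 1"
  have V: "open V" "V \<subseteq> ball z0 \<epsilon> \<inter> ball 0 1" "V \<subseteq> ball z0 \<epsilon>' \<inter> ball 0 1"
    by (auto simp: V_def)
  have hol: "f holomorphic_on V" "g holomorphic_on V"
    using \<epsilon>(2) \<epsilon>'(2) V(2,3) by (meson holomorphic_on_subset)+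
  have "norm ((deriv ^^ 3) (\<lambda>z. f z + g z) z) \<le> (C + C') / sqrt (1 - norm z)" if "z \<in> V" for z
  proof -
    have "norm ((deriv ^^ 3) f z + (deriv ^^ 3) g z) \<le> C / sqrt (1 - norm z) + C' / sqrt (1 - norm z)"
      using that V \<epsilon>(3)[of z] \<epsilon>'(3)[of z]
      by (intro order.trans[OF norm_triangle_ineq] add_mono) blast+
    then show ?thesis
      using higher_deriv_add[OF hol V(1) that, of 3] by (simp add: add_divide_distrib)
  qed
  moreover have "(\<lambda>z. f z + g z) holomorphic_on V" using hol by (intro holomorphic_intros)
  ultimately show ?thesis
    unfolding d3_bounded_near_def using \<epsilon>(1) \<epsilon>'(1)
    by (intro exI[of _ "min \<epsilon> \<epsilon>'"] conjI exI[of _ "C + C'"] ballI) (auto simp: V_def)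
qed

lemma holomorphic_bounded_on_cball:
  fixes f :: "complex \<Rightarrow> complex"
  assumes "f holomorphic_on ball z0 \<epsilon>" "r < \<epsilon>"
  obtains C where "C \<ge> 0" "\<And>z. dist z0 z \<le> r \<Longrightarrow> norm (f z) \<le> C"
proof -
  have "continuous_on (cball z0 r) f"
    using assms by (intro continuous_on_subset[OF holomorphic_on_imp_continuous_on]) auto
  then have "compact (f ` cball z0 r)" by (intro compact_continuous_image) auto
  then have "bounded (f ` cball z0 r)" by (rule compact_imp_bounded)
  then obtain C where "C > 0" "\<forall>x \<in> f ` cball z0 r. norm x \<le> C"
    using bounded_pos by blast
  then show ?thesis using that[of C] by auto
qed

lemma d3_bounded_near_holomorphic:
  assumes "f holomorphic_on ball z0 \<epsilon>" "\<epsilon> > 0"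
  shows "d3_bounded_near f z0"
proof -
  have "(deriv ^^ 3) f holomorphic_on ball z0 \<epsilon>"
    by (intro holomorphic_higher_deriv assms) auto
  then obtain C where C0: "C \<ge> 0" and C: "\<And>z. dist z0 z \<le> \<epsilon> / 2 \<Longrightarrow> norm ((deriv ^^ 3) f z) \<le> C"
    by (rule holomorphic_bounded_on_cball[of _ _ _ "\<epsilon> / 2"]) (use assms in auto)
  have "norm ((deriv ^^ 3) f z) \<le> C / sqrt (1 - norm z)" if "z \<in> ball z0 (\<epsilon> / 2) \<inter> ball 0 1" for z
  proof -
    have "norm ((deriv ^^ 3) f z) \<le> C" using C that by auto
    also have "C / 1 \<le> C / sqrt (1 - norm z)" using that C0 by (intro divide_left_mono) auto
    finally show ?thesis by simp
  qed
  moreover have "f holomorphic_on ball z0 (\<epsilon> / 2) \<inter> ball 0 1"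
    using assms by (auto intro: holomorphic_on_subset)
  ultimately show ?thesis unfolding d3_bounded_near_def using assms(2) by (intro exI[of _ "\<epsilon> / 2"] conjI exI[of _ C] ballI) auto
qed

lemma d3_bounded_near_rotate:
  assumes "d3_bounded_near f (\<zeta> * z0)" "norm \<zeta> = 1"
  shows "d3_bounded_near (\<lambda>z. c * f (\<zeta> * z)) z0"
proof -
  obtain \<epsilon> C where \<epsilon>: "\<epsilon> > 0" "f holomorphic_on ball (\<zeta> * z0) \<epsilon> \<inter> ball 0 1"
    "\<And>z. z \<in> ball (\<zeta> * z0) \<epsilon> \<inter> ball 0 1 \<Longrightarrow> norm ((deriv ^^ 3) f z) \<le> C / sqrt (1 - norm z)"
    using assms(1) unfolding d3_bounded_near_def by blast
  define V W where "V = ball z0 \<epsilon> \<inter> ball 0 1" and "W = ball (\<zeta> * z0) \<epsilon> \<inter> ball 0 1"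
  have op: "open V" "open W" by (auto simp: V_def W_def)
  have in_W: "\<zeta> * z \<in> W" if "z \<in> V" for z
  proof -
    have "dist (\<zeta> * z0) (\<zeta> * z) = dist z0 z"
      by (simp add: dist_norm norm_mult assms(2) flip: right_diff_distrib)
    then show ?thesis using that assms(2) by (simp add: V_def W_def norm_mult)
  qed
  have fW: "f holomorphic_on W" using \<epsilon>(2) by (simp add: W_def)
  have comp: "(\<lambda>z. f (\<zeta> * z)) holomorphic_on V"
    by (rule holomorphic_on_compose_gen[of _ V f W, unfolded o_def])
       (use in_W fW in \<open>auto intro!: holomorphic_intros\<close>)
  have "norm ((deriv ^^ 3) (\<lambda>z. c * f (\<zeta> * z)) z) \<le> norm c * C / sqrt (1 - norm z)" if "z \<in> V" for z
  proof -
    have "(deriv ^^ 3) (\<lambda>z. c * f (\<zeta> * z)) z = c * (deriv ^^ 3) (\<lambda>z. f (\<zeta> * z)) z"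
      by (rule higher_deriv_cmult[OF comp that op(1)])
    also have "(deriv ^^ 3) (\<lambda>z. f (\<zeta> * z)) z = \<zeta> ^ 3 * (deriv ^^ 3) f (\<zeta> * z)"
      by (rule higher_deriv_compose_linear[OF fW op that in_W])
    also have "norm (c * \<dots>) = norm c * norm ((deriv ^^ 3) f (\<zeta> * z))"
      using assms(2) by (simp add: norm_mult norm_power)
    also have "\<dots> \<le> norm c * (C / sqrt (1 - norm (\<zeta> * z)))"
      using \<epsilon>(3)[of "\<zeta> * z"] in_W[OF that] by (intro mult_left_mono) (auto simp: W_def)
    finally show ?thesis using assms(2) by (simp add: norm_mult)
  qed
  moreover have "(\<lambda>z. c * f (\<zeta> * z)) holomorphic_on V" using comp by (intro holomorphic_intros)
  ultimately show ?thesis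
    unfolding d3_bounded_near_def using \<epsilon>(1) V_def by blast
qed

lemma not_nonpos_Reals_of_Re_pos: "Re z > 0 \<Longrightarrow> z \<notin> \<real>\<^sub>\<le>\<^sub>0"
  by (auto simp: complex_nonpos_Reals_iff)

text \<open>
  A point \<open>z\<close> of the disc has distance at least \<open>|1 - z|\<close> from the cut \<open>[1, \<infinity>)\<close>. So the function is
  holomorphic on the disc of radius \<open>t/2\<close> about \<open>z\<close>, where \<open>t = |1 - z|\<close>, and bounded there by a
  multiple of \<open>t\<^bsup>5/2\<^esup>\<close>. Cauchy's inequality bounds the third derivative by a multiple of
  \<open>t\<^bsup>5/2\<^esup> / t\<^sup>3 = t\<^bsup>-1/2\<^esup>\<close>, and \<open>t \<ge> 1 - |z|\<close>.
\<close>

lemma d3_bounded_near_sqrt: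
  assumes M: "M holomorphic_on ball 0 \<delta>" and "\<delta> > 0"
  shows "d3_bounded_near (\<lambda>z. csqrt (1 - z) ^ 5 * M (csqrt (1 - z))) 1"
proof -
  define b where "b z = csqrt (1 - z) ^ 5 * M (csqrt (1 - z))" for z
  obtain B where B0: "B \<ge> 0" and B: "\<And>s. dist 0 s \<le> \<delta> / 2 \<Longrightarrow> norm (M s) \<le> B"
    by (rule holomorphic_bounded_on_cball[OF M, of "\<delta> / 2"]) (use assms in auto)
  define N where "N = {z \<in> ball (1::complex) (\<delta>\<^sup>2 / 4). 1 - z \<notin> \<real>\<^sub>\<le>\<^sub>0}"
  have small: "csqrt (1 - z) \<in> cball 0 (\<delta> / 2) \<and> csqrt (1 - z) \<in> ball 0 \<delta>" if "dist 1 z < \<delta>\<^sup>2 / 4" for z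
  proof -
    have "norm (csqrt (1 - z)) = sqrt (dist 1 z)" by (simp add: dist_norm norm_csqrt)
    also have "\<dots> < sqrt ((\<delta> / 2)\<^sup>2)" using that by (intro real_sqrt_less_mono) (simp add: power_divide)
    also have "\<dots> = \<delta> / 2" using assms(2) by simp
    finally have "norm (csqrt (1 - z)) < \<delta> / 2" .
    then show ?thesis using assms(2) by simp
  qed
  have b_hol: "b holomorphic_on N"
  proof -
    have s: "(\<lambda>z. csqrt (1 - z)) holomorphic_on N"
      by (rule holomorphic_on_compose_gen[of _ N csqrt "- \<real>\<^sub>\<le>\<^sub>0", unfolded o_def])
         (auto simp: N_def intro!: holomorphic_intros)
    have "(\<lambda>z. M (csqrt (1 - z))) holomorphic_on N"
      by (rule holomorphic_on_compose_gen[of _ N M "ball 0 \<delta>", unfolded o_def])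
         (use s M small in \<open>auto simp: N_def\<close>)
    with s show ?thesis unfolding b_def by (intro holomorphic_on_mult holomorphic_on_power)
  qed
  define \<epsilon> where "\<epsilon> = \<delta>\<^sup>2 / 16"
  have \<epsilon>: "\<epsilon> > 0" using assms(2) by (simp add: \<epsilon>_def)
  have "norm ((deriv ^^ 3) b z) \<le> 192 * sqrt 2 * B / sqrt (1 - norm z)" if z: "z \<in> ball 1 \<epsilon> \<inter> ball 0 1" for z
  proof -
    define t where "t = norm (1 - z)"
    have Re: "Re z < 1" using complex_Re_le_cmod[of z] z by simp
    have t: "t > 0" "1 - norm z \<le> t" "t < \<epsilon>"
      using Re z norm_triangle_ineq2[of 1 z] by (auto simp: t_def dist_norm)
    have u: "u \<in> N \<and> norm (1 - u) \<le> 2 * t" if u: "dist z u \<le> t / 2" for u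
    proof -
      have "norm (1 - u) \<le> norm (1 - z) + norm (z - u)" by norm
      then have n: "norm (1 - u) \<le> 2 * t" using u t unfolding t_def dist_norm by linarith
      moreover have "1 - u \<notin> \<real>\<^sub>\<le>\<^sub>0"
      proof
        assume "1 - u \<in> \<real>\<^sub>\<le>\<^sub>0"
        then have "Re u \<ge> 1" "Im u = 0" by (auto simp: complex_nonpos_Reals_iff)
        then have "\<bar>Re (1 - z)\<bar> \<le> \<bar>Re (u - z)\<bar>" "\<bar>Im (1 - z)\<bar> \<le> \<bar>Im (u - z)\<bar>" using Re by auto
        then have "norm (1 - z) \<le> norm (u - z)"
          unfolding cmod_def by (intro real_sqrt_le_mono add_mono) (simp_all add: abs_le_square_iff)
        then show False using u t norm_minus_commute[of u z] unfolding t_def dist_norm by linarith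
      qed
      ultimately show ?thesis using t(1,3) n by (simp add: N_def \<epsilon>_def dist_norm)
    qed
    have "norm ((deriv ^^ 3) b z) \<le> fact 3 * (B * sqrt (2 * t) ^ 5) / (t / 2) ^ 3"
    proof (rule Cauchy_inequality)
      show "b holomorphic_on ball z (t / 2)" using u by (intro holomorphic_on_subset[OF b_hol]) auto
      show "continuous_on (cball z (t / 2)) b"
        using u by (intro continuous_on_subset[OF holomorphic_on_imp_continuous_on[OF b_hol]]) auto
      show "norm (b u) \<le> B * sqrt (2 * t) ^ 5" if "norm (z - u) = t / 2" for u
      proof -
        have *: "u \<in> N \<and> norm (1 - u) \<le> 2 * t" using u[of u] that by (simp add: dist_norm)
        have "norm (csqrt (1 - u)) \<le> sqrt (2 * t)" using * by (simp add: norm_csqrt)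
        then have "norm (csqrt (1 - u)) ^ 5 \<le> sqrt (2 * t) ^ 5" by (intro power_mono) auto
        moreover have "norm (M (csqrt (1 - u))) \<le> B"
          using * by (intro B) (use small[of u] in \<open>simp add: N_def\<close>)
        ultimately show ?thesis unfolding b_def norm_mult norm_power
          using B0 t by (subst mult.commute) (intro mult_mono, auto)
      qed
    qed (use t in auto)
    also have "fact 3 * (B * sqrt (2 * t) ^ 5) / (t / 2) ^ 3 = 192 * sqrt 2 * B / sqrt t"
    proof -
      have *: "sqrt (2 * t) ^ 5 = 4 * sqrt 2 * (sqrt t) ^ 5"
        using power_add[of "sqrt 2" 4 1] power_mult[of "sqrt 2" 2 2]
        by (simp add: real_sqrt_mult power_mult_distrib)
      define q where "q = sqrt t"
      have q: "q > 0" "t = q\<^sup>2" using t(1) by (simp_all add: q_def)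
      have "fact 3 * (B * (4 * sqrt 2 * q ^ 5)) / (q\<^sup>2 / 2) ^ 3 = 192 * sqrt 2 * B / q"
        using q(1) by (simp add: fact_numeral) (simp add: field_simps eval_nat_numeral)
      then show ?thesis unfolding * q_def[symmetric] using q(2) by simp
    qed
    also have "\<dots> \<le> 192 * sqrt 2 * B / sqrt (1 - norm z)"
      using t z B0 by (intro divide_left_mono) auto
    finally show ?thesis .
  qed
  moreover have "ball 1 \<epsilon> \<inter> ball 0 1 \<subseteq> N"
  proof
    fix z :: complex assume z: "z \<in> ball 1 \<epsilon> \<inter> ball 0 1"
    then have "Re (1 - z) > 0" using complex_Re_le_cmod[of z] by simp
    moreover have "dist 1 z < \<epsilon>" using z by simp
    then have "dist 1 z < \<delta>\<^sup>2 / 4" using zero_le_power2[of \<delta>] unfolding \<epsilon>_def by linarith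
    ultimately show "z \<in> N" using not_nonpos_Reals_of_Re_pos[of "1 - z"] by (simp add: N_def)
  qed
  ultimately have "d3_bounded_near b 1"
    unfolding d3_bounded_near_def using \<epsilon> holomorphic_on_subset[OF b_hol] by blast
  then show ?thesis by (simp only: b_def[abs_def])
qed

text \<open>
  Finitely many of the neighbourhoods cover the closed disc, by compactness.
\<close>

lemma d3_bounded_if_near:
  assumes "\<And>z. norm z \<le> 1 \<Longrightarrow> d3_bounded_near f z"
  obtains C where "C \<ge> 0" "\<And>z. norm z < 1 \<Longrightarrow> norm ((deriv ^^ 3) f z) \<le> C / sqrt (1 - norm z)"
proof -
  have "\<forall>z0\<in>cball 0 1. \<exists>\<epsilon> C. \<epsilon> > 0 \<and> (\<forall>z \<in> ball z0 \<epsilon> \<inter> ball 0 1. norm ((deriv ^^ 3) f z) \<le> C / sqrt (1 - norm z))"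
    using assms unfolding d3_bounded_near_def by (force simp del: ball_simps)
  then obtain \<epsilon> C where \<epsilon>: "\<And>z0::complex. z0 \<in> cball 0 1 \<Longrightarrow> \<epsilon> z0 > 0"
    "\<And>z0 z. z0 \<in> cball 0 1 \<Longrightarrow> z \<in> ball z0 (\<epsilon> z0) \<Longrightarrow> norm z < 1 \<Longrightarrow>
       norm ((deriv ^^ 3) f z) \<le> C z0 / sqrt (1 - norm z)"
    by (metis IntI mem_ball_0)
  have "compact (cball (0::complex) 1)" by simp
  then obtain T where T: "T \<subseteq> cball 0 1" "finite T" "cball (0::complex) 1 \<subseteq> (\<Union>z0\<in>T. ball z0 (\<epsilon> z0))"
    by (rule compactE_image[of _ "cball 0 1" "\<lambda>z0. ball z0 (\<epsilon> z0)"]) (use \<epsilon>(1) in auto)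
  define B where "B = (\<Sum>z0\<in>T. \<bar>C z0\<bar>)"
  show ?thesis
  proof (rule that[of B])
    show "B \<ge> 0" by (simp add: B_def sum_nonneg)
    fix z :: complex assume z: "norm z < 1"
    then have "z \<in> (\<Union>z0\<in>T. ball z0 (\<epsilon> z0))" by (intro subsetD[OF T(3)]) simp
    then obtain z0 where z0: "z0 \<in> T" "z \<in> ball z0 (\<epsilon> z0)" by auto
    have "norm ((deriv ^^ 3) f z) \<le> C z0 / sqrt (1 - norm z)" using \<epsilon>(2) z0 z T(1) by blast
    moreover have "C z0 \<le> B"
      using member_le_sum[of z0 T "\<lambda>z0. \<bar>C z0\<bar>"] z0(1) T(2) unfolding B_def by auto
    then have "C z0 / sqrt (1 - norm z) \<le> B / sqrt (1 - norm z)"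
      using z by (intro divide_right_mono) auto
    ultimately show "norm ((deriv ^^ 3) f z) \<le> B / sqrt (1 - norm z)" by linarith
  qed
qed

text \<open>
  Cauchy's inequality for the third derivative on the circle of radius \<open>1 - 1/n\<close>, on which the
  assumed bound is \<open>C \<surd>n\<close>; passing back to the function itself divides the coefficient by a quantity
  of order \<open>n\<^sup>3\<close>.
\<close>

lemma coeff_bound_of_third_deriv:
  assumes hol: "f holomorphic_on ball 0 1"
    and C: "C \<ge> 0" "\<And>z. norm z < 1 \<Longrightarrow> norm ((deriv ^^ 3) f z) \<le> C / sqrt (1 - norm z)"
  shows "(\<lambda>n. (deriv ^^ n) f 0 / fact n) \<in> O(\<lambda>n. of_real (real n powr (-5/2)))"
proof (rule bigoI[of _ "8 * exp 2 * C"], rule eventually_sequentiallyI[of 4])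
  fix n :: nat assume n: "n \<ge> 4"
  obtain m where m: "n = m + 3" using n le_Suc_ex[of 3 n] by auto
  define r where "r = 1 - 1 / real n"
  have r: "0 < r" "r < 1" using n by (auto simp: r_def field_simps)
  have hol3: "(deriv ^^ 3) f holomorphic_on ball 0 1" by (intro holomorphic_higher_deriv hol) auto
  have "norm ((deriv ^^ (n - 3)) ((deriv ^^ 3) f) 0) \<le> fact (n - 3) * (C * sqrt n) / r ^ (n - 3)"
  proof (rule Cauchy_inequality)
    show "(deriv ^^ 3) f holomorphic_on ball 0 r"
      using r by (intro holomorphic_on_subset[OF hol3]) auto
    show "continuous_on (cball 0 r) ((deriv ^^ 3) f)"
      using r by (intro continuous_on_subset[OF holomorphic_on_imp_continuous_on[OF hol3]]) auto
    show "norm ((deriv ^^ 3) f z) \<le> C * sqrt n" if "norm (0 - z) = r" for z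
      using C(2)[of z] that r by (simp add: r_def real_sqrt_divide)
  qed (use r in auto)
  moreover have "(deriv ^^ (n - 3)) ((deriv ^^ 3) f) = (deriv ^^ n) f"
    by (simp only: m funpow_add comp_apply diff_add_inverse2)
  ultimately have "norm ((deriv ^^ n) f 0) \<le> fact (n - 3) * (C * sqrt n) / r ^ (n - 3)" by simp
  also have "\<dots> \<le> fact (n - 3) * (C * sqrt n) / exp (-2)"
  proof (intro divide_left_mono)
    have "- (1 / real n) - 2 * (1 / real n)\<^sup>2 \<le> ln r"
      unfolding r_def using n by (intro ln_one_minus_pos_lower_bound) (auto simp: field_simps)
    then have "real n * (- (1 / real n) - 2 * (1 / real n)\<^sup>2) \<le> real n * ln r"
      by (intro mult_left_mono) auto
    moreover have "- 2 \<le> real n * (- (1 / real n) - 2 * (1 / real n)\<^sup>2)"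
      using n by (simp add: field_simps power2_eq_square)
    ultimately have "exp (-2) \<le> exp (real n * ln r)" by simp
    also have "\<dots> = r ^ n" using r by (simp add: exp_of_nat_mult)
    also have "r ^ n \<le> r ^ (n - 3)" using r by (intro power_decreasing) auto
    finally show "exp (-2) \<le> r ^ (n - 3)" .
  qed (use C r in auto)
  finally have 1: "norm ((deriv ^^ n) f 0) \<le> exp 2 * C * sqrt n * fact (n - 3)"
    by (simp add: exp_minus field_simps)
  have "fact n = real n * (real n - 1) * (real n - 2) * fact (n - 3)"
    by (simp add: m numeral_3_eq_3 algebra_simps)
  moreover have "real n * (real n / 2) * (real n / 4) \<le> real n * (real n - 1) * (real n - 2)"
    using n by (intro mult_mono) auto
  then have "(real n * (real n / 2) * (real n / 4)) * fact (n - 3)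
      \<le> (real n * (real n - 1) * (real n - 2)) * fact (n - 3)" by (rule mult_right_mono) simp
  ultimately have 2: "real n ^ 3 / 8 * fact (n - 3) \<le> fact n" by (simp add: power3_eq_cube)
  have 3: "sqrt n / real n ^ 3 = real n powr (-5/2)"
  proof -
    have "sqrt n = real n powr (1/2)" by (simp add: powr_half_sqrt)
    moreover have "real n ^ 3 = real n powr 3" using n by simp
    ultimately have "sqrt n / real n ^ 3 = real n powr (1/2 - 3)" by (simp only: powr_diff)
    then show ?thesis by simp
  qed
  have "norm ((deriv ^^ n) f 0 / fact n) = norm ((deriv ^^ n) f 0) / fact n"
    by (simp add: norm_divide)
  also have "\<dots> \<le> (exp 2 * C * sqrt n * fact (n - 3)) / (real n ^ 3 / 8 * fact (n - 3))"
    using 1 2 n C by (intro frac_le) auto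
  also have "\<dots> = 8 * exp 2 * C * (sqrt n / real n ^ 3)" by simp
  finally show "norm ((deriv ^^ n) f 0 / fact n) \<le> 8 * exp 2 * C * norm (of_real (real n powr (-5/2)) :: complex)"
    unfolding 3 by simp
qed

section \<open>The singularities on the circle of convergence\<close>

text \<open>
  The exponents \<open>n\<close> with \<open>z\<^sup>n = 1\<close> are the multiples of the least positive one.
\<close>

lemma power_Gcd_eq_1:
  fixes z :: complex
  assumes "\<And>i. i \<in> I \<Longrightarrow> z ^ i = 1"
  shows "z ^ Gcd I = 1"
proof (cases "I \<subseteq> {0}")
  case True
  then have "Gcd I = 0" by (simp only: Gcd_0_iff)
  then show ?thesis by (simp only: power_0)
next
  case False
  then obtain j where j: "j \<in> I" "j > 0" by auto
  define e where "e = (LEAST n. n > 0 \<and> z ^ n = 1)"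
  have e: "e > 0" "z ^ e = 1"
    using LeastI[of "\<lambda>n. n > 0 \<and> z ^ n = 1" j] j assms by (auto simp: e_def)
  have "e dvd i" if "i \<in> I" for i
  proof -
    have "1 = z ^ (e * (i div e) + i mod e)" using assms[OF that] by simp
    also have "\<dots> = z ^ (i mod e)" unfolding power_add power_mult e(2) by simp
    finally have "z ^ (i mod e) = 1" by simp
    then have "\<not> i mod e > 0"
      using not_less_Least[of "i mod e" "\<lambda>n. n > 0 \<and> z ^ n = 1"] e(1) unfolding e_def[symmetric]
      by (meson mod_less_divisor)
    then show ?thesis by (simp add: dvd_eq_mod_eq_0)
  qed
  then have "e dvd Gcd I" by (rule Gcd_greatest)
  then show ?thesis using e(2) by (auto simp: power_mult elim!: dvdE)
qed

text \<open>
  The series of the nonnegative numbers \<open>a n - Re (c n)\<close> has sum 0.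
\<close>

lemma sums_norm_bound_attained:
  fixes c :: "nat \<Rightarrow> complex" and a :: "nat \<Rightarrow> real"
  assumes "c sums of_real A" "a sums A" "\<And>n. norm (c n) \<le> a n"
  shows "c n = of_real (a n)"
proof -
  have "(\<lambda>n. Re (c n)) sums A" using sums_Re[OF assms(1)] by simp
  then have "(\<lambda>n. a n - Re (c n)) sums (A - A)" by (intro sums_diff assms(2))
  moreover have nn: "a n - Re (c n) \<ge> 0" for n
    using assms(3)[of n] complex_Re_le_cmod[of "c n"] by simp
  ultimately have "a n - Re (c n) = 0"
    using suminf_eq_zero_iff[of "\<lambda>n. a n - Re (c n)"] by (simp add: sums_iff)
  then have "Re (c n) = a n" "norm (c n) = a n"
    using assms(3)[of n] complex_Re_le_cmod[of "c n"] by auto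
  then have "Im (c n) = 0" using cmod_power2[of "c n"] by simp
  with \<open>Re (c n) = a n\<close> show ?thesis by (simp add: complex_eq_iff)
qed

text \<open>
  The branching condition \<open>z \<Phi>'(H z) = 1\<close> can hold on the closed disc only at \<open>d\<close>-th roots of
  unity. By the triangle inequality \<open>|z \<Phi>'(H z)| \<le> \<Phi>'(\<eta>) = 1\<close>, so equality holds term by term. A term
  of index at least 2 then forces \<open>|H z| = \<eta>\<close>, which is equality in the triangle inequality for \<open>H\<close>
  and gives \<open>H z = \<eta> z\<close> through the term of index 1. Back in the terms of \<open>\<Phi>'\<close> this says
  \<open>z\<^sup>i = 1\<close> whenever \<open>w i > 0\<close>.
\<close>

lemma characteristic_eq_imp_root_of_unity:
  fixes h w :: "nat \<Rightarrow> real" and z H :: complex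
  assumes h: "\<And>n. h n \<ge> 0" "h 1 > 0" "h sums \<eta>" and H: "(\<lambda>n. of_real (h n) * z ^ n) sums H"
    and w: "\<And>n. w n \<ge> 0" "i \<ge> 2" "w i > 0" and w1: "(\<lambda>i. real i * w i * \<eta> ^ (i - 1)) sums 1"
    and z: "norm z \<le> 1" and eq: "(\<lambda>i. of_nat i * of_real (w i) * H ^ (i - 1)) sums D" "z * D = 1"
  shows "z ^ Gcd {i. w i > 0} = 1"
proof -
  have term_h: "norm (of_real (h n) * z ^ n) \<le> h n" for n
    using h(1)[of n] z by (simp add: norm_mult norm_power mult_left_le power_le_one)
  have \<eta>: "\<eta> > 0"
    using h suminf_pos2[of h 1] by (simp add: sums_iff)
  have "norm (\<Sum>n. of_real (h n) * z ^ n) \<le> (\<Sum>n. h n)"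
    using h(3) term_h by (intro norm_suminf_le) (auto simp: sums_iff)
  then have H_le: "norm H \<le> \<eta>" using H h(3) by (simp add: sums_iff)
  have c: "of_nat i * of_real (w i) * H ^ (i - 1) * z = of_real (real i * w i * \<eta> ^ (i - 1))" for i
  proof (rule sums_norm_bound_attained[of "\<lambda>i. of_nat i * of_real (w i) * H ^ (i - 1) * z" 1
        "\<lambda>i. real i * w i * \<eta> ^ (i - 1)"])
    show "(\<lambda>i. of_nat i * of_real (w i) * H ^ (i - 1) * z) sums of_real 1"
      using sums_mult2[OF eq(1), of z] eq(2) by (simp add: mult.commute)
    show "(\<lambda>i. real i * w i * \<eta> ^ (i - 1)) sums 1" by (rule w1)
    show "norm (of_nat n * of_real (w n) * H ^ (n - 1) * z) \<le> real n * w n * \<eta> ^ (n - 1)" for n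
    proof -
      have "norm H ^ (n - 1) * norm z \<le> \<eta> ^ (n - 1) * 1"
        using H_le z \<eta> by (intro mult_mono power_mono) auto
      then show ?thesis
        using w(1)[of n] by (simp add: norm_mult norm_power mult.assoc mult_left_mono)
    qed
  qed
  have HZ: "H ^ (i - 1) * z = of_real (\<eta> ^ (i - 1))" if "w i > 0" "i \<noteq> 0" for i
    using c[of i] that by (simp add: mult.assoc)
  have "norm H ^ (i - 1) * norm z = \<eta> ^ (i - 1)"
    using arg_cong[OF HZ[of i], of norm] w(2,3) \<eta> by (simp add: norm_mult norm_power)
  moreover have "norm H ^ (i - 1) * norm z \<le> norm H ^ (i - 1)" using z by (simp add: mult_left_le)
  ultimately have "\<eta> ^ (i - 1) \<le> norm H ^ (i - 1)" by simp
  then have "\<eta> \<le> norm H"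
    using power_strict_mono[of "norm H" \<eta> "i - 1"] w(2) by fastforce
  then have nH: "norm H = \<eta>" using H_le by simp
  then have nz: "norm z = 1"
    using \<open>norm H ^ (i - 1) * norm z = \<eta> ^ (i - 1)\<close> \<eta> by simp
  have "cnj H / \<eta> * (of_real (h 1) * z ^ 1) = of_real (h 1)"
  proof (rule sums_norm_bound_attained[of "\<lambda>n. cnj H / \<eta> * (of_real (h n) * z ^ n)" \<eta> h])
    have "cnj H * H = of_real (\<eta> * \<eta>)"
      using complex_norm_square[of H] nH by (simp add: power2_eq_square mult.commute)
    then show "(\<lambda>n. cnj H / \<eta> * (of_real (h n) * z ^ n)) sums of_real \<eta>"
      using sums_mult[OF H, of "cnj H / \<eta>"] \<eta> by simp
    show "h sums \<eta>" by (rule h(3))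
    show "norm (cnj H / \<eta> * (of_real (h n) * z ^ n)) \<le> h n" for n
      using term_h[of n] nH \<eta> by (simp add: norm_mult norm_divide)
  qed
  then have "cnj H * z = \<eta>" using h(2) \<eta> by (simp add: field_simps)
  then have "H * cnj H * z = \<eta> * H" by (simp add: mult.assoc)
  moreover have "H * cnj H = of_real (\<eta> * \<eta>)"
    using complex_norm_square[of H] nH by (simp add: power2_eq_square)
  ultimately have Hz: "H = \<eta> * z" using \<eta> by simp
  have "z ^ i = 1" if "i \<in> {i. w i > 0}" for i
  proof (cases "i = 0")
    case False
    then have "(\<eta> * z) ^ (i - 1) * z = of_real (\<eta> ^ (i - 1))" using HZ[of i] that Hz by simp
    moreover have "z ^ (i - 1) * z = z ^ i" using False by (simp flip: power_Suc2)
    ultimately show ?thesis using \<eta> by (simp add: power_mult_distrib mult.assoc)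
  qed simp
  then show ?thesis by (rule power_Gcd_eq_1)
qed

section \<open>Subtracting the singular terms\<close>

lemma holomorphic_divided_difference:
  fixes f :: "complex \<Rightarrow> complex"
  assumes "f holomorphic_on ball 0 \<delta>"
  obtains f1 where "f1 holomorphic_on ball 0 \<delta>" "\<And>s. f s = f 0 + s * f1 s" "f1 0 = deriv f 0"
proof (rule that)
  show "(\<lambda>s. if s = 0 then deriv f 0 else (f s - f 0) / (s - 0)) holomorphic_on ball 0 \<delta>"
    by (rule pole_lemma_open[OF assms]) auto
qed auto

lemma holomorphic_Taylor5:
  fixes K :: "complex \<Rightarrow> complex"
  assumes "K holomorphic_on ball 0 \<delta>"
  obtains c0 c2 c3 c4 M where "M holomorphic_on ball 0 \<delta>"
    "\<And>s. K s = c0 + deriv K 0 * s + c2 * s^2 + c3 * s^3 + c4 * s^4 + s^5 * M s"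
proof -
  obtain K1 where K1: "K1 holomorphic_on ball 0 \<delta>" "\<And>s. K s = K 0 + s * K1 s" "K1 0 = deriv K 0"
    using holomorphic_divided_difference[OF assms] by blast
  obtain K2 where K2: "K2 holomorphic_on ball 0 \<delta>" "\<And>s. K1 s = K1 0 + s * K2 s"
    using holomorphic_divided_difference[OF K1(1)] by blast
  obtain K3 where K3: "K3 holomorphic_on ball 0 \<delta>" "\<And>s. K2 s = K2 0 + s * K3 s"
    using holomorphic_divided_difference[OF K2(1)] by blast
  obtain K4 where K4: "K4 holomorphic_on ball 0 \<delta>" "\<And>s. K3 s = K3 0 + s * K4 s"
    using holomorphic_divided_difference[OF K3(1)] by blast
  obtain K5 where K5: "K5 holomorphic_on ball 0 \<delta>" "\<And>s. K4 s = K4 0 + s * K5 s"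
    using holomorphic_divided_difference[OF K4(1)] by blast
  have "K s = K 0 + deriv K 0 * s + K2 0 * s^2 + K3 0 * s^3 + K4 0 * s^4 + s^5 * K5 s" for s
    unfolding K1(3)[symmetric]
    by (subst K1(2), subst K2(2), subst K3(2), subst K4(2), subst K5(2))
       (simp add: algebra_simps eval_nat_numeral)
  then show ?thesis using that K5(1) by blast
qed

lemma norm_root_of_unity:
  fixes \<zeta> :: complex
  assumes "\<zeta> ^ d = 1" "d > 0"
  shows "norm \<zeta> = 1"
  using arg_cong[OF assms(1), of norm] power_eq_imp_eq_base[of "norm \<zeta>" d 1] assms(2)
  by (simp add: norm_power)

lemma d3_bounded_near_sum:
  assumes "finite A" "\<And>x. x \<in> A \<Longrightarrow> d3_bounded_near (f x) z0"
  shows "d3_bounded_near (\<lambda>z. \<Sum>x\<in>A. f x z) z0"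
  using assms
proof (induction A rule: finite_induct)
  case empty
  then show ?case by (auto intro!: d3_bounded_near_holomorphic[of _ _ 1])
next
  case (insert x A)
  then show ?case by (auto intro!: d3_bounded_near_add)
qed

lemma d3_bounded_near_csqrt_off_1:
  assumes "norm z0 \<le> 1" "z0 \<noteq> 1"
  shows "d3_bounded_near (\<lambda>z. c3 * csqrt (1 - z) ^ 3 - k * csqrt (1 - z)) z0"
proof -
  have "1 - z0 \<notin> \<real>\<^sub>\<le>\<^sub>0"
  proof
    assume "1 - z0 \<in> \<real>\<^sub>\<le>\<^sub>0"
    then have "Re z0 \<ge> 1" "Im z0 = 0" by (auto simp: complex_nonpos_Reals_iff)
    then show False using assms complex_Re_le_cmod[of z0] by (simp add: complex_eq_iff)
  qed
  then have z0: "z0 \<in> {z. 1 - z \<notin> \<real>\<^sub>\<le>\<^sub>0}" by simp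
  have "open {z::complex. 1 - z \<notin> \<real>\<^sub>\<le>\<^sub>0}"
  proof -
    have "{z::complex. 1 - z \<notin> \<real>\<^sub>\<le>\<^sub>0} = (\<lambda>z. 1 - z) -` (- \<real>\<^sub>\<le>\<^sub>0)" by auto
    then show ?thesis by (auto intro!: continuous_open_vimage continuous_intros)
  qed
  then obtain \<epsilon> where \<epsilon>: "\<epsilon> > 0" "ball z0 \<epsilon> \<subseteq> {z. 1 - z \<notin> \<real>\<^sub>\<le>\<^sub>0}"
    using z0 open_contains_ball by blast
  have "(\<lambda>z. csqrt (1 - z)) holomorphic_on ball z0 \<epsilon>"
    by (rule holomorphic_on_compose_gen[of _ _ csqrt "- \<real>\<^sub>\<le>\<^sub>0", unfolded o_def])
       (use \<epsilon> in \<open>auto intro!: holomorphic_intros\<close>)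
  then have "(\<lambda>z. c3 * csqrt (1 - z) ^ 3 - k * csqrt (1 - z)) holomorphic_on ball z0 \<epsilon>"
    by (intro holomorphic_on_diff holomorphic_on_mult holomorphic_on_power holomorphic_on_const)
  then show ?thesis using \<epsilon>(1) by (rule d3_bounded_near_holomorphic)
qed

text \<open>
  Every point of the closed disc has a neighbourhood in which the bound holds. Away from the \<open>d\<close>-th
  roots of unity, \<open>H\<close> continues holomorphically across the circle by the implicit function theorem.
  Near 1 it is a holomorphic function of \<open>s = \<surd>(1 - z)\<close>, and a Taylor expansion up to \<open>s\<^sup>4\<close> leaves a
  remainder \<open>s\<^sup>5 M(s)\<close>. The even powers of \<open>s\<close> are polynomials in \<open>z\<close>; hence it suffices to subtract the
  terms in \<open>s\<close> and \<open>s\<^sup>3\<close>. The symmetry \<open>H(\<zeta> z) = \<zeta> H(z)\<close> carries this to the other roots of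
  unity.
\<close>

lemma third_deriv_bound:
  fixes H G \<Phi> :: "complex \<Rightarrow> complex" and p a :: real and d :: nat
  assumes d: "d > 0" and r: "r > 1" and a: "a > 0" and p: "p > 0"
    and H: "H holomorphic_on ball 0 1" "continuous_on (cball 0 1) H"
    and \<Phi>: "\<Phi> holomorphic_on U" "open U" "H ` cball 0 1 \<subseteq> U"
    and G: "G holomorphic_on ball 0 r"
    and feq: "\<And>z. norm z \<le> 1 \<Longrightarrow> H z = G z + z * \<Phi> (H z)"
    and Re: "\<And>z. norm z < 1 \<Longrightarrow> Re (H z) \<le> Re (H 1)"
    and d1: "deriv \<Phi> (H 1) = 1" and d2: "deriv (deriv \<Phi>) (H 1) = of_real (2 * a)"
    and p_eq: "deriv G 1 + \<Phi> (H 1) = of_real p"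
    and root: "\<And>z. norm z \<le> 1 \<Longrightarrow> z * deriv \<Phi> (H z) = 1 \<Longrightarrow> z ^ d = 1"
    and sym: "\<And>\<zeta> z. \<zeta> ^ d = 1 \<Longrightarrow> norm z < 1 \<Longrightarrow> H (\<zeta> * z) = \<zeta> * H z"
  obtains c3 C where "C \<ge> 0"
    "\<And>z. norm z < 1 \<Longrightarrow> norm ((deriv ^^ 3) (\<lambda>z. H z - (\<Sum>\<zeta> | \<zeta> ^ d = 1.
        inverse \<zeta> * (c3 * csqrt (1 - \<zeta> * z) ^ 3 - of_real (sqrt (p / a)) * csqrt (1 - \<zeta> * z)))) z)
        \<le> C / sqrt (1 - norm z)"
proof -
  define k where "k = complex_of_real (sqrt (p / a))"
  have fin: "finite {\<zeta>::complex. \<zeta> ^ d = 1}" using d by (intro finite_roots_unity) auto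
  have H1: "H 1 \<in> U" using \<Phi>(3) by auto
  then obtain r1 where r1: "r1 > 0" "ball (H 1) r1 \<subseteq> U" using \<Phi>(2) open_contains_ball by blast
  define r2 where "r2 = min r1 (r - 1)"
  have r2: "r2 > 0" "ball (H 1) r2 \<subseteq> U" "ball 1 r2 \<subseteq> ball (0::complex) r"
  proof -
    have "norm z < r" if "dist 1 z < r2" for z :: complex
      using norm_triangle_ineq[of 1 "z - 1"] that by (simp add: dist_norm norm_minus_commute r2_def)
    then show "r2 > 0" "ball (H 1) r2 \<subseteq> U" "ball 1 r2 \<subseteq> ball (0::complex) r"
      using r1 r by (auto simp: r2_def)
  qed
  obtain K \<delta> \<epsilon> where K: "\<delta> > 0" "\<epsilon> > 0" "K holomorphic_on ball 0 \<delta>" "deriv K 0 = - k"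
    "\<And>z h. dist z 1 < \<epsilon> \<Longrightarrow> norm z < 1 \<Longrightarrow> dist h (H 1) < \<epsilon> \<Longrightarrow> Re h \<le> Re (H 1) \<Longrightarrow>
       h = G z + z * \<Phi> h \<Longrightarrow> csqrt (1 - z) \<in> ball 0 \<delta> \<and> h = K (csqrt (1 - z))"
  proof (rule square_root_singularity[OF r2(1) _ _ _ d1 d2 a p_eq p])
    show "G holomorphic_on ball 1 r2" using G r2(3) by (rule holomorphic_on_subset)
    show "\<Phi> holomorphic_on ball (H 1) r2" using \<Phi>(1) r2(2) by (rule holomorphic_on_subset)
    show "H 1 = G 1 + \<Phi> (H 1)" using feq[of 1] by simp
  qed (auto simp: k_def)
  obtain c0 c2 c3 c4 M where M: "M holomorphic_on ball 0 \<delta>"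
    "\<And>s. K s = c0 + deriv K 0 * s + c2 * s^2 + c3 * s^3 + c4 * s^4 + s^5 * M s"
    by (rule holomorphic_Taylor5[OF K(3)]) (rule that)
  \<comment> \<open>the odd part of the Taylor polynomial; \<open>- k\<close> is \<open>deriv K 0\<close>\<close>
  define S where "S z = c3 * csqrt (1 - z) ^ 3 - k * csqrt (1 - z)" for z
  have H_near: "\<exists>\<epsilon>'>0. \<forall>z \<in> ball z0 \<epsilon>' \<inter> ball 0 1. dist (H z) (H z0) < e" if ze: "norm z0 \<le> 1" "e > 0" for z0 e
  proof -
    obtain \<epsilon>' where "\<epsilon>' > 0" "\<And>z. z \<in> cball 0 1 \<Longrightarrow> dist z z0 < \<epsilon>' \<Longrightarrow> dist (H z) (H z0) < e"
      using H(2)[unfolded continuous_on_iff, rule_format, of z0 e] ze by auto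
    then show ?thesis by (intro exI[of _ \<epsilon>']) (auto simp: dist_commute)
  qed
  have near_1: "d3_bounded_near (\<lambda>z. H z - S z) 1"
  proof -
    obtain \<epsilon>' where \<epsilon>': "\<epsilon>' > 0" "\<And>z. z \<in> ball 1 \<epsilon>' \<inter> ball 0 1 \<Longrightarrow> dist (H z) (H 1) < \<epsilon>"
      using H_near[of 1 \<epsilon>] K(2) by auto
    have "d3_bounded_near (\<lambda>z. (c0 + c2 * (1 - z) + c4 * (1 - z)^2)
            + csqrt (1 - z) ^ 5 * M (csqrt (1 - z))) 1"
      by (intro d3_bounded_near_add d3_bounded_near_sqrt[OF M(1) K(1)]
            d3_bounded_near_holomorphic[of _ _ 1] holomorphic_intros) auto
    then show ?thesis
    proof (rule d3_bounded_near_cong)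
      show "min \<epsilon> \<epsilon>' > 0" using K(2) \<epsilon>' by simp
      fix z :: complex assume z: "z \<in> ball 1 (min \<epsilon> \<epsilon>') \<inter> ball 0 1"
      define s where "s = csqrt (1 - z)"
      have s2: "s\<^sup>2 = 1 - z" by (simp add: s_def)
      have "H z = K s" unfolding s_def
        using K(5)[of z "H z"] z \<epsilon>'(2)[of z] Re[of z] feq[of z] by (simp add: dist_commute)
      also have "\<dots> = c0 - k * s + c2 * s\<^sup>2 + c3 * s ^ 3 + c4 * (s\<^sup>2)\<^sup>2 + s ^ 5 * M s"
        unfolding M(2)[of s] K(4) by simp
      finally have "H z - S z = c0 + c2 * s\<^sup>2 + c4 * (s\<^sup>2)\<^sup>2 + s ^ 5 * M s"
        unfolding S_def s_def[symmetric] by simp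
      then show "c0 + c2 * (1 - z) + c4 * (1 - z)^2 + csqrt (1 - z) ^ 5 * M (csqrt (1 - z)) = H z - S z"
        unfolding s_def[symmetric] by (simp only: s2)
    qed
  qed
  have H_off: "d3_bounded_near H z0" if z0: "norm z0 \<le> 1" "z0 ^ d \<noteq> 1" for z0
  proof -
    have "H z0 \<in> U" using \<Phi>(3) z0 by auto
    then obtain r3 where r3: "r3 > 0" "ball (H z0) r3 \<subseteq> U" using \<Phi>(2) open_contains_ball by blast
    define r4 where "r4 = min r3 (r - 1)"
    have r4: "r4 > 0" "ball (H z0) r4 \<subseteq> U" "ball z0 r4 \<subseteq> ball 0 r"
    proof -
      have "norm z < r" if "dist z0 z < r4" for z :: complex
        using norm_triangle_ineq[of z0 "z - z0"] that z0 by (simp add: dist_norm norm_minus_commute r4_def)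
      then show "r4 > 0" "ball (H z0) r4 \<subseteq> U" "ball z0 r4 \<subseteq> ball 0 r"
        using r3 r by (auto simp: r4_def)
    qed
    have dhol: "deriv \<Phi> holomorphic_on U" using \<Phi> by (intro holomorphic_deriv)
    obtain f \<delta> \<epsilon> where f: "\<delta> > 0" "\<epsilon> > 0" "f holomorphic_on ball z0 \<delta>"
      "\<And>z h. z \<in> ball z0 \<delta> \<Longrightarrow> h \<in> ball (H z0) \<epsilon> \<Longrightarrow> h - G z - z * \<Phi> h = 0 \<longleftrightarrow> h = f z"
    proof (rule holomorphic_implicit_function[OF r4(1), of z0 "H z0" "\<lambda>z h. h - G z - z * \<Phi> h" "\<lambda>z h. 1 - z * deriv \<Phi> h"])
      fix x y assume "x \<in> ball z0 r4" "y \<in> ball (H z0) r4"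
      then have "(\<Phi> has_field_derivative deriv \<Phi> y) (at y)"
        using \<Phi>(1,2) r4(2) by (meson holomorphic_derivI subsetD)
      from DERIV_diff[OF DERIV_diff[OF DERIV_ident DERIV_const] DERIV_cmult[OF this, of x]]
      show "((\<lambda>h. h - G x - x * \<Phi> h) has_field_derivative 1 - x * deriv \<Phi> y) (at y)" by simp
    next
      have "isCont (deriv \<Phi>) (H z0)"
        using holomorphic_on_imp_continuous_on[OF dhol] \<Phi>(2) \<open>H z0 \<in> U\<close>
        by (simp add: continuous_on_eq_continuous_at)
      then have "isCont (\<lambda>q. deriv \<Phi> (snd q)) (z0, H z0)"
        using isCont_o2[of "(z0, H z0)" snd "deriv \<Phi>"] by (auto intro!: continuous_intros)
      then show "isCont (\<lambda>(z, h). 1 - z * deriv \<Phi> h) (z0, H z0)"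
        unfolding case_prod_unfold by (intro continuous_intros)
    next
      fix g S assume S: "open S" "S \<subseteq> ball z0 r4" "g holomorphic_on S" "g ` S \<subseteq> ball (H z0) r4"
      have "(\<lambda>x. \<Phi> (g x)) holomorphic_on S"
        by (rule holomorphic_on_compose_gen[of _ S \<Phi> U, unfolded o_def]) (use S r4 \<Phi> in auto)
      moreover have "G holomorphic_on S" using G S r4 by (meson holomorphic_on_subset order_trans)
      ultimately show "(\<lambda>x. g x - G x - x * \<Phi> (g x)) holomorphic_on S"
        using S by (intro holomorphic_intros)
    next
      show "H z0 - G z0 - z0 * \<Phi> (H z0) = 0" using feq[OF z0(1)] by (simp add: algebra_simps)
      show "1 - z0 * deriv \<Phi> (H z0) \<noteq> 0" using root[OF z0(1)] z0(2) by auto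
    qed (rule that)
    obtain \<epsilon>' where \<epsilon>': "\<epsilon>' > 0" "\<And>z. z \<in> ball z0 \<epsilon>' \<inter> ball 0 1 \<Longrightarrow> dist (H z) (H z0) < \<epsilon>"
      using H_near[OF z0(1) f(2)] by auto
    show ?thesis
    proof (rule d3_bounded_near_cong[OF d3_bounded_near_holomorphic[OF f(3,1)]])
      show "min \<delta> \<epsilon>' > 0" using f \<epsilon>' by simp
      fix z assume z: "z \<in> ball z0 (min \<delta> \<epsilon>') \<inter> ball 0 1"
      then have "norm z \<le> 1" by simp
      then have "H z - G z - z * \<Phi> (H z) = 0" using feq[of z] by (simp add: algebra_simps)
      then show "f z = H z" using f(4)[of z "H z"] \<epsilon>'(2)[of z] z by (simp add: dist_commute)
    qed
  qed
  have S_off: "d3_bounded_near (\<lambda>z. - inverse \<zeta> * S (\<zeta> * z)) z0"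
    if "norm z0 \<le> 1" "\<zeta> ^ d = 1" "\<zeta> * z0 \<noteq> 1" for \<zeta> z0
    unfolding S_def using norm_root_of_unity[OF that(2) d] that
    by (intro d3_bounded_near_rotate d3_bounded_near_csqrt_off_1) (auto simp: norm_mult)
  define Q where "Q z = H z - (\<Sum>\<zeta> | \<zeta> ^ d = 1. inverse \<zeta> * S (\<zeta> * z))" for z
  have Q_near: "d3_bounded_near Q z0" if z0: "norm z0 \<le> 1" for z0
  proof (cases "z0 ^ d = 1")
    case False
    have "\<zeta> * z0 \<noteq> 1" if "\<zeta> ^ d = 1" for \<zeta>
      using that False by (metis mult_1 power_mult_distrib power_one)
    then have "d3_bounded_near (\<lambda>z. H z + (\<Sum>\<zeta> | \<zeta> ^ d = 1. - inverse \<zeta> * S (\<zeta> * z))) z0"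
      using z0 False fin by (intro d3_bounded_near_add d3_bounded_near_sum S_off H_off) auto
    then show ?thesis by (simp add: Q_def[abs_def] sum_negf)
  next
    case True
    have z0n: "norm z0 = 1" "z0 \<noteq> 0" using norm_root_of_unity[OF True d] by auto
    define \<zeta>0 where "\<zeta>0 = inverse z0"
    have \<zeta>0: "\<zeta>0 ^ d = 1" "norm \<zeta>0 = 1" "\<zeta>0 * z0 = 1" "\<zeta>0 \<noteq> 0"
      using True z0n by (auto simp: \<zeta>0_def power_inverse norm_inverse)
    \<comment> \<open>only the term of \<open>\<zeta>0\<close> is singular at \<open>z0\<close>; it is the situation at 1, rotated\<close>
    have "d3_bounded_near (\<lambda>z. inverse \<zeta>0 * (H (\<zeta>0 * z) - S (\<zeta>0 * z))) z0"
      by (rule d3_bounded_near_rotate[of "\<lambda>z. H z - S z"]) (use near_1 \<zeta>0 in auto)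
    moreover have "d3_bounded_near (\<lambda>z. \<Sum>\<zeta>\<in>{\<zeta>. \<zeta> ^ d = 1} - {\<zeta>0}. - inverse \<zeta> * S (\<zeta> * z)) z0"
    proof (intro d3_bounded_near_sum S_off)
      fix \<zeta> assume "\<zeta> \<in> {\<zeta>. \<zeta> ^ d = 1} - {\<zeta>0}"
      then show "\<zeta> * z0 \<noteq> 1" using z0n by (auto simp: \<zeta>0_def field_simps)
    qed (use z0 fin in auto)
    ultimately have "d3_bounded_near (\<lambda>z. inverse \<zeta>0 * (H (\<zeta>0 * z) - S (\<zeta>0 * z)) +
       (\<Sum>\<zeta>\<in>{\<zeta>. \<zeta> ^ d = 1} - {\<zeta>0}. - inverse \<zeta> * S (\<zeta> * z))) z0" by (rule d3_bounded_near_add)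
    then show ?thesis
    proof (rule d3_bounded_near_cong[of _ _ 1])
      fix z assume "z \<in> ball z0 1 \<inter> ball 0 1"
      then have "inverse \<zeta>0 * H (\<zeta>0 * z) = H z" using sym[OF \<zeta>0(1), of z] \<zeta>0(4) by simp
      moreover have "(\<Sum>\<zeta> | \<zeta> ^ d = 1. inverse \<zeta> * S (\<zeta> * z)) = inverse \<zeta>0 * S (\<zeta>0 * z) +
          (\<Sum>\<zeta>\<in>{\<zeta>. \<zeta> ^ d = 1} - {\<zeta>0}. inverse \<zeta> * S (\<zeta> * z))"
        using fin \<zeta>0(1) by (intro sum.remove) auto
      ultimately show "inverse \<zeta>0 * (H (\<zeta>0 * z) - S (\<zeta>0 * z)) +
         (\<Sum>\<zeta>\<in>{\<zeta>. \<zeta> ^ d = 1} - {\<zeta>0}. - inverse \<zeta> * S (\<zeta> * z)) = Q z"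
        by (simp add: Q_def sum_negf right_diff_distrib)
    qed simp
  qed
  obtain C where "C \<ge> 0" "\<And>z. norm z < 1 \<Longrightarrow> norm ((deriv ^^ 3) Q z) \<le> C / sqrt (1 - norm z)"
    using d3_bounded_if_near[of Q] Q_near by blast
  then show ?thesis using that[of C c3] by (simp add: Q_def[abs_def] S_def k_def)
qed

section \<open>Power series with real coefficients\<close>

text \<open>
  The function \<open>generator\<close> for a complex argument.
\<close>

definition gf :: "(nat \<Rightarrow> real) \<Rightarrow> complex \<Rightarrow> complex" where
  "gf a z = (\<Sum>n. of_real (a n) * z ^ n)"

lemma conv_radius_complex_of_real [simp]: "conv_radius (\<lambda>n. complex_of_real (a n)) = conv_radius a"
  using conv_radius_norm[of "\<lambda>n. complex_of_real (a n)"] conv_radius_norm[of a] by simp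

lemma gf_sums: "ereal (norm z) < conv_radius a \<Longrightarrow> (\<lambda>n. of_real (a n) * z ^ n) sums gf a z"
  unfolding gf_def by (intro summable_sums summable_in_conv_radius) simp

lemma gf_eq_eval_fps: "gf a = eval_fps (Abs_fps (\<lambda>n. complex_of_real (a n)))"
  by (simp add: fun_eq_iff gf_def eval_fps_def)

lemma gf_holomorphic: "S \<subseteq> eball 0 (conv_radius a) \<Longrightarrow> gf a holomorphic_on S"
  unfolding gf_eq_eval_fps by (intro holomorphic_on_eval_fps) (simp add: fps_conv_radius_def)

lemma conv_radius_diffs: "conv_radius a \<le> conv_radius (diffs a)" for a :: "nat \<Rightarrow> real"
proof -
  have "fps_conv_radius (fps_deriv (Abs_fps a)) \<ge> fps_conv_radius (Abs_fps a)"
    by (rule fps_conv_radius_deriv)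
  moreover have "fps_deriv (Abs_fps a) = Abs_fps (diffs a)" by (simp add: fps_eq_iff diffs_def)
  ultimately show ?thesis by (simp add: fps_conv_radius_def)
qed

lemma deriv_gf:
  assumes "ereal (norm z) < conv_radius a"
  shows "deriv (gf a) z = gf (diffs a) z"
proof -
  have "eval_fps (fps_deriv (Abs_fps (\<lambda>n. complex_of_real (a n)))) z = deriv (gf a) z"
    unfolding gf_eq_eval_fps by (intro eval_fps_deriv) (use assms in \<open>simp add: fps_conv_radius_def\<close>)
  then show ?thesis by (simp add: gf_def eval_fps_def diffs_def)
qed

lemma gf_of_real:
  assumes "ereal \<bar>x\<bar> < conv_radius a"
  shows "gf a (of_real x) = of_real (\<Sum>n. a n * x ^ n)" "summable (\<lambda>n. a n * x ^ n)"
proof -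
  show s: "summable (\<lambda>n. a n * x ^ n)" using assms by (intro summable_in_conv_radius) simp
  show "gf a (of_real x) = of_real (\<Sum>n. a n * x ^ n)"
    unfolding gf_def using suminf_of_real[OF s, where 'a = complex] by simp
qed

text \<open>
  Nonnegative summable coefficients dominate the series uniformly on the closed disc, so it converges
  and is continuous up to the circle, although its radius of convergence may be 1.
\<close>

lemma gf_closed_disc:
  assumes "\<And>n. a n \<ge> 0" "a sums A"
  shows "norm z \<le> 1 \<Longrightarrow> (\<lambda>n. of_real (a n) * z ^ n) sums gf a z"
    and "norm z \<le> 1 \<Longrightarrow> norm (gf a z) \<le> A"
    and "continuous_on (cball 0 1) (gf a)"
proof -
  have le: "norm (of_real (a n) * z ^ n) \<le> a n" if "norm z \<le> 1" for n and z :: complex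
    using assms(1)[of n] that by (simp add: norm_mult norm_power mult_left_le power_le_one)
  have sa: "summable a" "suminf a = A" using assms(2) by (simp_all add: sums_iff)
  have s: "summable (\<lambda>n. of_real (a n) * z ^ n)" if "norm z \<le> 1" for z :: complex
    by (rule summable_comparison_test'[OF sa(1), of 0]) (rule le[OF that])
  show "(\<lambda>n. of_real (a n) * z ^ n) sums gf a z" if "norm z \<le> 1"
    unfolding gf_def by (rule summable_sums[OF s[OF that]])
  show "norm (gf a z) \<le> A" if "norm z \<le> 1"
    unfolding gf_def sa(2)[symmetric] by (rule norm_suminf_le[OF le[OF that] sa(1)])
  have "uniform_limit (cball 0 1) (\<lambda>n z. \<Sum>i<n. of_real (a i) * z ^ i) (\<lambda>z. \<Sum>i. of_real (a i) * z ^ i :: complex) sequentially"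
    by (rule Weierstrass_m_test[OF _ sa(1)]) (rule le, simp)
  moreover have "\<forall>\<^sub>F n in sequentially. continuous_on (cball 0 1) (\<lambda>z. \<Sum>i<n. of_real (a i) * z ^ i :: complex)"
    by (intro always_eventually allI continuous_intros)
  ultimately have "continuous_on (cball 0 1) (\<lambda>z. \<Sum>i. of_real (a i) * z ^ i :: complex)"
    by (intro uniform_limit_theorem) auto
  moreover have "gf a = (\<lambda>z. \<Sum>i. of_real (a i) * z ^ i :: complex)" by (simp add: gf_def fun_eq_iff)
  ultimately show "continuous_on (cball 0 1) (gf a)" by simp
qed

text \<open>
  The \<open>n\<close>-th coefficient of \<open>- \<surd>(1 - z)\<close>, with the sign that makes it positive for \<open>n \<ge> 1\<close>.
\<close>

definition sqrt_coeff :: "nat \<Rightarrow> real" where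
  "sqrt_coeff n = - ((- 1) ^ n * ((1/2) gchoose n))"

lemma of_real_gbinomial: "complex_of_real (a gchoose n) = of_real a gchoose n"
  by (simp add: gbinomial_prod_rev)

lemma gbinomial_bigo:
  "(\<lambda>n. (a gchoose n :: real)) \<in> O(\<lambda>n. real n powr (- a - 1))"
proof -
  have "Bseq (\<lambda>n. (a gchoose n) / ((-1)^n / exp ((a+1) * of_real (ln (real n)))))"
    using gbinomial_asymptotic[of a] by (intro convergent_imp_Bseq convergentI)
  then obtain K where K: "K > 0" "\<And>n. norm ((a gchoose n) / ((-1)^n / exp ((a+1) * of_real (ln (real n))))) \<le> K"
    by (auto simp: Bseq_def)
  show ?thesis
  proof (rule bigoI[of _ K], rule eventually_sequentiallyI[of 1])
    fix n :: nat assume n: "n \<ge> 1"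
    have "\<bar>a gchoose n\<bar> * exp ((a + 1) * ln (real n)) \<le> K"
      using K(2)[of n] by (simp add: abs_mult power_abs)
    moreover have "real n powr (- a - 1) * exp ((a + 1) * ln (real n)) = 1"
      using n by (simp add: powr_def algebra_simps flip: exp_add)
    ultimately have "\<bar>a gchoose n\<bar> * exp ((a + 1) * ln (real n))
        \<le> K * real n powr (- a - 1) * exp ((a + 1) * ln (real n))" by (simp add: mult.assoc)
    then show "norm (a gchoose n) \<le> K * norm (real n powr (- a - 1))" by simp
  qed
qed

lemma sqrt_coeff_asymptotic: "\<exists>c>0. (\<lambda>n. sqrt_coeff n * real n powr (3/2)) \<longlonglongrightarrow> c"
proof -
  have "Gamma (1/2 :: real) = (-1/2) * Gamma (-1/2)"
  proof -
    have "-1/2 \<notin> (\<int>\<^sub>\<le>\<^sub>0 :: real set)"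
    proof
      assume "-1/2 \<in> (\<int>\<^sub>\<le>\<^sub>0 :: real set)"
      then obtain n where "-1/2 = real_of_int n" by (auto elim: nonpos_Ints_cases)
      then have "real_of_int (2 * n + 1) = 0" by simp
      then show False unfolding of_int_eq_0_iff by presburger
    qed
    then show ?thesis using Gamma_plus1[of "-1/2 :: real"] by simp
  qed
  moreover have "Gamma (1/2 :: real) > 0" by (intro Gamma_real_pos) simp
  ultimately have "inverse (Gamma (-1/2 :: real)) < 0" by simp
  moreover have "(\<lambda>n. - (((1/2) gchoose n) / ((-1)^n / exp ((1/2+1) * of_real (ln (real n))))))
      \<longlonglongrightarrow> - inverse (Gamma (- (1/2) :: real))"
    by (intro tendsto_minus gbinomial_asymptotic)
  moreover have "\<forall>\<^sub>F n in sequentially. - (((1/2) gchoose n) / ((-1)^n / exp ((1/2+1) * of_real (ln (real n)))))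
      = sqrt_coeff n * real n powr (3/2)"
  proof (rule eventually_sequentiallyI[of 1])
    fix n :: nat assume "n \<ge> 1"
    moreover have "x / ((-1) ^ n / y) = (-1) ^ n * x * y" for x y :: real
      by (cases "even n") auto
    ultimately show "- (((1/2) gchoose n) / ((-1)^n / exp ((1/2+1) * of_real (ln (real n)))))
      = sqrt_coeff n * real n powr (3/2)" by (simp add: sqrt_coeff_def powr_def)
  qed
  ultimately show ?thesis
    by (intro exI[of _ "- inverse (Gamma (- (1/2) :: real))"]) (auto elim: Lim_transform_eventually)
qed

lemma csqrt_series:
  assumes "norm z < 1"
  shows "(\<lambda>n. - of_real (sqrt_coeff n) * z ^ n) sums csqrt (1 - z)"
    and "(\<lambda>n. (- 1) ^ n * of_real ((3/2) gchoose n) * z ^ n) sums (csqrt (1 - z) ^ 3)"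
proof -
  have "(\<lambda>n. ((1/2) gchoose n) * (- z) ^ n) sums (1 + - z) powr (1/2)"
    using assms by (intro gen_binomial_complex) simp
  moreover have "((1/2::complex) gchoose n) * (- z) ^ n = - of_real (sqrt_coeff n) * z ^ n" for n
    by (simp add: sqrt_coeff_def of_real_gbinomial power_minus[of z])
  ultimately show "(\<lambda>n. - of_real (sqrt_coeff n) * z ^ n) sums csqrt (1 - z)"
    by (simp add: csqrt_conv_powr)
  have nz: "1 - z \<noteq> 0" using assms by auto
  have "(\<lambda>n. ((3/2) gchoose n) * (- z) ^ n) sums (1 + - z) powr (3/2)"
    using assms by (intro gen_binomial_complex) simp
  moreover have "((3/2::complex) gchoose n) * (- z) ^ n = (- 1) ^ n * of_real ((3/2) gchoose n) * z ^ n" for n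
    by (simp add: of_real_gbinomial power_minus[of z])
  moreover have "(1 + - z) powr (3/2) = csqrt (1 - z) ^ 3"
    using nz by (simp add: csqrt_conv_powr powr_def exp_of_nat_mult[of 3, simplified, symmetric])
  ultimately show "(\<lambda>n. (- 1) ^ n * of_real ((3/2) gchoose n) * z ^ n) sums (csqrt (1 - z) ^ 3)"
    by simp
qed

lemma sum_roots_of_unity_power:
  assumes "d > 0" "n \<ge> 1" "d dvd n - 1"
  shows "(\<Sum>\<zeta>::complex | \<zeta> ^ d = 1. inverse \<zeta> * \<zeta> ^ n) = of_nat d"
proof -
  have "inverse \<zeta> * \<zeta> ^ n = 1" if "\<zeta> ^ d = 1" for \<zeta> :: complex
  proof -
    have "\<zeta> \<noteq> 0" using norm_root_of_unity[OF that assms(1)] by auto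
    moreover have "\<zeta> ^ (n - 1) = 1" using assms(3) that by (auto simp: power_mult elim!: dvdE)
    moreover have "\<zeta> ^ n = \<zeta> * \<zeta> ^ (n - 1)" using assms(2) by (simp flip: power_Suc)
    ultimately show ?thesis by simp
  qed
  then have "(\<Sum>\<zeta>::complex | \<zeta> ^ d = 1. inverse \<zeta> * \<zeta> ^ n) = (\<Sum>\<zeta>::complex | \<zeta> ^ d = 1. 1)"
    by (intro sum.cong) auto
  then show ?thesis using card_roots_unity_eq[OF assms(1)] by simp
qed

section \<open>Coefficients of the solution\<close>

text \<open>
  The functional equation with its dominant singularity scaled to 1. The function left over in
  \<open>third_deriv_bound\<close> has coefficients \<open>O(n\<^bsup>-5/2\<^esup>)\<close>. For \<open>n\<close> congruent to 1 modulo \<open>d\<close> the \<open>d\<close> rotated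
  copies of the subtracted terms contribute equally, so the square roots add up to a multiple of
  \<open>sqrt_coeff n\<close>, while the cubes contribute \<open>O(n\<^bsup>-5/2\<^esup>)\<close> again.
\<close>

lemma coefficient_asymptotics:
  fixes w g h :: "nat \<Rightarrow> real" and \<eta> :: real and d :: nat
  assumes w: "\<And>i. w i \<ge> 0" "w 0 > 0" "i \<ge> 2" "w i > 0" and R: "ereal \<eta> < conv_radius w"
    and w1: "(\<lambda>i. real i * w i * \<eta> ^ (i - 1)) sums 1"
    and g: "\<And>n. g n \<ge> 0" "conv_radius g > 1"
    and h: "\<And>n. h n \<ge> 0" "h 1 > 0" "h sums \<eta>"
    and feq: "\<And>z. norm z < 1 \<Longrightarrow> gf h z = gf g z + z * gf w (gf h z)"
    and d: "d = Gcd {i. w i > 0}" and supp: "\<And>n. h n \<noteq> 0 \<Longrightarrow> n \<ge> 1 \<and> d dvd n - 1"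
  shows "\<exists>\<kappa>>0. (\<lambda>n. h n - \<kappa> * sqrt_coeff n) \<in>
           O[inf sequentially (principal {n. n \<ge> 1 \<and> d dvd n - 1})](\<lambda>n. real n powr (-5/2))"
proof -
  have d0: "d > 0"
  proof (rule ccontr)
    assume "\<not> d > 0"
    then have "{i. w i > 0} \<subseteq> {0}" unfolding d by (simp add: Gcd_0_iff)
    then show False using w(3,4) by auto
  qed
  have \<eta>: "\<eta> > 0"
    using h suminf_pos2[of h 1] by (simp add: sums_iff)
  define U where "U = eball (0::complex) (conv_radius w)"
  define \<Phi> where "\<Phi> = gf w"
  define G where "G = gf g"
  define H where "H = gf h"
  note H_disc = gf_closed_disc[OF h(1,3), folded H_def]
  have U: "u \<in> U" if "norm u \<le> \<eta>" for u
    using that R unfolding U_def by (simp add: dist_norm) (meson ereal_less_eq(3) le_less_trans)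
  have HU: "H z \<in> U" if "norm z \<le> 1" for z using H_disc(2)[OF that] by (rule U)
  have H1: "H 1 = of_real \<eta>"
    using sums_unique2[OF H_disc(1)[of 1]] sums_of_real[OF h(3)] by simp
  have \<Phi>_hol: "\<Phi> holomorphic_on U" unfolding \<Phi>_def U_def by (intro gf_holomorphic) simp
  have \<Phi>': "deriv \<Phi> u = gf (diffs w) u" if "u \<in> U" for u
    unfolding \<Phi>_def using that by (intro deriv_gf) (simp add: U_def)
  have \<Phi>'_sums: "(\<lambda>i. of_nat i * of_real (w i) * u ^ (i - 1)) sums deriv \<Phi> u" if "u \<in> U" for u
  proof -
    have "(\<lambda>n. of_real (diffs w n) * u ^ n) sums gf (diffs w) u"
      using that conv_radius_diffs[of w] by (intro gf_sums) (simp add: U_def order_less_le_trans)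
    then have "(\<lambda>n. of_nat (Suc n) * of_real (w (Suc n)) * u ^ (Suc n - 1)) sums deriv \<Phi> u"
      unfolding \<Phi>'[OF that] by (simp add: diffs_def)
    then show ?thesis by (subst (asm) sums_Suc_iff) simp
  qed
  have U\<eta>: "of_real \<eta> \<in> U" using U \<eta> by simp
  have d1: "deriv \<Phi> (H 1) = 1"
    unfolding H1 using sums_unique2[OF \<Phi>'_sums[OF U\<eta>]] sums_of_real[OF w1] by simp
  define a where "a = (\<Sum>n. diffs (diffs w) n * \<eta> ^ n) / 2"
  have R2: "ereal \<bar>\<eta>\<bar> < conv_radius (diffs w)" "ereal \<bar>\<eta>\<bar> < conv_radius (diffs (diffs w))"
    using R \<eta> conv_radius_diffs[of w] conv_radius_diffs[of "diffs w"] by (auto simp: less_le_trans)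
  have dd: "diffs (diffs w) n \<ge> 0" for n using w(1) by (simp add: diffs_def)
  obtain j where "i = 2 + j" using le_Suc_ex[OF w(3)] by blast
  then have j: "i = Suc (Suc j)" by simp
  have "diffs (diffs w) j > 0" using w(4) by (simp add: diffs_def j)
  then have "(\<Sum>n. diffs (diffs w) n * \<eta> ^ n) > 0"
    using gf_of_real(2)[OF R2(2)] dd \<eta> by (intro suminf_pos2[of _ j]) auto
  then have a: "a > 0" by (simp add: a_def)
  have d2: "deriv (deriv \<Phi>) (H 1) = of_real (2 * a)"
  proof -
    have "deriv (deriv \<Phi>) (H 1) = deriv (gf (diffs w)) (H 1)"
    proof (rule complex_derivative_transform_within_open[of _ U])
      show "deriv \<Phi> holomorphic_on U" by (intro holomorphic_deriv \<Phi>_hol) (simp add: U_def)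
      show "gf (diffs w) holomorphic_on U"
        unfolding U_def by (intro gf_holomorphic eball_mono conv_radius_diffs)
    qed (use U\<eta> \<Phi>' in \<open>auto simp: H1 U_def\<close>)
    also have "\<dots> = gf (diffs (diffs w)) (of_real \<eta>)"
      unfolding H1 using R2(1) by (intro deriv_gf) simp
    finally show ?thesis using gf_of_real(1)[OF R2(2)] by (simp add: a_def)
  qed
  define p where "p = (\<Sum>n. diffs g n * 1 ^ n) + (\<Sum>n. w n * \<eta> ^ n)"
  have "(\<Sum>n. w n * \<eta> ^ n) > 0"
    using gf_of_real(2)[of \<eta> w] R w(1,2) \<eta> by (intro suminf_pos2[of _ 0]) auto
  moreover have g1: "ereal \<bar>1\<bar> < conv_radius (diffs g)"
    using g(2) conv_radius_diffs[of g] by (simp add: one_ereal_def less_le_trans)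
  have "(\<Sum>n. diffs g n * 1 ^ n) \<ge> 0"
    using gf_of_real(2)[OF g1] g(1) by (intro suminf_nonneg) (auto simp: diffs_def)
  ultimately have p: "p > 0" by (simp add: p_def)
  have p_eq: "deriv G 1 + \<Phi> (H 1) = of_real p"
    using gf_of_real(1)[OF g1] gf_of_real(1)[of \<eta> w] R \<eta> g(2)
    by (simp add: p_def G_def \<Phi>_def H1 deriv_gf one_ereal_def)
  obtain r where r: "r > 1" "ereal r < conv_radius g"
    using ereal_dense2[OF g(2)] by (auto simp: one_ereal_def)
  have G_hol: "G holomorphic_on ball 0 r"
    unfolding G_def using r by (intro gf_holomorphic ball_eball_mono) simp
  have feq': "H z = G z + z * \<Phi> (H z)" if "norm z \<le> 1" for z
  proof -
    have "H z - (G z + z * \<Phi> (H z)) = 0"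
    proof (rule continuous_constant_on_closure[of "ball 0 1" "\<lambda>z. H z - (G z + z * \<Phi> (H z))"])
      have "continuous_on (cball 0 1) G"
        using r by (intro continuous_on_subset[OF holomorphic_on_imp_continuous_on[OF G_hol]]) auto
      moreover have "continuous_on (cball 0 1) (\<lambda>z. \<Phi> (H z))"
        by (rule continuous_on_compose2[OF holomorphic_on_imp_continuous_on[OF \<Phi>_hol] H_disc(3)])
           (use HU in auto)
      ultimately show "continuous_on (closure (ball 0 1)) (\<lambda>z. H z - (G z + z * \<Phi> (H z)))"
        using H_disc(3) by (auto intro!: continuous_intros)
    qed (use that feq in \<open>auto simp: H_def G_def \<Phi>_def\<close>)
    then show ?thesis by simp
  qed
  have H_hol: "H holomorphic_on ball 0 1"
  proof -
    have "ereal 1 \<le> conv_radius h"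
      using h(3) conv_radius_geI[of h 1] by (simp add: sums_iff)
    then show ?thesis unfolding H_def by (intro gf_holomorphic ball_eball_mono)
  qed
  obtain c3 C where C: "C \<ge> 0"
    "\<And>z. norm z < 1 \<Longrightarrow> norm ((deriv ^^ 3) (\<lambda>z. H z - (\<Sum>\<zeta> | \<zeta> ^ d = 1.
        inverse \<zeta> * (c3 * csqrt (1 - \<zeta> * z) ^ 3 - of_real (sqrt (p / a)) * csqrt (1 - \<zeta> * z)))) z)
        \<le> C / sqrt (1 - norm z)"
  proof (rule third_deriv_bound[OF d0 r(1) a p H_hol H_disc(3) \<Phi>_hol _ _ G_hol feq' _ d1 d2 p_eq])
    show "open U" by (simp add: U_def)
    show "H ` cball 0 1 \<subseteq> U" using HU by auto
    show "Re (H z) \<le> Re (H 1)" if "norm z < 1" for z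
      using H_disc(2)[of z] complex_Re_le_cmod[of "H z"] that by (simp add: H1)
    show "z ^ d = 1" if "norm z \<le> 1" "z * deriv \<Phi> (H z) = 1" for z
      unfolding d using characteristic_eq_imp_root_of_unity[OF h H_disc(1)[OF that(1)] w(1,3,4) w1 that(1)
        \<Phi>'_sums[OF HU[OF that(1)]] that(2)] .
    show "H (\<zeta> * z) = \<zeta> * H z" if "\<zeta> ^ d = 1" "norm z < 1" for \<zeta> z
    proof -
      have "of_real (h n) * (\<zeta> * z) ^ n = \<zeta> * (of_real (h n) * z ^ n)" for n
      proof (cases "h n = 0")
        case False
        then have "\<zeta> ^ (n - 1) = 1" "\<zeta> ^ n = \<zeta> * \<zeta> ^ (n - 1)"
          using supp[of n] that(1) by (auto simp: power_mult elim!: dvdE simp flip: power_Suc)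
        then show ?thesis by (simp add: power_mult_distrib)
      qed simp
      moreover have "summable (\<lambda>n. of_real (h n) * z ^ n)"
        using H_disc(1)[of z] that(2) by (simp add: sums_iff)
      ultimately show ?thesis unfolding H_def gf_def by (simp only: suminf_mult)
    qed
  qed (assumption, rule that)
  define k where "k = sqrt (p / a)"
  define Q where "Q z = H z - (\<Sum>\<zeta> | \<zeta> ^ d = 1.
        inverse \<zeta> * (c3 * csqrt (1 - \<zeta> * z) ^ 3 - of_real k * csqrt (1 - \<zeta> * z)))" for z
  define q where "q n = of_real (h n) - (\<Sum>\<zeta> | \<zeta> ^ d = 1. inverse \<zeta> *
      (c3 * ((- 1) ^ n * of_real ((3/2) gchoose n) * \<zeta> ^ n) - of_real k * (- of_real (sqrt_coeff n) * \<zeta> ^ n)))" for n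
  have Q_sums: "(\<lambda>n. q n * z ^ n) sums Q z" if z: "norm z < 1" for z
  proof -
    have "(\<lambda>n. of_real (h n) * z ^ n - (\<Sum>\<zeta> | \<zeta> ^ d = 1. inverse \<zeta> *
      (c3 * ((- 1) ^ n * of_real ((3/2) gchoose n) * (\<zeta> * z) ^ n) -
       of_real k * (- of_real (sqrt_coeff n) * (\<zeta> * z) ^ n)))) sums Q z"
      unfolding Q_def
      by (intro sums_diff sums_sum sums_mult csqrt_series H_disc(1))
         (use z norm_root_of_unity[OF _ d0] in \<open>auto simp: norm_mult\<close>)
    moreover have "of_real (h n) * z ^ n - (\<Sum>\<zeta> | \<zeta> ^ d = 1. inverse \<zeta> *
      (c3 * ((- 1) ^ n * of_real ((3/2) gchoose n) * (\<zeta> * z) ^ n) -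
       of_real k * (- of_real (sqrt_coeff n) * (\<zeta> * z) ^ n))) = q n * z ^ n" for n
      unfolding q_def left_diff_distrib[of "of_real (h n)"] sum_distrib_right
      by (intro arg_cong2[where f = "(-)"] sum.cong refl) (simp add: power_mult_distrib algebra_simps)
    ultimately show ?thesis by simp
  qed
  have Q_hol: "Q holomorphic_on ball 0 1"
    using power_series_holomorphic[of 0 1 q Q] Q_sums by (simp add: dist_norm)
  have Q_coeff: "(deriv ^^ n) Q 0 / fact n = q n" for n
  proof -
    have "Q has_fps_expansion Abs_fps q"
      by (rule has_fps_expansionI) (use Q_sums in \<open>auto simp: eventually_nhds_metric dist_norm intro!: exI[of _ 1]\<close>)
    from fps_nth_fps_expansion[OF this, of n] show ?thesis by simp
  qed
  have q_bound: "q \<in> O(\<lambda>n. of_real (real n powr (-5/2)))"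
  proof -
    have "norm ((deriv ^^ 3) Q z) \<le> C / sqrt (1 - norm z)" if "norm z < 1" for z
      using C(2)[OF that] unfolding Q_def[abs_def] k_def .
    from coeff_bound_of_third_deriv[OF Q_hol C(1) this] show ?thesis unfolding Q_coeff .
  qed
  define F where "F = inf sequentially (principal {n. n \<ge> 1 \<and> d dvd n - 1})"
  have F_iff: "eventually P F \<longleftrightarrow> (\<forall>\<^sub>F n in sequentially. n \<ge> 1 \<and> d dvd n - 1 \<longrightarrow> P n)" for P
    unfolding F_def eventually_inf_principal by simp
  have k: "k > 0" using a p by (simp add: k_def)
  obtain B1 where B1: "B1 > 0" "\<forall>\<^sub>F n in sequentially. norm (q n) \<le> B1 * norm (real n powr (-5/2))"
    using landau_o.bigE[OF q_bound] by (auto simp: norm_of_real)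
  obtain B2 where B2: "B2 > 0" "\<forall>\<^sub>F n in sequentially. norm ((3/2::real) gchoose n) \<le> B2 * norm (real n powr (-5/2))"
    using landau_o.bigE[OF gbinomial_bigo[of "3/2"]] by auto
  have "(\<lambda>n. h n - (d * k) * sqrt_coeff n) \<in> O[F](\<lambda>n. real n powr (-5/2))"
  proof (rule landau_o.bigI[of "B1 + d * norm c3 * B2"])
    show "B1 + d * norm c3 * B2 > 0" using B1 B2 by (simp add: add_pos_nonneg)
    have "\<forall>\<^sub>F n in sequentially. n \<ge> 1 \<and> d dvd n - 1 \<longrightarrow>
        norm (h n - (d * k) * sqrt_coeff n) \<le> (B1 + d * norm c3 * B2) * norm (real n powr (-5/2))"
      using B1(2) B2(2)
    proof eventually_elim
      case (elim n)
      show ?case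
      proof
        assume n: "n \<ge> 1 \<and> d dvd n - 1"
        define t where "t = (-1) ^ n * complex_of_real ((3/2) gchoose n)"
        have "q n = of_real (h n) - (\<Sum>\<zeta> | \<zeta> ^ d = 1. (c3 * t + of_real k * of_real (sqrt_coeff n)) * (inverse \<zeta> * \<zeta> ^ n))"
          unfolding q_def t_def by (intro arg_cong2[where f = "(-)"] sum.cong refl) (simp add: algebra_simps)
        also have "\<dots> = of_real (h n - (d * k) * sqrt_coeff n) - of_nat d * c3 * t"
          unfolding sum_distrib_left[symmetric] sum_roots_of_unity_power[OF d0 conjunct1[OF n] conjunct2[OF n]]
          by (simp add: algebra_simps)
        finally have "of_real (h n - (d * k) * sqrt_coeff n) = q n + of_nat d * c3 * t" by simp
        then have "norm (h n - (d * k) * sqrt_coeff n) = norm (q n + of_nat d * c3 * t)"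
          by (metis norm_of_real real_norm_def)
        also have "\<dots> \<le> norm (q n) + d * norm c3 * norm t"
          by (rule order.trans[OF norm_triangle_ineq]) (simp add: norm_mult)
        also have "norm t = norm ((3/2::real) gchoose n)" by (simp add: t_def norm_mult norm_power)
        also have "norm (q n) + d * norm c3 * norm ((3/2::real) gchoose n)
            \<le> B1 * norm (real n powr (-5/2)) + d * norm c3 * (B2 * norm (real n powr (-5/2)))"
          using elim by (intro add_mono mult_left_mono) auto
        finally show "norm (h n - (d * k) * sqrt_coeff n) \<le> (B1 + d * norm c3 * B2) * norm (real n powr (-5/2))"
          by (simp add: algebra_simps)
      qed
    qed
    then show "\<forall>\<^sub>F n in F. norm (h n - (d * k) * sqrt_coeff n) \<le> (B1 + d * norm c3 * B2) * norm (real n powr (-5/2))"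
      unfolding F_iff .
  qed
  moreover have "d * k > 0" using d0 k by simp
  ultimately show ?thesis unfolding F_def by blast
qed

section \<open>Trees and their root subtrees\<close>

lemma Nil_in_nodes: "[] \<in> nodes T"
  by (cases T) auto

lemma tree_size_pos: "tree_size T > 0"
  using Nil_in_nodes[of T] finite_nodes[of T] by (auto simp: tree_size_def card_gt_0_iff)

lemma nodes_Node_Cons: "i # v \<in> nodes (Node ts) \<longleftrightarrow> i < length ts \<and> v \<in> nodes (ts ! i)"
  by auto

lemma tree_size_Node: "tree_size (Node ts) = Suc (sum_list (map tree_size ts))"
proof -
  have "card (nodes (Node ts)) = Suc (card (\<Union>i\<in>{..<length ts}. (#) i ` nodes (ts ! i)))"
    unfolding nodes.simps by (rule card_insert_disjoint) (auto intro: finite_nodes)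
  also have "card (\<Union>i\<in>{..<length ts}. (#) i ` nodes (ts ! i)) = (\<Sum>i<length ts. tree_size (ts ! i))"
    by (subst card_UN_disjoint) (auto simp: finite_nodes tree_size_def card_image)
  finally show ?thesis by (simp add: tree_size_def sum_list_sum_nth atLeast0LessThan)
qed

lemma outdegree_Nil: "outdegree (Node ts) [] = length ts"
proof -
  have "{u \<in> nodes (Node ts). \<exists>i. u = [] @ [i]} = (\<lambda>i. [i]) ` {..<length ts}"
    using Nil_in_nodes by (auto simp del: nodes.simps simp: nodes_Node_Cons)
  then show ?thesis unfolding outdegree_def by (simp add: card_image inj_on_def)
qed

lemma outdegree_Cons:
  assumes "i < length ts"
  shows "outdegree (Node ts) (i # v) = outdegree (ts ! i) v"
proof -
  have "{u \<in> nodes (Node ts). \<exists>j. u = (i # v) @ [j]} = (#) i ` {u \<in> nodes (ts ! i). \<exists>j. u = v @ [j]}"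
    using assms by (auto simp del: nodes.simps simp: nodes_Node_Cons)
  then show ?thesis unfolding outdegree_def by (simp add: card_image)
qed

lemma prod_list_conv_prod_nth:
  "prod_list (map f xs) = (\<Prod>i<length xs. f (xs ! i) :: 'a :: comm_monoid_mult)"
  by (induction xs) (simp_all add: prod.lessThan_Suc_shift del: prod.lessThan_Suc)

lemma tree_weight_Node: "tree_weight w (Node ts) = w (length ts) * prod_list (map (tree_weight w) ts)"
proof -
  have "tree_weight w (Node ts) = w (length ts) *
      (\<Prod>v\<in>(\<Union>i\<in>{..<length ts}. (#) i ` nodes (ts ! i)). w (outdegree (Node ts) v))"
    unfolding tree_weight_def nodes.simps
    by (subst prod.insert) (auto simp: outdegree_Nil intro: finite_nodes)
  also have "(\<Prod>v\<in>(\<Union>i\<in>{..<length ts}. (#) i ` nodes (ts ! i)). w (outdegree (Node ts) v)) =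
      (\<Prod>i<length ts. \<Prod>v\<in>(#) i ` nodes (ts ! i). w (outdegree (Node ts) v))"
    by (rule prod.UNION_disjoint) (auto intro: finite_nodes)
  also have "\<dots> = (\<Prod>i<length ts. tree_weight w (ts ! i))"
    by (intro prod.cong refl) (simp add: prod.reindex tree_weight_def outdegree_Cons)
  finally show ?thesis by (simp add: prod_list_conv_prod_nth)
qed

text \<open>
  A set of nodes containing the root is connected exactly if it is closed under parents: a path from
  a node \<open>v @ [i]\<close> of the set to the root has to leave the branch below \<open>v @ [i]\<close>, and the only way
  out is the edge to \<open>v\<close>.
\<close>

lemma connected_nodes_iff:
  assumes "[] \<in> S"
  shows "connected_nodes S \<longleftrightarrow> (\<forall>v i. v @ [i] \<in> S \<longrightarrow> v \<in> S)"
proof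
  let ?E = "\<lambda>a b. a \<in> S \<and> b \<in> S \<and> adjacent a b"
  assume conn: "connected_nodes S"
  show "\<forall>v i. v @ [i] \<in> S \<longrightarrow> v \<in> S"
  proof (intro allI impI)
    fix v i assume "v @ [i] \<in> S"
    then have "?E\<^sup>*\<^sup>* (v @ [i]) []" using conn assms by (auto simp: connected_nodes_def)
    moreover have "(\<exists>x. b = (v @ [i]) @ x) \<or> v \<in> S" if "?E\<^sup>*\<^sup>* (v @ [i]) b" for b
      using that
    proof (induction rule: rtranclp_induct)
      case (step a b)
      show ?case
      proof (cases "v \<in> S")
        case False
        then obtain x where x: "a = (v @ [i]) @ x" using step by blast
        consider j where "b = a @ [j]" | j where "a = b @ [j]"
          using step.hyps by (auto simp: adjacent_def)
        then show ?thesis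
        proof cases
          case 2
          then show ?thesis using x step.hyps by (cases x rule: rev_cases) auto
        qed (use x in auto)
      qed auto
    qed auto
    ultimately show "v \<in> S" by fastforce
  qed
next
  let ?E = "\<lambda>a b. a \<in> S \<and> b \<in> S \<and> adjacent a b"
  assume closed: "\<forall>v i. v @ [i] \<in> S \<longrightarrow> v \<in> S"
  have to_root: "?E\<^sup>*\<^sup>* u []" if "u \<in> S" for u
    using that
  proof (induction u rule: rev_induct)
    case (snoc i u)
    then have "u \<in> S" using closed by blast
    then have "?E (u @ [i]) u" using snoc by (auto simp: adjacent_def)
    then show ?case using snoc.IH[OF \<open>u \<in> S\<close>] by (rule converse_rtranclp_into_rtranclp)
  qed auto
  have "symp ?E" by (auto simp: symp_def adjacent_def)
  then have "symp ?E\<^sup>*\<^sup>*" by (rule symp_rtranclp)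
  then show "connected_nodes S"
    unfolding connected_nodes_def using to_root by (meson rtranclp_trans sympD)
qed

lemma root_subtrees_iff:
  "S \<in> root_subtrees T \<longleftrightarrow> S \<subseteq> nodes T \<and> [] \<in> S \<and> (\<forall>v i. v @ [i] \<in> S \<longrightarrow> v \<in> S)"
  using connected_nodes_iff by (auto simp: root_subtrees_def)

lemma finite_root_subtrees: "finite (root_subtrees T)"
  by (rule finite_subset[of _ "Pow (nodes T)"]) (auto simp: root_subtrees_def finite_nodes)

text \<open>
  A root subtree is determined by its traces on the branches, each of which is empty or a root subtree
  of that branch; every choice of traces occurs.
\<close>

lemma num_root_subtrees_Node:
  "num_root_subtrees (Node ts) = prod_list (map (\<lambda>t. 1 + num_root_subtrees t) ts)"
proof -
  let ?n = "length ts"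
  let ?P = "\<Pi>\<^sub>E i\<in>{..<?n}. insert {} (root_subtrees (ts ! i))"
  define f :: "nat list set \<Rightarrow> nat \<Rightarrow> nat list set" where "f S = (\<lambda>i\<in>{..<?n}. {v. i # v \<in> S})" for S
  define g :: "(nat \<Rightarrow> nat list set) \<Rightarrow> nat list set" where "g F = insert [] (\<Union>i\<in>{..<?n}. (#) i ` F i)" for F
  have "bij_betw f (root_subtrees (Node ts)) ?P"
  proof (rule bij_betw_byWitness[where f' = g])
    show "\<forall>S\<in>root_subtrees (Node ts). g (f S) = S"
    proof
      fix S assume S: "S \<in> root_subtrees (Node ts)"
      then have "[] \<in> S" "i < ?n" if "i # v \<in> S" for i v
        using that nodes_Node_Cons by (auto simp: root_subtrees_iff simp del: nodes.simps)
      then have "x \<in> g (f S) \<longleftrightarrow> x \<in> S" for x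
        using S by (cases x) (auto simp: root_subtrees_iff g_def f_def simp del: nodes.simps)
      then show "g (f S) = S" by blast
    qed
    show "\<forall>F\<in>?P. f (g F) = F"
    proof
      fix F assume F: "F \<in> ?P"
      have "f (g F) i = F i" for i
        using F by (cases "i < ?n") (auto simp: f_def g_def PiE_def extensional_def)
      then show "f (g F) = F" by blast
    qed
    show "f ` root_subtrees (Node ts) \<subseteq> ?P"
    proof (rule image_subsetI)
      fix S assume S: "S \<in> root_subtrees (Node ts)"
      have "{v. i # v \<in> S} \<in> insert {} (root_subtrees (ts ! i))" if i: "i < ?n" for i
      proof (cases "{v. i # v \<in> S} = {}")
        case False
        then obtain v where "i # v \<in> S" by auto
        then have "i # [] \<in> S"
        proof (induction v rule: rev_induct)
          case (snoc j v)
          then show ?case using S by (metis append_Cons root_subtrees_iff)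
        qed
        moreover have "{v. i # v \<in> S} \<subseteq> nodes (ts ! i)"
          using S by (auto simp: root_subtrees_iff nodes_Node_Cons simp del: nodes.simps)
        moreover have "i # v \<in> S" if "i # v @ [j] \<in> S" for v j
          using S that by (metis append_Cons root_subtrees_iff)
        ultimately show ?thesis by (auto simp: root_subtrees_iff)
      qed auto
      then show "f S \<in> ?P" by (simp add: f_def)
    qed
    show "g ` ?P \<subseteq> root_subtrees (Node ts)"
    proof (rule image_subsetI)
      fix F assume F: "F \<in> ?P"
      then have Fi: "F i = {} \<or> F i \<in> root_subtrees (ts ! i)" if "i < ?n" for i
        using that by (auto simp: PiE_def Pi_def)
      have "g F \<subseteq> nodes (Node ts)"
        using Fi by (fastforce simp: g_def root_subtrees_iff)
      moreover have "v \<in> g F" if "v @ [j] \<in> g F" for v j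
      proof (cases v)
        case (Cons i x)
        then have "i < ?n" "x @ [j] \<in> F i" using that by (auto simp: g_def)
        then have "x \<in> F i" using Fi[of i] by (auto simp: root_subtrees_iff)
        then show ?thesis using Cons \<open>i < ?n\<close> by (auto simp: g_def)
      qed (simp add: g_def)
      ultimately show "g F \<in> root_subtrees (Node ts)" by (auto simp: root_subtrees_iff g_def)
    qed
  qed
  then have "num_root_subtrees (Node ts) = card ?P"
    unfolding num_root_subtrees_def by (rule bij_betw_same_card)
  also have "\<dots> = (\<Prod>i<?n. card (insert {} (root_subtrees (ts ! i))))" by (simp add: card_PiE)
  also have "\<dots> = (\<Prod>i<?n. 1 + num_root_subtrees (ts ! i))"
    by (intro prod.cong refl, subst card_insert_disjoint)
       (auto simp: finite_root_subtrees num_root_subtrees_def root_subtrees_iff)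
  finally show ?thesis by (simp add: prod_list_conv_prod_nth)
qed

definition forests :: "nat \<Rightarrow> nat \<Rightarrow> otree list set" where
  "forests k n = {ts. length ts = k \<and> sum_list (map tree_size ts) = n}"

lemma length_le_sum_tree_size: "length ts \<le> sum_list (map tree_size ts)"
proof (induction ts)
  case (Cons t ts)
  then show ?case using tree_size_pos[of t] by simp
qed simp

lemma finite_forest_sizes: "finite {ts. sum_list (map tree_size ts) = n}"
proof (rule finite_subset)
  show "{ts. sum_list (map tree_size ts) = n} \<subseteq> {ts. set ts \<subseteq> {T. tree_size T \<le> n} \<and> length ts \<le> n}"
    using length_le_sum_tree_size by (auto intro: member_le_sum_list)
  show "finite {ts. set ts \<subseteq> {T. tree_size T \<le> n} \<and> length ts \<le> n}"
    by (rule finite_lists_length_le[OF finite_trees_le])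
qed

lemma finite_forests: "finite (forests k n)"
  by (rule finite_subset[OF _ finite_forest_sizes[of n]]) (auto simp: forests_def)

definition tree_fps :: "(otree \<Rightarrow> real) \<Rightarrow> real fps" where
  "tree_fps b = Abs_fps (\<lambda>n. \<Sum>T | tree_size T = n. b T)"

text \<open>
  A forest of \<open>k\<close> trees is a \<open>k\<close>-tuple of trees, so the generating function of forests under a
  multiplicative weight is a \<open>k\<close>-th power.
\<close>

lemma forest_sum: "(\<Sum>ts\<in>forests k n. prod_list (map b ts)) = fps_nth (tree_fps b ^ k) n"
proof (induction k arbitrary: n)
  case 0
  have "forests 0 n = (if n = 0 then {[]} else {})" by (auto simp: forests_def)
  then show ?case by simp
next
  case (Suc k)
  have "forests (Suc k) n = (\<lambda>(t, ts). t # ts) ` (SIGMA t:{t. tree_size t \<le> n}. forests k (n - tree_size t))"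
    by (auto simp: forests_def length_Suc_conv image_iff)
  then have "(\<Sum>ts\<in>forests (Suc k) n. prod_list (map b ts)) =
     (\<Sum>(t, ts)\<in>(SIGMA t:{t. tree_size t \<le> n}. forests k (n - tree_size t)). b t * prod_list (map b ts))"
    by (simp add: sum.reindex inj_on_def case_prod_unfold o_def)
  also have "\<dots> = (\<Sum>t | tree_size t \<le> n. b t * fps_nth (tree_fps b ^ k) (n - tree_size t))"
    by (subst sum.Sigma[symmetric]) (auto simp: finite_trees_le finite_forests Suc.IH simp flip: sum_distrib_left)
  also have "\<dots> = (\<Sum>i=0..n. \<Sum>t | t \<in> {t. tree_size t \<le> n} \<and> tree_size t = i. b t * fps_nth (tree_fps b ^ k) (n - tree_size t))"
    by (rule sum.group[symmetric]) (auto simp: finite_trees_le)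
  also have "\<dots> = (\<Sum>i=0..n. (\<Sum>t | tree_size t = i. b t) * fps_nth (tree_fps b ^ k) (n - i))"
    unfolding sum_distrib_right by (intro sum.cong refl) auto
  also have "\<dots> = fps_nth (tree_fps b ^ Suc k) n" by (simp add: fps_mult_nth tree_fps_def)
  finally show ?case .
qed

text \<open>
  Decomposition of a tree at its root. The weights \<open>a\<close> of the tree and \<open>b\<close> of the branches may
  differ: for the moments of the number \<open>R\<close> of root subtrees, \<open>a\<close> involves \<open>R\<^sup>m\<close> and \<open>b\<close> involves
  \<open>(1 + R)\<^sup>m\<close>.
\<close>

lemma tree_fps_eq:
  assumes "\<And>ts. a (Node ts) = w (length ts) * prod_list (map b ts)"
  shows "tree_fps a = fps_X * (Abs_fps w oo tree_fps b)"
proof (rule fps_ext)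
  fix n
  show "fps_nth (tree_fps a) n = fps_nth (fps_X * (Abs_fps w oo tree_fps b)) n"
  proof (cases n)
    case 0
    moreover have "{T. tree_size T = 0} = {}" using tree_size_pos by auto
    then have "sum a {T. tree_size T = 0} = 0" by (simp only: sum.empty)
    ultimately show ?thesis by (simp add: tree_fps_def)
  next
    case (Suc m)
    have "{T. tree_size T = Suc m} = Node ` {ts. sum_list (map tree_size ts) = m}"
    proof safe
      fix T assume "tree_size T = Suc m"
      then show "T \<in> Node ` {ts. sum_list (map tree_size ts) = m}"
        by (cases T) (auto simp: tree_size_Node)
    qed (simp add: tree_size_Node)
    then have "fps_nth (tree_fps a) n = (\<Sum>ts | sum_list (map tree_size ts) = m. w (length ts) * prod_list (map b ts))"
      using Suc assms by (simp add: tree_fps_def sum.reindex inj_on_def)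
    also have "\<dots> = (\<Sum>k=0..m. \<Sum>ts | ts \<in> {ts. sum_list (map tree_size ts) = m} \<and> length ts = k. w (length ts) * prod_list (map b ts))"
      by (rule sum.group[symmetric]) (use length_le_sum_tree_size finite_forest_sizes in auto)
    also have "\<dots> = (\<Sum>k=0..m. w k * (\<Sum>ts\<in>forests k m. prod_list (map b ts)))"
      unfolding sum_distrib_left by (intro sum.cong refl) (auto simp: forests_def)
    also have "\<dots> = fps_nth (fps_X * (Abs_fps w oo tree_fps b)) n"
      using Suc by (simp add: forest_sum fps_compose_nth)
    finally show ?thesis .
  qed
qed

text \<open>
  In a tree of positive weight every outdegree is divisible by the span of the weight sequence, and
  the outdegrees add up to the number of nodes other than the root.
\<close>

lemma tree_size_mod:
  assumes w: "\<And>i. w i \<ge> (0::real)" and "tree_weight w T \<noteq> 0"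
  shows "Gcd {i. w i > 0} dvd tree_size T - 1"
  using assms(2)
proof (induction T)
  case (Node ts)
  define d where "d = Gcd {i. w i > 0}"
  have "w (length ts) \<noteq> 0" and nz: "\<And>t. t \<in> set ts \<Longrightarrow> tree_weight w t \<noteq> 0"
    using Node.prems by (auto simp: tree_weight_Node prod_list_zero_iff)
  then have "w (length ts) > 0" using w[of "length ts"] by simp
  then have len: "d dvd length ts" unfolding d_def by (intro Gcd_dvd) simp
  have dvd_sum: "d dvd sum_list xs" if "\<And>x. x \<in> set xs \<Longrightarrow> d dvd x" for xs
    using that by (induction xs) auto
  have "d dvd sum_list (map (\<lambda>t. tree_size t - 1) ts)"
    by (rule dvd_sum) (use Node.IH nz in \<open>auto simp: d_def\<close>)
  moreover have "sum_list (map tree_size ts) = sum_list (map (\<lambda>t. tree_size t - 1) ts) + length ts"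
    using tree_size_pos by (induction ts) (auto simp: Suc_diff_le Suc_leI)
  ultimately show ?case using len by (simp add: tree_size_Node d_def)
qed

section \<open>The functional equation for numerical series\<close>

lemma generator_summable: "ereal \<bar>x\<bar> < conv_radius a \<Longrightarrow> summable (\<lambda>n. a n * x ^ n)"
  by (intro summable_in_conv_radius) simp

lemma generator_mono:
  assumes a: "\<And>n. a n \<ge> 0" and x: "0 \<le> x" "x \<le> y" and s: "summable (\<lambda>n. a n * y ^ n)"
  shows "generator a x \<le> generator a y" "summable (\<lambda>n. a n * x ^ n)"
proof -
  have le: "a n * x ^ n \<le> a n * y ^ n" for n
    using a x by (intro mult_left_mono power_mono) auto
  show s': "summable (\<lambda>n. a n * x ^ n)"
    by (rule summable_comparison_test'[OF s, of 0]) (use le a x in auto)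
  show "generator a x \<le> generator a y"
    unfolding generator_def by (rule suminf_le[OF le s' s])
qed

lemma generator_ge_term:
  assumes a: "\<And>n. a n \<ge> 0" and x: "0 \<le> x" and s: "summable (\<lambda>n. a n * x ^ n)"
  shows "a n * x ^ n \<le> generator a x"
  using sum_le_suminf[OF s, of "{n}"] a x by (simp add: generator_def)

lemma generator_strict_mono:
  assumes a: "\<And>n. a n \<ge> 0" "a k > 0" "k \<ge> 1" and x: "0 \<le> x" "x < y" and s: "summable (\<lambda>n. a n * y ^ n)"
  shows "generator a x < generator a y"
proof -
  have s': "summable (\<lambda>n. a n * x ^ n)" using generator_mono(2)[OF a(1) _ _ s, of x] x by simp
  have "0 < (\<Sum>n. a n * y ^ n - a n * x ^ n)"
  proof (rule suminf_pos2[of _ k])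
    show "a n * y ^ n - a n * x ^ n \<ge> 0" for n
      using a(1)[of n] x by (simp add: mult_left_mono power_mono)
    show "0 < a k * y ^ k - a k * x ^ k"
      using a(2,3) x power_strict_mono[of x y k] by simp
  qed (intro summable_diff s s')
  then show ?thesis using suminf_diff[OF s s'] by (simp add: generator_def)
qed

lemma has_field_derivative_generator:
  "ereal \<bar>x\<bar> < conv_radius a \<Longrightarrow> (generator a has_field_derivative generator (diffs a) x) (at x)"
  unfolding generator_def[abs_def] by (intro has_field_derivative_powser) simp

lemma isCont_generator: "ereal \<bar>x\<bar> < conv_radius a \<Longrightarrow> isCont (generator a) x"
  by (rule DERIV_isCont[OF has_field_derivative_generator])

text \<open>
  Expanding the power of the partial sum produces all terms on the left, and further nonnegative ones.
\<close>

lemma fps_power_partial_sum_le: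
  fixes f :: "real fps"
  assumes f: "\<And>n. fps_nth f n \<ge> 0" and x: "x \<ge> 0"
  shows "(\<Sum>n\<le>N. fps_nth (f ^ i) n * x ^ n) \<le> (\<Sum>n\<le>N. fps_nth f n * x ^ n) ^ i"
    and "fps_nth (f ^ i) n \<ge> 0"
proof -
  have nn: "fps_nth (f ^ i) n \<ge> 0" for i n
  proof (induction i arbitrary: n)
    case (Suc i)
    then show ?case using f by (auto simp: fps_mult_nth intro!: sum_nonneg mult_nonneg_nonneg)
  qed (simp add: fps_one_nth)
  then show "fps_nth (f ^ i) n \<ge> 0" .
  show "(\<Sum>n\<le>N. fps_nth (f ^ i) n * x ^ n) \<le> (\<Sum>n\<le>N. fps_nth f n * x ^ n) ^ i"
  proof (induction i)
    case 0
    have "(\<Sum>n\<le>N. fps_nth (1 :: real fps) n * x ^ n) = 1"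
      by (subst sum.remove[of _ 0]) (auto intro!: sum.neutral simp: fps_one_nth)
    then show ?case by simp
  next
    case (Suc i)
    define u v where "u n = fps_nth f n * x ^ n" and "v n = fps_nth (f ^ i) n * x ^ n" for n
    have uv: "u n \<ge> 0" "v n \<ge> 0" for n using f nn x by (auto simp: u_def v_def)
    have "(\<Sum>n\<le>N. fps_nth (f ^ Suc i) n * x ^ n) = (\<Sum>n\<le>N. \<Sum>j\<le>n. u j * v (n - j))"
    proof (intro sum.cong refl)
      fix n
      have "x ^ n = x ^ j * x ^ (n - j)" if "j \<le> n" for j
        using that by (simp flip: power_add)
      then show "fps_nth (f ^ Suc i) n * x ^ n = (\<Sum>j\<le>n. u j * v (n - j))"
        unfolding power_Suc fps_mult_nth sum_distrib_right atLeast0AtMost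
        by (intro sum.cong refl) (simp add: u_def v_def)
    qed
    also have "\<dots> = (\<Sum>(j, l)\<in>{(j, l). j + l \<le> N}. u j * v l)"
      by (rule sum.triangle_reindex_eq[symmetric])
    also have "\<dots> \<le> (\<Sum>(j, l)\<in>{..N} \<times> {..N}. u j * v l)"
      using uv by (intro sum_mono2) auto
    also have "\<dots> = (\<Sum>n\<le>N. u n) * (\<Sum>n\<le>N. v n)"
      by (simp add: sum_product sum.cartesian_product)
    also have "\<dots> \<le> (\<Sum>n\<le>N. u n) * (\<Sum>n\<le>N. fps_nth f n * x ^ n) ^ i"
      using Suc uv by (intro mult_left_mono sum_nonneg) (auto simp: v_def)
    finally show ?case by (simp add: u_def)
  qed
qed

text \<open>
  A supersolution \<open>y\<close> of the equation at \<open>x\<close> bounds all partial sums of \<open>h\<close> at \<open>x\<close>, by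
  induction on their length: the coefficients of \<open>h\<close> up to \<open>N + 1\<close> depend only on those up to \<open>N\<close>.
  This is how convergence of \<open>h\<close> beyond a given point is obtained.
\<close>

lemma implicit_series_dominated:
  fixes w g h :: "nat \<Rightarrow> real"
  assumes nonneg: "\<And>n. w n \<ge> 0" "\<And>n. g n \<ge> 0" "\<And>n. h n \<ge> 0" and h0: "h 0 = 0"
    and eq: "Abs_fps h = Abs_fps g + fps_X * (Abs_fps w oo Abs_fps h)"
    and x: "x \<ge> 0" and y: "y \<ge> 0" "ereal y < conv_radius w" and g: "summable (\<lambda>n. g n * x ^ n)"
    and le: "generator g x + x * generator w y \<le> y"
  shows "summable (\<lambda>n. h n * x ^ n)" "generator h x \<le> y"
proof -
  have sw: "summable (\<lambda>n. w n * y ^ n)" using y by (intro generator_summable) simp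
  have coeff: "h (Suc n) = g (Suc n) + (\<Sum>i\<le>n. w i * fps_nth (Abs_fps h ^ i) n)" for n
    using arg_cong[OF eq, of "\<lambda>f. fps_nth f (Suc n)"] by (simp add: fps_compose_nth atLeast0AtMost)
  have pw: "fps_nth (Abs_fps h ^ i) n \<ge> 0" for i n
    using fps_power_partial_sum_le(2)[of "Abs_fps h"] nonneg(3) x by simp
  have p: "(\<Sum>n\<le>N. h n * x ^ n) \<le> y" for N
  proof (induction N)
    case 0
    then show ?case using h0 y by simp
  next
    case (Suc N)
    have p0: "0 \<le> (\<Sum>n\<le>N. h n * x ^ n)" using nonneg x by (intro sum_nonneg) auto
    have "(\<Sum>n\<le>N. (\<Sum>i\<le>n. w i * fps_nth (Abs_fps h ^ i) n) * x ^ n)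
       \<le> (\<Sum>n\<le>N. (\<Sum>i\<le>N. w i * fps_nth (Abs_fps h ^ i) n) * x ^ n)"
      using nonneg pw x by (intro sum_mono mult_right_mono sum_mono2) auto
    also have "\<dots> = (\<Sum>i\<le>N. w i * (\<Sum>n\<le>N. fps_nth (Abs_fps h ^ i) n * x ^ n))"
      unfolding sum_distrib_left sum_distrib_right by (subst sum.swap) (simp add: mult.assoc)
    also have "\<dots> \<le> (\<Sum>i\<le>N. w i * y ^ i)"
    proof (intro sum_mono mult_left_mono nonneg)
      fix i
      have "(\<Sum>n\<le>N. fps_nth (Abs_fps h ^ i) n * x ^ n) \<le> (\<Sum>n\<le>N. h n * x ^ n) ^ i"
        using fps_power_partial_sum_le(1)[of "Abs_fps h" x i N] nonneg(3) x by simp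
      also have "\<dots> \<le> y ^ i" using Suc p0 by (intro power_mono)
      finally show "(\<Sum>n\<le>N. fps_nth (Abs_fps h ^ i) n * x ^ n) \<le> y ^ i" .
    qed
    also have "\<dots> \<le> generator w y"
      unfolding generator_def using nonneg y by (intro sum_le_suminf sw) auto
    finally have 1: "x * (\<Sum>n\<le>N. (\<Sum>i\<le>n. w i * fps_nth (Abs_fps h ^ i) n) * x ^ n) \<le> x * generator w y"
      using x by (rule mult_left_mono)
    have "(\<Sum>n\<le>Suc N. h n * x ^ n) = (\<Sum>n\<le>N. h (Suc n) * x ^ Suc n)"
      by (simp add: sum.atMost_Suc_shift h0 del: sum.atMost_Suc)
    also have "\<dots> = (\<Sum>n\<le>N. g (Suc n) * x ^ Suc n) + x * (\<Sum>n\<le>N. (\<Sum>i\<le>n. w i * fps_nth (Abs_fps h ^ i) n) * x ^ n)"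
      unfolding sum_distrib_left sum.distrib[symmetric] by (intro sum.cong refl) (simp add: coeff algebra_simps)
    also have "(\<Sum>n\<le>N. g (Suc n) * x ^ Suc n) \<le> (\<Sum>n\<le>Suc N. g n * x ^ n)"
      using nonneg x by (simp add: sum.atMost_Suc_shift del: sum.atMost_Suc)
    also have "\<dots> \<le> generator g x"
      unfolding generator_def using nonneg x by (intro sum_le_suminf g) auto
    finally show ?case using 1 le by simp
  qed
  have p': "(\<Sum>i<n. h i * x ^ i) \<le> y" for n
  proof -
    have "(\<Sum>i<n. h i * x ^ i) \<le> (\<Sum>i\<le>n. h i * x ^ i)" using nonneg x by (intro sum_mono2) auto
    then show ?thesis using p[of n] by simp
  qed
  show s: "summable (\<lambda>n. h n * x ^ n)"
    by (rule summableI_nonneg_bounded[of _ y]) (use p' nonneg x in auto)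
  show "generator h x \<le> y"
    unfolding generator_def by (rule suminf_le_const[OF s p'])
qed

lemma fps_power_sums:
  fixes f :: "complex fps"
  assumes "summable (\<lambda>n. norm (fps_nth f n * z ^ n))" "(\<lambda>n. fps_nth f n * z ^ n) sums s"
  shows "(\<lambda>n. fps_nth (f ^ i) n * z ^ n) sums s ^ i \<and> summable (\<lambda>n. norm (fps_nth (f ^ i) n * z ^ n))"
proof (induction i)
  case 0
  have "fps_nth (f ^ 0) n * z ^ n = (if n = 0 then 1 else 0)" for n
    by (simp add: fps_one_nth)
  moreover have "summable (\<lambda>n. norm (if n = 0 then 1 else 0 :: complex))"
    by (rule summable_finite[of "{0}"]) auto
  ultimately show ?case using sums_single[of 0 "\<lambda>_. 1 :: complex"] by (simp only: power_0)
next
  case (Suc i)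
  have eq: "fps_nth (f ^ Suc i) n * z ^ n = (\<Sum>j\<le>n. (fps_nth f j * z ^ j) * (fps_nth (f ^ i) (n - j) * z ^ (n - j)))" for n
  proof -
    have "z ^ n = z ^ j * z ^ (n - j)" if "j \<le> n" for j
      using that by (simp flip: power_add)
    then show ?thesis
      unfolding power_Suc fps_mult_nth sum_distrib_right atLeast0AtMost
      by (intro sum.cong refl) simp
  qed
  have "(\<lambda>n. \<Sum>j\<le>n. (fps_nth f j * z ^ j) * (fps_nth (f ^ i) (n - j) * z ^ (n - j))) sums
      ((\<Sum>n. fps_nth f n * z ^ n) * (\<Sum>n. fps_nth (f ^ i) n * z ^ n))"
    using assms(1) Suc by (intro Cauchy_product_sums) auto
  then have "(\<lambda>n. fps_nth (f ^ Suc i) n * z ^ n) sums s ^ Suc i"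
    unfolding eq using assms(2) Suc by (simp add: sums_iff)
  moreover have "summable (\<lambda>n. norm (fps_nth (f ^ Suc i) n * z ^ n))"
  proof -
    have "summable (\<lambda>n. \<Sum>j\<le>n. norm (fps_nth f j * z ^ j) * norm (fps_nth (f ^ i) (n - j) * z ^ (n - j)))"
      using assms(1) Suc by (intro summable_Cauchy_product) auto
    then show ?thesis
      unfolding eq by (rule summable_comparison_test'[of _ 0])
        (auto simp: norm_mult intro!: order.trans[OF norm_sum] sum_mono)
  qed
  ultimately show ?case by blast
qed

text \<open>
  The double series \<open>\<Sum>\<^sub>i w\<^sub>i \<Sum>\<^sub>n [z\<^sup>n]h\<^sup>i z\<^sup>n\<close> is dominated by its value at \<open>x\<close> and may be summed in
  either order. This also covers points on the circle of convergence of \<open>h\<close>, where \<open>h\<close> merely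
  converges absolutely.
\<close>

lemma gf_compose_sums:
  fixes w h :: "nat \<Rightarrow> real"
  assumes nonneg: "\<And>n. w n \<ge> 0" "\<And>n. h n \<ge> 0" and h0: "h 0 = 0"
    and z: "norm z \<le> x" and h: "summable (\<lambda>n. h n * x ^ n)" and R: "ereal (generator h x) < conv_radius w"
  shows "(\<lambda>n. of_real (fps_nth (Abs_fps w oo Abs_fps h) n) * z ^ n) sums gf w (gf h z)"
proof -
  define c where "c i n = fps_nth (Abs_fps h ^ i) n" for i n
  have x0: "x \<ge> 0" using z norm_ge_zero order_trans by blast
  have c0: "c i n \<ge> 0" for i n
    using fps_power_partial_sum_le(2)[of "Abs_fps h" x i n] nonneg(2) x0 by (simp add: c_def)
  have cz: "c i n = 0" if "n < i" for i n
    using that startsby_zero_power_prefix[of "Abs_fps h" i] h0 by (simp add: c_def)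
  have sum_c: "(\<lambda>n. of_real (c i n) * y ^ n) sums gf h y ^ i" if "norm y \<le> x" for i and y :: complex
  proof -
    define f where "f = Abs_fps (\<lambda>n. complex_of_real (h n))"
    have f_pow: "fps_nth (f ^ i) n = of_real (c i n)" for i n
    proof (induction i arbitrary: n)
      case (Suc i)
      then show ?case by (simp add: fps_mult_nth c_def f_def)
    qed (simp add: c_def fps_one_nth)
    have s: "summable (\<lambda>n. norm (fps_nth f n * y ^ n))"
    proof (rule summable_comparison_test'[OF h, of 0])
      fix n
      show "norm (norm (fps_nth f n * y ^ n)) \<le> h n * x ^ n"
        using that nonneg(2)[of n] by (simp add: f_def norm_mult norm_power mult_left_mono power_mono)
    qed
    then have "(\<lambda>n. fps_nth f n * y ^ n) sums gf h y"
      unfolding gf_def by (simp add: f_def summable_sums summable_norm_cancel)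
    from conjunct1[OF fps_power_sums[OF s this]] show ?thesis by (simp add: f_pow)
  qed
  have gfx: "gf h (of_real x) = of_real (generator h x)"
    unfolding gf_def generator_def using suminf_of_real[OF h, where 'a = complex] by simp
  have sum_cx: "(\<lambda>n. c i n * x ^ n) sums generator h x ^ i" for i
  proof -
    have "(\<lambda>n. complex_of_real (c i n * x ^ n)) sums of_real (generator h x ^ i)"
      using sum_c[of "of_real x" i] x0 gfx by simp
    then show ?thesis by (simp only: sums_of_real_iff)
  qed
  have H0: "generator h x \<ge> 0"
    unfolding generator_def using nonneg x0 by (intro suminf_nonneg h) auto
  define F where "F i n = of_real (w i * c i n) * z ^ n" for i n
  have normF: "norm (F i n) \<le> w i * c i n * x ^ n" for i n
    using nonneg(1)[of i] c0[of i n] z by (simp add: F_def norm_mult norm_power mult_left_mono power_mono)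
  have F_summable: "(\<lambda>(i, n). F i n) summable_on UNIV \<times> UNIV"
  proof -
    have "(\<lambda>(i, n). w i * c i n * x ^ n) summable_on UNIV \<times> UNIV"
    proof (rule summable_on_SigmaI)
      show "((\<lambda>n. case (i, n) of (i, n) \<Rightarrow> w i * c i n * x ^ n) has_sum w i * generator h x ^ i) UNIV" for i
        using sums_mult[OF sum_cx[of i], of "w i"] nonneg c0 x0
        by (intro norm_summable_imp_has_sum) (auto simp: mult.assoc sums_iff abs_mult)
      have "summable (\<lambda>i. w i * generator h x ^ i)"
        using R H0 by (intro generator_summable) simp
      then show "(\<lambda>i. w i * generator h x ^ i) summable_on UNIV"
        using nonneg H0 by (intro norm_summable_imp_summable_on) simp
    qed (use nonneg c0 x0 in auto)
    then have "(\<lambda>p. norm (case p of (i, n) \<Rightarrow> F i n)) summable_on UNIV \<times> UNIV"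
      by (rule summable_on_comparison_test) (use normF in auto)
    then show ?thesis by (rule abs_summable_summable)
  qed
  have hs1: "((\<lambda>n. F i n) has_sum of_real (w i) * gf h z ^ i) UNIV" for i
  proof (rule norm_summable_imp_has_sum)
    show "(\<lambda>n. F i n) sums (of_real (w i) * gf h z ^ i)"
      using sums_mult[OF sum_c[OF z, of i], of "of_real (w i)"] by (simp add: F_def mult.assoc)
    show "summable (\<lambda>n. norm (F i n))"
    proof (rule summable_comparison_test'[of "\<lambda>n. w i * (c i n * x ^ n)" 0])
      show "summable (\<lambda>n. w i * (c i n * x ^ n))" using sum_cx[of i] by (intro summable_mult) (simp add: sums_iff)
      show "norm (norm (F i n)) \<le> w i * (c i n * x ^ n)" for n using normF[of i n] by (simp add: mult.assoc)
    qed
  qed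
  define S where "S = (\<Sum>\<^sub>\<infinity>(i, n)\<in>UNIV \<times> UNIV. F i n)"
  have hsS: "((\<lambda>(i, n). F i n) has_sum S) (UNIV \<times> UNIV)"
    unfolding S_def using F_summable by (rule has_sum_infsum)
  have "((\<lambda>i. of_real (w i) * gf h z ^ i) has_sum S) UNIV"
    by (rule has_sum_SigmaD[OF hsS]) (use hs1 in auto)
  then have "(\<lambda>i. of_real (w i) * gf h z ^ i) sums S" by (rule has_sum_imp_sums)
  then have S_eq: "S = gf w (gf h z)" by (simp add: gf_def sums_iff)
  have "((\<lambda>(n, i). F i n) has_sum S) (UNIV \<times> UNIV)"
    using hsS has_sum_reindex[of prod.swap "UNIV \<times> UNIV" "\<lambda>(i, n). F i n" S]
    by (simp add: o_def case_prod_unfold)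
  then have "((\<lambda>n. \<Sum>i\<le>n. F i n) has_sum S) UNIV"
  proof (rule has_sum_SigmaD)
    fix n
    have "((\<lambda>i. F i n) has_sum (\<Sum>i\<le>n. F i n)) {..n}" by (rule has_sum_finite) simp
    then show "((\<lambda>i. case (n, i) of (n, i) \<Rightarrow> F i n) has_sum (\<Sum>i\<le>n. F i n)) UNIV"
      by (subst (asm) has_sum_cong_neutral[of UNIV]) (auto simp: F_def cz)
  qed
  then have "(\<lambda>n. \<Sum>i\<le>n. F i n) sums S" by (rule has_sum_imp_sums)
  moreover have "(\<Sum>i\<le>n. F i n) = of_real (fps_nth (Abs_fps w oo Abs_fps h) n) * z ^ n" for n
    by (simp add: F_def fps_compose_nth c_def atLeast0AtMost sum_distrib_right)
  ultimately show ?thesis by (simp add: S_eq)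
qed

lemma implicit_series_functional_eq:
  fixes w g h :: "nat \<Rightarrow> real"
  assumes nonneg: "\<And>n. w n \<ge> 0" "\<And>n. h n \<ge> 0" and h0: "h 0 = 0"
    and eq: "Abs_fps h = Abs_fps g + fps_X * (Abs_fps w oo Abs_fps h)"
    and z: "norm z \<le> x" and h: "summable (\<lambda>n. h n * x ^ n)" and R: "ereal (generator h x) < conv_radius w"
    and g: "ereal x < conv_radius g"
  shows "gf h z = gf g z + z * gf w (gf h z)"
proof -
  define c where "c n = fps_nth (Abs_fps w oo Abs_fps h) n" for n
  have coeff: "h n = g n + (case n of 0 \<Rightarrow> 0 | Suc m \<Rightarrow> c m)" for n
    using arg_cong[OF eq, of "\<lambda>f. fps_nth f n"] by (cases n) (simp_all add: c_def)
  have "(\<lambda>n. of_real (c n) * z ^ n) sums gf w (gf h z)"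
    unfolding c_def using assms by (intro gf_compose_sums)
  from sums_mult[OF this, of z] have "(\<lambda>n. of_real (case Suc n of 0 \<Rightarrow> 0 | Suc m \<Rightarrow> c m) * z ^ Suc n) sums (z * gf w (gf h z))"
    by (simp add: mult_ac)
  then have "(\<lambda>n. of_real (case n of 0 \<Rightarrow> 0 | Suc m \<Rightarrow> c m) * z ^ n) sums (z * gf w (gf h z))"
    by (subst (asm) sums_Suc_iff) simp
  moreover have "(\<lambda>n. of_real (g n) * z ^ n) sums gf g z"
    using z g by (intro gf_sums) (meson ereal_less_eq(3) le_less_trans)
  ultimately have "(\<lambda>n. of_real (g n) * z ^ n + of_real (case n of 0 \<Rightarrow> 0 | Suc m \<Rightarrow> c m) * z ^ n) sums (gf g z + z * gf w (gf h z))"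
    by (rule sums_add[rotated])
  then have "(\<lambda>n. of_real (h n) * z ^ n) sums (gf g z + z * gf w (gf h z))"
    by (subst coeff) (simp add: distrib_right)
  then show ?thesis by (simp add: gf_def sums_iff)
qed

section \<open>Existence of the dominant singularity\<close>

lemma continuous_on_generator_closed:
  assumes "\<And>n. a n \<ge> 0" "summable (\<lambda>n. a n * r ^ n)"
  shows "continuous_on {0..r} (generator a)"
proof -
  have le: "norm (a n * x ^ n) \<le> a n * r ^ n" if "x \<in> {0..r}" for n x
    using assms(1)[of n] that by (simp add: abs_mult mult_left_mono power_mono)
  have "uniform_limit {0..r} (\<lambda>n x. \<Sum>i<n. a i * x ^ i) (\<lambda>x. \<Sum>i. a i * x ^ i) sequentially"
    by (rule Weierstrass_m_test[OF _ assms(2)]) (rule le)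
  moreover have "\<forall>\<^sub>F n in sequentially. continuous_on {0..r} (\<lambda>x. \<Sum>i<n. a i * x ^ i)"
    by (intro always_eventually allI continuous_intros)
  ultimately have "continuous_on {0..r} (\<lambda>x. \<Sum>i. a i * x ^ i)"
    by (intro uniform_limit_theorem) auto
  then show ?thesis by (simp add: generator_def[abs_def])
qed

text \<open>
  Let \<open>B\<close> be the set of \<open>x \<ge> 0\<close> at which \<open>h\<close> converges to a value inside the disc of \<open>w\<close> and
  \<open>x \<Phi>'(H x) \<le> 1\<close>. The singularity \<open>\<rho>\<close> is its supremum. As \<open>\<Phi>'\<close> is unbounded, the condition
  \<open>x \<Phi>'(H x) \<le> 1\<close> keeps \<open>H\<close> away from the circle of convergence, so \<open>\<rho>\<close> itself lies in \<open>B\<close>. If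
  \<open>\<rho> \<Phi>'(H \<rho>)\<close> were smaller than 1, then \<open>y - G \<rho> - \<rho> \<Phi> y\<close> would be positive for \<open>y\<close> slightly above
  \<open>H \<rho>\<close>, hence also with \<open>\<rho>\<close> replaced by a slightly larger \<open>x\<close>, and \<open>implicit_series_dominated\<close>
  would put this \<open>x\<close> into \<open>B\<close>.
\<close>

lemma singularity_exists:
  fixes w g h :: "nat \<Rightarrow> real"
  assumes nonneg: "\<And>n. w n \<ge> 0" "\<And>n. g n \<ge> 0" "\<And>n. h n \<ge> 0" and w2: "i \<ge> 2" "w i > 0"
    and unb: "\<And>B. \<exists>y\<ge>0. ereal y < conv_radius w \<and> generator (diffs w) y > B"
    and h: "h 0 = 0" "h 1 > 0" and eq: "Abs_fps h = Abs_fps g + fps_X * (Abs_fps w oo Abs_fps h)"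
    and sub: "\<And>x. x \<ge> 0 \<Longrightarrow> summable (\<lambda>n. h n * x ^ n) \<Longrightarrow> ereal (generator h x) < conv_radius w \<Longrightarrow>
                x * generator (diffs w) (generator h x) \<le> 1 \<Longrightarrow> ereal x < conv_radius g"
  obtains \<rho> where "\<rho> > 0" "summable (\<lambda>n. h n * \<rho> ^ n)" "ereal (generator h \<rho>) < conv_radius w"
    "\<rho> * generator (diffs w) (generator h \<rho>) = 1" "ereal \<rho> < conv_radius g"
proof -
  define H where "H = generator h"
  define \<Phi>' where "\<Phi>' = generator (diffs w)"
  define B where "B = {x. x \<ge> 0 \<and> summable (\<lambda>n. h n * x ^ n) \<and> ereal (H x) < conv_radius w \<and> x * \<Phi>' (H x) \<le> 1}"
  have dw: "diffs w n \<ge> 0" for n using nonneg(1) by (simp add: diffs_def)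
  have in_R': "ereal \<bar>y\<bar> < conv_radius (diffs w)" if "y \<ge> 0" "ereal y < conv_radius w" for y
    using that conv_radius_diffs[of w] by (simp add: less_le_trans)
  have \<Phi>'_mono: "\<Phi>' x \<le> \<Phi>' y" if "0 \<le> x" "x \<le> y" "ereal y < conv_radius w" for x y
    unfolding \<Phi>'_def using that dw in_R'[of y]
    by (intro generator_mono(1) generator_summable) auto
  have \<Phi>'_nonneg: "\<Phi>' y \<ge> 0" if "0 \<le> y" "ereal y < conv_radius w" for y
    unfolding \<Phi>'_def generator_def using that dw in_R'[of y]
    by (intro suminf_nonneg generator_summable) auto
  have H_mono: "H x \<le> H y" if "0 \<le> x" "x \<le> y" "summable (\<lambda>n. h n * y ^ n)" for x y
    unfolding H_def by (rule generator_mono(1)[OF nonneg(3) that])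
  have H_nonneg: "H x \<ge> 0" if "0 \<le> x" "summable (\<lambda>n. h n * x ^ n)" for x
    unfolding H_def generator_def using that nonneg(3) by (intro suminf_nonneg) auto
  have H0: "H 0 = 0" using powser_zero[of h] h(1) by (simp add: H_def generator_def)
  have R_pos: "conv_radius w > 0"
    using unb[of 0] by (auto intro: le_less_trans[of 0 "ereal _"])
  have B0: "0 \<in> B" using R_pos by (simp add: B_def H0 zero_ereal_def)
  have B_down: "x \<in> B" if "y \<in> B" "0 \<le> x" "x \<le> y" for x y
  proof -
    have y: "summable (\<lambda>n. h n * y ^ n)" "ereal (H y) < conv_radius w" "y * \<Phi>' (H y) \<le> 1" "y \<ge> 0"
      using that(1) by (auto simp: B_def)
    have s: "summable (\<lambda>n. h n * x ^ n)" by (rule generator_mono(2)[OF nonneg(3) that(2,3) y(1)])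
    have le: "H x \<le> H y" using that y by (intro H_mono)
    then have R: "ereal (H x) < conv_radius w" using y(2) by (meson ereal_less_eq(3) le_less_trans)
    have "x * \<Phi>' (H x) \<le> y * \<Phi>' (H y)"
      using that(2,3) s R y le by (intro mult_mono \<Phi>'_mono H_nonneg \<Phi>'_nonneg) auto
    then show ?thesis using s R y that(2) by (simp add: B_def)
  qed
  have B_bdd: "bdd_above B"
  proof -
    define c where "c = diffs w (i - 1) * h 1 ^ (i - 1)"
    have c: "c > 0" using w2 h(2) by (simp add: c_def diffs_def)
    have "x \<le> max 1 (1 / c)" if x: "x \<in> B" for x
    proof (cases "x \<le> 1")
      case False
      have B: "summable (\<lambda>n. h n * x ^ n)" "ereal (H x) < conv_radius w" "x * \<Phi>' (H x) \<le> 1" "x \<ge> 0"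
        using x by (auto simp: B_def)
      have "h 1 \<le> h 1 * x ^ 1" using False h(2) by simp
      also have "\<dots> \<le> H x" unfolding H_def by (rule generator_ge_term[OF nonneg(3) B(4,1)])
      finally have h1: "h 1 \<le> H x" .
      have "c \<le> diffs w (i - 1) * H x ^ (i - 1)"
        unfolding c_def using h1 h(2) dw by (intro mult_left_mono power_mono) auto
      also have "\<dots> \<le> \<Phi>' (H x)"
        unfolding \<Phi>'_def using H_nonneg[OF B(4,1)] B(2) in_R'
        by (intro generator_ge_term[OF dw] generator_summable) auto
      finally have "x * c \<le> 1" using B(3) mult_left_mono[of c "\<Phi>' (H x)" x] B(4) by linarith
      then have "x \<le> 1 / c" using c by (simp add: field_simps)
      then show ?thesis by simp
    qed simp
    then show ?thesis by (rule bdd_aboveI)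
  qed
  define \<rho> where "\<rho> = Sup B"
  have \<rho>0: "\<rho> \<ge> 0" unfolding \<rho>_def using B0 B_bdd by (rule cSup_upper)
  have below: "x \<in> B" if x: "0 \<le> x" "x < \<rho>" for x
  proof -
    have "\<exists>y\<in>B. x < y" using x(2) B0 unfolding \<rho>_def by (intro less_cSupD) auto
    then obtain y where "y \<in> B" "x < y" by auto
    then show ?thesis using B_down[of y x] x by simp
  qed
  have \<rho>_in: "\<rho> \<in> B"
  proof (cases "\<rho> = 0")
    case False
    then have \<rho>: "\<rho> > 0" using \<rho>0 by simp
    obtain y1 where y1: "y1 \<ge> 0" "ereal y1 < conv_radius w" "\<Phi>' y1 > 2 / \<rho>"
      using unb[of "2 / \<rho>"] unfolding \<Phi>'_def by blast
    \<comment> \<open>\<open>\<Phi>' (H x) \<le> 1/x \<le> 2/\<rho> < \<Phi>' y1\<close> on the upper half of the interval\<close>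
    have bound: "H x \<le> y1" if "\<rho> / 2 \<le> x" "x < \<rho>" for x
    proof (rule ccontr)
      assume "\<not> H x \<le> y1"
      moreover have B: "x \<in> B" using below that \<rho> by simp
      ultimately have "\<Phi>' y1 \<le> \<Phi>' (H x)" using y1 by (intro \<Phi>'_mono) (auto simp: B_def)
      then have "x * \<Phi>' y1 \<le> x * \<Phi>' (H x)" using B by (intro mult_left_mono) (auto simp: B_def)
      also have "\<dots> \<le> 1" using B by (simp add: B_def)
      finally have "x * \<Phi>' y1 \<le> 1" .
      moreover have "\<rho> / 2 * (2 / \<rho>) < x * \<Phi>' y1"
        using that y1(3) \<rho> by (intro mult_le_less_imp_less) auto
      ultimately show False using \<rho> by simp
    qed
    have partial: "(\<Sum>n<N. h n * \<rho> ^ n) \<le> y1" for N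
    proof (rule tendsto_upperbound)
      show "((\<lambda>x. \<Sum>n<N. h n * x ^ n) \<longlongrightarrow> (\<Sum>n<N. h n * \<rho> ^ n)) (at_left \<rho>)"
        by (intro tendsto_intros)
      have "\<forall>\<^sub>F x in at_left \<rho>. x \<in> {\<rho> / 2<..<\<rho>}"
        using \<rho> by (intro eventually_at_leftI[of "\<rho> / 2"]) auto
      then show "\<forall>\<^sub>F x in at_left \<rho>. (\<Sum>n<N. h n * x ^ n) \<le> y1"
      proof eventually_elim
        case (elim x)
        then have "x \<in> B" using below \<rho> by simp
        then have "(\<Sum>n<N. h n * x ^ n) \<le> H x"
          unfolding H_def generator_def B_def using nonneg(3) by (intro sum_le_suminf) auto
        also have "\<dots> \<le> y1" using elim by (intro bound) auto
        finally show ?case .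
      qed
    qed simp
    have s: "summable (\<lambda>n. h n * \<rho> ^ n)"
      by (rule summableI_nonneg_bounded[of _ y1]) (use partial nonneg(3) \<rho> in auto)
    have "H \<rho> \<le> y1" unfolding H_def generator_def by (rule suminf_le_const[OF s partial])
    then have R: "ereal (H \<rho>) < conv_radius w" using y1(2) by (meson ereal_less_eq(3) le_less_trans)
    have "\<rho> * \<Phi>' (H \<rho>) \<le> 1"
    proof (rule tendsto_upperbound)
      have "(H \<longlongrightarrow> H \<rho>) (at_left \<rho>)"
        using continuous_on_generator_closed[OF nonneg(3) s] \<rho> unfolding H_def[symmetric]
        by (simp add: continuous_on_Icc_at_leftD)
      moreover have "isCont \<Phi>' (H \<rho>)"
        unfolding \<Phi>'_def using in_R'[OF H_nonneg[OF \<rho>0 s] R] by (rule isCont_generator)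
      ultimately show "((\<lambda>x. x * \<Phi>' (H x)) \<longlongrightarrow> \<rho> * \<Phi>' (H \<rho>)) (at_left \<rho>)"
        by (intro tendsto_intros isCont_tendsto_compose[of _ \<Phi>'])
      have "\<forall>\<^sub>F x in at_left \<rho>. x \<in> {0<..<\<rho>}"
        using \<rho> by (intro eventually_at_leftI[of 0]) auto
      then show "\<forall>\<^sub>F x in at_left \<rho>. x * \<Phi>' (H x) \<le> 1"
        by eventually_elim (use below in \<open>auto simp: B_def\<close>)
    qed simp
    then show ?thesis using s R \<rho> by (simp add: B_def)
  qed (use B0 in simp)
  then have \<rho>: "summable (\<lambda>n. h n * \<rho> ^ n)" "ereal (H \<rho>) < conv_radius w" "\<rho> * \<Phi>' (H \<rho>) \<le> 1"
    by (auto simp: B_def)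
  have \<rho>g: "ereal \<rho> < conv_radius g"
    using sub[OF \<rho>0] \<rho> by (simp add: H_def \<Phi>'_def)
  have H\<rho>0: "H \<rho> \<ge> 0" using H_nonneg \<rho>0 \<rho>(1) .
  have "\<rho> * \<Phi>' (H \<rho>) = 1"
  proof (rule ccontr)
    assume "\<rho> * \<Phi>' (H \<rho>) \<noteq> 1"
    then have less: "\<rho> * \<Phi>' (H \<rho>) < 1" using \<rho>(3) by simp
    have gf_real: "gf a (of_real x) = of_real (generator a x)" if "ereal \<bar>x\<bar> < conv_radius a" for a x
      using gf_of_real(1)[OF that] by (simp add: generator_def)
    have gfh: "gf h (of_real \<rho>) = of_real (H \<rho>)"
      unfolding gf_def H_def generator_def using suminf_of_real[OF \<rho>(1), where 'a = complex] by simp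
    have "gf h (of_real \<rho>) = gf g (of_real \<rho>) + of_real \<rho> * gf w (gf h (of_real \<rho>))"
      using \<rho> \<rho>0 \<rho>g nonneg h(1) eq by (intro implicit_series_functional_eq[of w h g _ \<rho>]) (auto simp: H_def)
    then have "complex_of_real (H \<rho>) = of_real (generator g \<rho> + \<rho> * generator w (H \<rho>))"
      using gf_real[of \<rho> g] gf_real[of "H \<rho>" w] \<rho>0 \<rho>g \<rho>(2) H\<rho>0 by (simp add: gfh)
    then have fp: "H \<rho> = generator g \<rho> + \<rho> * generator w (H \<rho>)" by (simp only: of_real_eq_iff)
    define f where "f y = y - generator g \<rho> - \<rho> * generator w y" for y
    have H\<rho>R: "ereal \<bar>H \<rho>\<bar> < conv_radius w" using \<rho>(2) H\<rho>0 by simp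
    have "(f has_field_derivative 1 - \<rho> * \<Phi>' (H \<rho>)) (at (H \<rho>))"
      unfolding f_def \<Phi>'_def
      by (rule derivative_eq_intros has_field_derivative_generator[OF H\<rho>R] refl | simp)+
    then obtain e where e: "e > 0" "\<And>u. u > 0 \<Longrightarrow> u < e \<Longrightarrow> f (H \<rho>) < f (H \<rho> + u)"
      using DERIV_pos_inc_right[of f "1 - \<rho> * \<Phi>' (H \<rho>)" "H \<rho>"] less by auto
    have ev1: "\<forall>\<^sub>F y in at_right (H \<rho>). f y > 0"
    proof (rule eventually_at_rightI[of "H \<rho>" "H \<rho> + e"])
      fix y assume "y \<in> {H \<rho><..<H \<rho> + e}"
      then have "f (H \<rho>) < f y" using e(2)[of "y - H \<rho>"] by simp
      moreover have "f (H \<rho>) = 0" using fp by (simp add: f_def)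
      ultimately show "f y > 0" by simp
    qed (use e in simp)
    have "((\<lambda>y. ereal y) \<longlongrightarrow> ereal (H \<rho>)) (at_right (H \<rho>))" by (intro tendsto_intros)
    then have ev2: "\<forall>\<^sub>F y in at_right (H \<rho>). ereal y < conv_radius w"
      using \<rho>(2) by (rule order_tendstoD)
    have "isCont \<Phi>' (H \<rho>)" unfolding \<Phi>'_def using in_R'[OF H\<rho>0 \<rho>(2)] by (rule isCont_generator)
    then have "((\<lambda>y. \<rho> * \<Phi>' y) \<longlongrightarrow> \<rho> * \<Phi>' (H \<rho>)) (at_right (H \<rho>))"
      by (intro tendsto_intros) (simp add: isCont_def filterlim_at_split)
    then have ev3: "\<forall>\<^sub>F y in at_right (H \<rho>). \<rho> * \<Phi>' y < 1" using less by (rule order_tendstoD)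
    obtain y where y: "y > H \<rho>" "f y > 0" "ereal y < conv_radius w" "\<rho> * \<Phi>' y < 1"
      using eventually_happens'[OF _ eventually_conj[OF eventually_at_right_less
        eventually_conj[OF ev1 eventually_conj[OF ev2 ev3]]]] by auto
    have y0: "y \<ge> 0" using y H\<rho>0 by simp
    have "isCont (generator g) \<rho>" using \<rho>g \<rho>0 by (intro isCont_generator) simp
    then have cg: "(generator g \<longlongrightarrow> generator g \<rho>) (at_right \<rho>)" by (simp add: isCont_def filterlim_at_split)
    have "((\<lambda>x. y - generator g x - x * generator w y) \<longlongrightarrow> f y) (at_right \<rho>)"
      unfolding f_def by (intro tendsto_intros cg)
    then have ev1: "\<forall>\<^sub>F x in at_right \<rho>. y - generator g x - x * generator w y > 0"
      using y(2) by (rule order_tendstoD)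
    have "((\<lambda>x. ereal x) \<longlongrightarrow> ereal \<rho>) (at_right \<rho>)" by (intro tendsto_intros)
    then have ev2: "\<forall>\<^sub>F x in at_right \<rho>. ereal x < conv_radius g"
      using \<rho>g by (rule order_tendstoD)
    have "((\<lambda>x. x * \<Phi>' y) \<longlongrightarrow> \<rho> * \<Phi>' y) (at_right \<rho>)" by (intro tendsto_intros)
    then have ev3: "\<forall>\<^sub>F x in at_right \<rho>. x * \<Phi>' y < 1" using y(4) by (rule order_tendstoD)
    obtain x where x: "x > \<rho>" "y - generator g x - x * generator w y > 0" "ereal x < conv_radius g" "x * \<Phi>' y < 1"
      using eventually_happens'[OF _ eventually_conj[OF eventually_at_right_less
        eventually_conj[OF ev1 eventually_conj[OF ev2 ev3]]]] by auto
    have x0: "x \<ge> 0" using x \<rho>0 by simp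
    have s: "summable (\<lambda>n. h n * x ^ n)" "H x \<le> y"
      using implicit_series_dominated[OF nonneg h(1) eq x0 y0 y(3)] x x0 generator_summable[of x g]
      by (auto simp: H_def)
    have "x * \<Phi>' (H x) \<le> x * \<Phi>' y"
      using s x0 y by (intro mult_left_mono \<Phi>'_mono H_nonneg) auto
    moreover have "ereal (H x) < conv_radius w" using s(2) y(3) by (meson ereal_less_eq(3) le_less_trans)
    ultimately have "x \<in> B" using x s x0 by (simp add: B_def)
    then have "x \<le> \<rho>" unfolding \<rho>_def using B_bdd by (rule cSup_upper)
    then show False using x by simp
  qed
  moreover from this have "\<rho> > 0" using \<rho>0 by (cases "\<rho> = 0") auto
  ultimately show ?thesis using that[of \<rho>] \<rho> \<rho>g by (simp add: H_def \<Phi>'_def)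
qed

section \<open>Moment generating functions of the number of root subtrees\<close>

definition moment_sum :: "(nat \<Rightarrow> real) \<Rightarrow> nat \<Rightarrow> nat \<Rightarrow> real" where
  "moment_sum w m n = (\<Sum>T | tree_size T = n. tree_weight w T * real (num_root_subtrees T) ^ m)"

definition shifted_moment_sum :: "(nat \<Rightarrow> real) \<Rightarrow> nat \<Rightarrow> nat \<Rightarrow> real" where
  "shifted_moment_sum w m n = (\<Sum>T | tree_size T = n. tree_weight w T * (1 + real (num_root_subtrees T)) ^ m)"

text \<open>
  The residue class outside of which there are no trees of positive weight.
\<close>

definition admissible_residues :: "(nat \<Rightarrow> real) \<Rightarrow> nat filter" where
  "admissible_residues w = inf sequentially (principal {n. n \<ge> 1 \<and> Gcd {i. w i > 0} dvd n - 1})"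

lemma tree_weight_nonneg: "(\<And>i. w i \<ge> 0) \<Longrightarrow> tree_weight w T \<ge> 0"
  unfolding tree_weight_def by (intro prod_nonneg) auto

text \<open>
  The equation \<open>F\<^sub>m = z \<Phi>(H\<^sub>m)\<close>, solved for \<open>H\<^sub>m\<close>: here \<open>H\<^sub>m\<close> is the series of
  \<open>shifted_moment_sum w m\<close> and \<open>F\<^sub>m\<close> that of \<open>moment_sum w m\<close>.
\<close>

lemma moment_fps_eq:
  "Abs_fps (shifted_moment_sum w m) = Abs_fps (\<lambda>n. shifted_moment_sum w m n - moment_sum w m n)
     + fps_X * (Abs_fps w oo Abs_fps (shifted_moment_sum w m))"
proof -
  define b where "b T = tree_weight w T * (1 + real (num_root_subtrees T)) ^ m" for T
  define a where "a T = tree_weight w T * real (num_root_subtrees T) ^ m" for T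
  have "a (Node ts) = w (length ts) * prod_list (map b ts)" for ts
  proof -
    have "prod_list (map b ts) = prod_list (map (tree_weight w) ts) * real (prod_list (map (\<lambda>t. 1 + num_root_subtrees t) ts)) ^ m"
    proof -
      have "real (prod_list (map (\<lambda>t. 1 + num_root_subtrees t) ts)) = prod_list (map (\<lambda>t. 1 + real (num_root_subtrees t)) ts)"
        by (induction ts) (simp_all add: distrib_right)
      moreover have "prod_list (map b ts) = prod_list (map (tree_weight w) ts) * prod_list (map (\<lambda>t. 1 + real (num_root_subtrees t)) ts) ^ m"
        by (induction ts) (simp_all add: b_def power_mult_distrib)
      ultimately show ?thesis by simp
    qed
    then show ?thesis by (simp add: a_def tree_weight_Node num_root_subtrees_Node)
  qed
  from tree_fps_eq[of a w b, OF this]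
  have "tree_fps a = fps_X * (Abs_fps w oo tree_fps b)" .
  moreover have "tree_fps b = Abs_fps (shifted_moment_sum w m)" "tree_fps a = Abs_fps (moment_sum w m)"
    by (simp_all add: tree_fps_def fps_eq_iff b_def a_def shifted_moment_sum_def moment_sum_def)
  ultimately have eq: "Abs_fps (moment_sum w m) = fps_X * (Abs_fps w oo Abs_fps (shifted_moment_sum w m))" by simp
  show ?thesis by (subst eq[symmetric]) (simp add: fps_eq_iff)
qed

lemma no_tree_of_size_0: "{T. tree_size T = 0} = {}"
  using tree_size_pos by auto

lemma trees_of_size_1: "{T. tree_size T = 1} = {Node []}"
proof safe
  fix T assume T: "tree_size T = 1"
  obtain ts where ts: "T = Node ts" by (cases T)
  then have "tree_size (Node ts) = 1" using T by simp
  then have "sum_list (map tree_size ts) = 0"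
    unfolding tree_size_Node by (simp only: One_nat_def nat.inject)
  then have "length ts = 0" using length_le_sum_tree_size[of ts] by (metis le_zero_eq)
  then show "T = Node []" using ts by simp
qed (simp add: tree_size_Node)

lemma shifted_moment_sum_0: "shifted_moment_sum w m 0 = 0"
  unfolding shifted_moment_sum_def no_tree_of_size_0 by simp

lemma shifted_moment_sum_1: "shifted_moment_sum w m 1 = w 0 * 2 ^ m"
  unfolding shifted_moment_sum_def trees_of_size_1 by (simp add: tree_weight_Node num_root_subtrees_Node)

lemma shifted_moment_sum_nonneg: "(\<And>i. w i \<ge> 0) \<Longrightarrow> shifted_moment_sum w m n \<ge> 0"
  unfolding shifted_moment_sum_def by (intro sum_nonneg mult_nonneg_nonneg tree_weight_nonneg) auto

lemma moment_sum_le_shifted: "(\<And>i. w i \<ge> 0) \<Longrightarrow> moment_sum w m n \<le> shifted_moment_sum w m n"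
  unfolding shifted_moment_sum_def moment_sum_def
  by (intro sum_mono mult_left_mono power_mono tree_weight_nonneg) auto

lemma shifted_moment_sum_mono: "(\<And>i. w i \<ge> 0) \<Longrightarrow> shifted_moment_sum w m n \<le> shifted_moment_sum w (Suc m) n"
  unfolding shifted_moment_sum_def
  by (intro sum_mono mult_left_mono power_increasing tree_weight_nonneg) auto

text \<open>
  The inhomogeneous term for the exponent \<open>m + 1\<close> is controlled by the series for the exponent \<open>m\<close>,
  and so converges wherever that one does.
\<close>

lemma moment_gap_le:
  assumes "\<And>i. w i \<ge> 0"
  shows "shifted_moment_sum w (Suc m) n - moment_sum w (Suc m) n \<le> real (Suc m) * shifted_moment_sum w m n"
proof -
  have pow: "(1 + x) ^ Suc m - x ^ Suc m \<le> real (Suc m) * (1 + x) ^ m" if "x \<ge> 0" for x :: real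
  proof (induction m)
    case (Suc m)
    have "(1 + x) ^ Suc (Suc m) - x ^ Suc (Suc m) = (1 + x) * ((1 + x) ^ Suc m - x ^ Suc m) + x ^ Suc m"
      by (simp add: algebra_simps)
    also have "\<dots> \<le> (1 + x) * (real (Suc m) * (1 + x) ^ m) + (1 + x) ^ Suc m"
      using Suc that by (intro add_mono mult_left_mono power_mono) auto
    also have "\<dots> = real (Suc (Suc m)) * (1 + x) ^ Suc m" by (simp add: algebra_simps)
    finally show ?case .
  qed simp
  have "shifted_moment_sum w (Suc m) n - moment_sum w (Suc m) n =
     (\<Sum>T | tree_size T = n. tree_weight w T * ((1 + real (num_root_subtrees T)) ^ Suc m - real (num_root_subtrees T) ^ Suc m))"
    by (simp only: shifted_moment_sum_def moment_sum_def right_diff_distrib sum_subtractf)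
  also have "\<dots> \<le> (\<Sum>T | tree_size T = n. tree_weight w T * (real (Suc m) * (1 + real (num_root_subtrees T)) ^ m))"
    using assms by (intro sum_mono mult_left_mono pow tree_weight_nonneg) auto
  also have "\<dots> = real (Suc m) * shifted_moment_sum w m n"
    by (simp only: shifted_moment_sum_def sum_distrib_left mult.left_commute)
  finally show ?thesis .
qed

lemma shifted_moment_sum_support:
  assumes "\<And>i. w i \<ge> 0" "shifted_moment_sum w m n \<noteq> 0"
  shows "n \<ge> 1 \<and> Gcd {i. w i > 0} dvd n - 1"
proof -
  obtain T where T: "tree_size T = n" "tree_weight w T \<noteq> 0"
    using assms(2) unfolding shifted_moment_sum_def by (metis (mono_tags, lifting) mem_Collect_eq mult_zero_left sum.neutral)
  then show ?thesis using tree_size_mod[of w T] tree_size_pos[of T] assms(1) by auto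
qed

text \<open>
  Scaling the variable by \<open>\<rho>\<close> leads to \<open>coefficient_asymptotics\<close> for the shifted moments. The
  difference to the moments themselves has a larger radius of convergence, hence coefficients that are
  smaller by an exponential factor.
\<close>

lemma moment_sum_asymptotics:
  fixes w :: "nat \<Rightarrow> real" and m :: nat and \<rho> :: real
  defines "h \<equiv> shifted_moment_sum w m" and "g \<equiv> \<lambda>n. shifted_moment_sum w m n - moment_sum w m n"
  assumes w: "\<And>i. w i \<ge> 0" "w 0 > 0" "i \<ge> 2" "w i > 0"
    and \<rho>: "\<rho> > 0" "summable (\<lambda>n. h n * \<rho> ^ n)" "ereal (generator h \<rho>) < conv_radius w"
    "\<rho> * generator (diffs w) (generator h \<rho>) = 1" "ereal \<rho> < conv_radius g"
  shows "\<exists>\<kappa>>0. (\<lambda>n. moment_sum w m n * \<rho> ^ n - \<kappa> * sqrt_coeff n) \<in> O[admissible_residues w](\<lambda>n. real n powr (-5/2))"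
proof -
  have h_nonneg: "h n \<ge> 0" for n unfolding h_def using w(1) by (rule shifted_moment_sum_nonneg)
  have g_nonneg: "g n \<ge> 0" for n unfolding g_def using moment_sum_le_shifted[of w m n] w(1) by simp
  define \<eta> where "\<eta> = generator h \<rho>"
  define w' where "w' n = \<rho> * w n" for n
  define h' where "h' n = h n * \<rho> ^ n" for n
  define g' where "g' n = g n * \<rho> ^ n" for n
  have \<eta>0: "\<eta> \<ge> 0" unfolding \<eta>_def generator_def using h_nonneg \<rho> by (intro suminf_nonneg) auto
  have rad: "conv_radius w' = conv_radius w"
    unfolding w'_def using \<rho>(1) conv_radius_cmult_left[of \<rho> w] by simp
  have rad_g: "conv_radius g' > 1"
    unfolding g'_def using \<rho>(1,5) conv_radius_mult_power_right[of \<rho> g]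
    by (cases "conv_radius g") (auto simp: one_ereal_def field_simps)
  have scale: "gf (\<lambda>n. a n * \<rho> ^ n) z = gf a (of_real \<rho> * z)" for a z
    by (simp add: gf_def power_mult_distrib mult_ac)
  have "\<exists>\<kappa>>0. (\<lambda>n. h' n - \<kappa> * sqrt_coeff n) \<in>
     O[inf sequentially (principal {n. n \<ge> 1 \<and> Gcd {i. w' i > 0} dvd n - 1})](\<lambda>n. real n powr (-5/2))"
  proof (rule coefficient_asymptotics[where i = i and g = g' and \<eta> = \<eta>])
    show "w' n \<ge> 0" for n using w \<rho>(1) by (simp add: w'_def)
    show "w' 0 > 0" "w' i > 0" using w \<rho>(1) by (simp_all add: w'_def)
    show "ereal \<eta> < conv_radius w'" using \<rho>(3) by (simp add: rad \<eta>_def)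
    show "(\<lambda>i. real i * w' i * \<eta> ^ (i - 1)) sums 1"
    proof -
      have "ereal \<bar>\<eta>\<bar> < conv_radius (diffs w)"
        using \<rho>(3) \<eta>0 conv_radius_diffs[of w] by (simp add: \<eta>_def less_le_trans)
      then have "(\<lambda>n. diffs w n * \<eta> ^ n) sums generator (diffs w) \<eta>"
        unfolding generator_def by (intro summable_sums generator_summable)
      from sums_mult[OF this, of \<rho>]
      have "(\<lambda>n. real (Suc n) * w' (Suc n) * \<eta> ^ (Suc n - 1)) sums 1"
        using \<rho>(4) by (simp add: w'_def \<eta>_def diffs_def mult_ac)
      then show ?thesis by (subst (asm) sums_Suc_iff) simp
    qed
    show "g' n \<ge> 0" "h' n \<ge> 0" for n using g_nonneg h_nonneg \<rho>(1) by (simp_all add: g'_def h'_def)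
    show "h' 1 > 0" using w(2) \<rho>(1) by (simp add: h'_def h_def shifted_moment_sum_1[unfolded One_nat_def])
    show "h' sums \<eta>" using \<rho>(2) unfolding h'_def \<eta>_def generator_def by (rule summable_sums)
    show "n \<ge> 1 \<and> Gcd {i. w' i > 0} dvd n - 1" if "h' n \<noteq> 0" for n
    proof -
      have "{i. w' i > 0} = {i. w i > 0}" using \<rho>(1) by (simp add: w'_def zero_less_mult_iff)
      then show ?thesis
        using shifted_moment_sum_support[of w m n] w(1) that by (simp add: h'_def h_def)
    qed
    show "gf h' z = gf g' z + z * gf w' (gf h' z)" if z: "norm z < 1" for z
    proof -
      define u where "u = of_real \<rho> * z"
      have u: "norm u \<le> \<rho>" using z \<rho>(1) by (simp add: u_def norm_mult)
      have eq: "gf h u = gf g u + u * gf w (gf h u)"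
        by (rule implicit_series_functional_eq[OF w(1) h_nonneg _ _ u \<rho>(2,3,5)])
           (auto simp: h_def g_def shifted_moment_sum_0 moment_fps_eq[symmetric])
      have "norm (gf h' z) \<le> \<eta>"
        using gf_closed_disc(2)[of h' \<eta> z] z h_nonneg \<rho>(1) \<open>h' sums \<eta>\<close> by (simp add: h'_def)
      then have "ereal (norm (gf h u)) < conv_radius w"
        using \<rho>(3) scale[of h z] unfolding h'_def[abs_def] u_def[symmetric] \<eta>_def
        by (metis ereal_less_eq(3) le_less_trans)
      from sums_mult[OF gf_sums[OF this], of "of_real \<rho>"]
      have "gf w' (gf h u) = of_real \<rho> * gf w (gf h u)"
        by (simp add: gf_def[of w'] w'_def sums_iff mult.assoc)
      then show ?thesis
        using eq scale[of h z] scale[of g z] by (simp add: h'_def[abs_def] g'_def[abs_def] u_def mult_ac)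
    qed
  qed (use w rad_g in simp_all)
  moreover have "{i. w' i > 0} = {i. w i > 0}" using \<rho>(1) by (simp add: w'_def zero_less_mult_iff)
  ultimately obtain \<kappa> where \<kappa>: "\<kappa> > 0" "(\<lambda>n. h' n - \<kappa> * sqrt_coeff n) \<in> O[admissible_residues w](\<lambda>n. real n powr (-5/2))"
    unfolding admissible_residues_def by auto
  have g_small: "g' \<in> O(\<lambda>n. real n powr (-5/2))"
  proof -
    obtain r where r: "r > 1" "ereal r < conv_radius g'"
      using ereal_dense2[OF rad_g] by (auto simp: one_ereal_def)
    have "summable (\<lambda>n. g' n * r ^ n)" using r by (intro generator_summable) simp
    then have "(\<lambda>n. g' n * r ^ n) \<longlonglongrightarrow> 0" by (rule summable_LIMSEQ_zero)
    then have "Bseq (\<lambda>n. g' n * r ^ n)" by (intro convergent_imp_Bseq convergentI)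
    then obtain K where K: "K > 0" "\<And>n. norm (g' n * r ^ n) \<le> K" by (auto simp: Bseq_def)
    have "g' \<in> O(\<lambda>n. (1 / r) ^ n)"
    proof (rule bigoI[of _ K], rule always_eventually, rule allI)
      fix n show "norm (g' n) \<le> K * norm ((1 / r) ^ n)"
        using K(2)[of n] r by (simp add: abs_mult power_divide field_simps)
    qed
    also have "(\<lambda>n. (1 / r) ^ n) \<in> O(\<lambda>n. real n powr (-5/2))"
      using r(1) by real_asymp
    finally show ?thesis .
  qed
  have "admissible_residues w \<le> sequentially" by (simp add: admissible_residues_def)
  then have "g' \<in> O[admissible_residues w](\<lambda>n. real n powr (-5/2))"
    using g_small landau_o.big.filter_mono by blast
  then have "(\<lambda>n. (h' n - \<kappa> * sqrt_coeff n) - g' n) \<in> O[admissible_residues w](\<lambda>n. real n powr (-5/2))"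
    using \<kappa>(2) by (rule sum_in_bigo(2)[rotated])
  moreover have "(h' n - \<kappa> * sqrt_coeff n) - g' n = moment_sum w m n * \<rho> ^ n - \<kappa> * sqrt_coeff n" for n
    by (simp add: h'_def g'_def h_def g_def algebra_simps)
  ultimately show ?thesis using \<kappa>(1) by auto
qed

lemma ratio_asymptotics:
  fixes u v b :: "nat \<Rightarrow> real"
  assumes "F \<le> sequentially" and b: "\<forall>\<^sub>F n in F. b n > 0"
    and u: "(\<lambda>n. u n - b n) \<in> O[F](\<lambda>n. b n / real n)" and v: "(\<lambda>n. v n - b n) \<in> O[F](\<lambda>n. b n / real n)"
  shows "(\<lambda>n. u n / v n - 1) \<in> O[F](\<lambda>n. 1 / real n)"
proof -
  obtain C1 where C1: "C1 > 0" "\<forall>\<^sub>F n in F. norm (u n - b n) \<le> C1 * norm (b n / real n)"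
    using landau_o.bigE[OF u] by blast
  obtain C2 where C2: "C2 > 0" "\<forall>\<^sub>F n in F. norm (v n - b n) \<le> C2 * norm (b n / real n)"
    using landau_o.bigE[OF v] by blast
  obtain N :: nat where N: "real N \<ge> 2 * C2" using real_arch_simple by blast
  have "\<forall>\<^sub>F n in F. n \<ge> max N 1" using assms(1) eventually_ge_at_top by (rule filter_leD)
  with C1(2) C2(2) b have "\<forall>\<^sub>F n in F. norm (u n / v n - 1) \<le> (2 * (C1 + C2)) * norm (1 / real n)"
  proof eventually_elim
    case (elim n)
    define e where "e = b n / real n"
    have n: "real n > 0" "real n \<ge> 2 * C2" using elim N by auto
    have e: "e > 0" "b n = e * real n" using elim n by (auto simp: e_def)
    have "C2 * e \<le> b n / 2" using e n by (simp add: mult.commute)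
    moreover have dv: "\<bar>v n - b n\<bar> \<le> C2 * e" using elim e by (simp add: e_def[symmetric])
    ultimately have v: "v n \<ge> b n / 2" by linarith
    have du: "\<bar>u n - b n\<bar> \<le> C1 * e" using elim e by (simp add: e_def[symmetric])
    have v0: "v n > 0" using v elim by simp
    have "\<bar>u n - v n\<bar> \<le> (C1 + C2) * e" using du dv unfolding distrib_right by linarith
    moreover have "norm (u n / v n - 1) = \<bar>u n - v n\<bar> / v n"
      using v0 by (simp add: diff_divide_distrib[symmetric] field_simps flip: abs_divide) (simp add: abs_divide)
    ultimately have "norm (u n / v n - 1) \<le> (C1 + C2) * e / (b n / 2)"
      using v v0 elim e C1 C2 by (simp only:) (intro frac_le, auto)
    also have "\<dots> = (2 * (C1 + C2)) * norm (1 / real n)" using e n by (simp add: field_simps)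
    finally show ?case .
  qed
  then show ?thesis using C1(1) C2(1) by (intro landau_o.bigI[of "2 * (C1 + C2)"]) auto
qed

section \<open>The singularities of the moment generating functions\<close>

text \<open>
  The condition \<open>\<rho> \<Phi>'(H\<^sub>m(\<rho>)) = 1\<close> under which the functional equation for the exponent \<open>m\<close> branches
  at \<open>\<rho>\<close>, together with what makes the branching dominant: \<open>H\<^sub>m\<close> converges at \<open>\<rho>\<close> to a value inside the disc
  of \<open>\<Phi>\<close>, and the inhomogeneous term is analytic beyond \<open>\<rho>\<close>.
\<close>

definition singular_at :: "(nat \<Rightarrow> real) \<Rightarrow> nat \<Rightarrow> real \<Rightarrow> bool" where
  "singular_at w m \<rho> \<longleftrightarrow> \<rho> > 0 \<and> summable (\<lambda>n. shifted_moment_sum w m n * \<rho> ^ n) \<and>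
     ereal (generator (shifted_moment_sum w m) \<rho>) < conv_radius w \<and>
     \<rho> * generator (diffs w) (generator (shifted_moment_sum w m) \<rho>) = 1 \<and>
     ereal \<rho> < conv_radius (\<lambda>n. shifted_moment_sum w m n - moment_sum w m n)"

text \<open>
  \<open>H\<^bsub>m+1\<^esub>\<close> exceeds \<open>H\<^sub>m\<close> on the positive axis, already because of the tree with one node, and \<open>\<Phi>'\<close> is
  strictly increasing. So at \<open>\<rho>\<close>, and from there on, \<open>x \<Phi>'(H\<^bsub>m+1\<^esub>(x))\<close> is larger than 1.
\<close>

lemma less_singularity:
  fixes w :: "nat \<Rightarrow> real"
  assumes w: "\<And>i. w i \<ge> 0" "w 0 > 0" "i \<ge> 2" "w i > 0" and \<rho>: "singular_at w m \<rho>"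
    and x: "x \<ge> 0" "summable (\<lambda>n. shifted_moment_sum w (Suc m) n * x ^ n)"
    "ereal (generator (shifted_moment_sum w (Suc m)) x) < conv_radius w"
    "x * generator (diffs w) (generator (shifted_moment_sum w (Suc m)) x) \<le> 1"
  shows "x < \<rho>"
proof (rule ccontr)
  assume "\<not> x < \<rho>"
  then have x\<rho>: "\<rho> \<le> x" by simp
  define h where "h = shifted_moment_sum w"
  have h: "h k n \<ge> 0" for k n unfolding h_def using w(1) by (rule shifted_moment_sum_nonneg)
  have \<rho>': "\<rho> > 0" "summable (\<lambda>n. h m n * \<rho> ^ n)" "\<rho> * generator (diffs w) (generator (h m) \<rho>) = 1"
    using \<rho> by (auto simp: singular_at_def h_def)
  have s: "summable (\<lambda>n. h (Suc m) n * \<rho> ^ n)"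
    using generator_mono(2)[of "h (Suc m)" \<rho> x] h x x\<rho> \<rho>' by (simp add: h_def)
  have "0 < (\<Sum>n. h (Suc m) n * \<rho> ^ n - h m n * \<rho> ^ n)"
  proof (rule suminf_pos2[of _ 1])
    show "0 \<le> h (Suc m) n * \<rho> ^ n - h m n * \<rho> ^ n" for n
      using shifted_moment_sum_mono[of w m n] w(1) \<rho>' by (simp add: h_def mult_right_mono)
    show "0 < h (Suc m) 1 * \<rho> ^ 1 - h m 1 * \<rho> ^ 1"
      using w(2) \<rho>' by (simp add: h_def shifted_moment_sum_1[unfolded One_nat_def])
  qed (intro summable_diff s \<rho>')
  then have "generator (h m) \<rho> < generator (h (Suc m)) \<rho>"
    using suminf_diff[OF s \<rho>'(2)] by (simp add: generator_def)
  also have "\<dots> \<le> generator (h (Suc m)) x"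
    using generator_mono(1)[of "h (Suc m)" \<rho> x] h x x\<rho> \<rho>' by (simp add: h_def)
  finally have less: "generator (h m) \<rho> < generator (h (Suc m)) x" .
  have nn: "generator (h m) \<rho> \<ge> 0" unfolding generator_def using h \<rho>' by (intro suminf_nonneg) auto
  have sd: "summable (\<lambda>n. diffs w n * generator (h (Suc m)) x ^ n)"
    using x(3) less nn conv_radius_diffs[of w] by (intro generator_summable) (simp add: h_def less_le_trans)
  have "diffs w (i - 1) > 0" using w(3,4) by (simp add: diffs_def)
  then have "generator (diffs w) (generator (h m) \<rho>) < generator (diffs w) (generator (h (Suc m)) x)"
    using w(1,3) less nn sd by (intro generator_strict_mono[of _ "i - 1"]) (auto simp: diffs_def)
  then have "1 < \<rho> * generator (diffs w) (generator (h (Suc m)) x)"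
    using \<rho>' by (metis mult_strict_left_mono)
  also have "\<dots> \<le> x * generator (diffs w) (generator (h (Suc m)) x)"
    using x\<rho> sd w(1) nn less unfolding generator_def[of "diffs w"]
    by (intro mult_right_mono suminf_nonneg) (auto simp: diffs_def)
  finally show False using x(4) by (simp add: h_def)
qed

text \<open>
  Induction on \<open>m\<close>: the inhomogeneous term vanishes for \<open>m = 0\<close>, and for \<open>m + 1\<close> it converges up to
  the singularity for \<open>m\<close>, which the one for \<open>m + 1\<close> precedes.
\<close>

lemma singularities_exist:
  fixes w :: "nat \<Rightarrow> real"
  assumes w: "\<And>i. w i \<ge> 0" "w 0 > 0" "i \<ge> 2" "w i > 0"
    and unb: "\<And>B. \<exists>y\<ge>0. ereal y < conv_radius w \<and> generator (diffs w) y > B"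
  shows "\<exists>\<rho>. singular_at w m \<rho>"
proof (induction m)
  case 0
  have g0: "(\<lambda>n. shifted_moment_sum w 0 n - moment_sum w 0 n) = (\<lambda>_. 0)"
    by (simp add: shifted_moment_sum_def moment_sum_def fun_eq_iff)
  obtain \<rho> where "\<rho> > 0" "summable (\<lambda>n. shifted_moment_sum w 0 n * \<rho> ^ n)"
    "ereal (generator (shifted_moment_sum w 0) \<rho>) < conv_radius w"
    "\<rho> * generator (diffs w) (generator (shifted_moment_sum w 0) \<rho>) = 1"
    "ereal \<rho> < conv_radius (\<lambda>n. shifted_moment_sum w 0 n - moment_sum w 0 n)"
  proof (rule singularity_exists[OF w(1) _ _ w(3,4) unb _ _ moment_fps_eq])
    show "shifted_moment_sum w 0 1 > 0" using w(2) unfolding shifted_moment_sum_1 by simp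
    show "0 \<le> shifted_moment_sum w 0 n - moment_sum w 0 n" for n
      using moment_sum_le_shifted[of w 0 n] w(1) by simp
    show "ereal x < conv_radius (\<lambda>n. shifted_moment_sum w 0 n - moment_sum w 0 n)" for x
      unfolding g0 by simp
  qed (use w(1) shifted_moment_sum_nonneg in \<open>auto simp: shifted_moment_sum_0\<close>)
  then show ?case unfolding singular_at_def by blast
next
  case (Suc m)
  then obtain \<rho>0 where \<rho>0: "singular_at w m \<rho>0" by blast
  define g where "g n = shifted_moment_sum w (Suc m) n - moment_sum w (Suc m) n" for n
  have g: "g n \<ge> 0" for n unfolding g_def using moment_sum_le_shifted[of w "Suc m" n] w(1) by simp
  have "summable (\<lambda>n. g n * \<rho>0 ^ n)"
  proof (rule summable_comparison_test'[of _ 0])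
    show "summable (\<lambda>n. real (Suc m) * (shifted_moment_sum w m n * \<rho>0 ^ n))"
      using \<rho>0 by (intro summable_mult) (simp add: singular_at_def)
    show "norm (g n * \<rho>0 ^ n) \<le> real (Suc m) * (shifted_moment_sum w m n * \<rho>0 ^ n)" for n
      using moment_gap_le[of w m n] w(1) g[of n] \<rho>0 unfolding g_def[symmetric] mult.assoc[symmetric]
      by (simp add: abs_mult singular_at_def mult_right_mono del: of_nat_Suc)
  qed
  then have rad: "ereal \<rho>0 \<le> conv_radius g"
    using conv_radius_geI[of g \<rho>0] \<rho>0 by (simp add: singular_at_def)
  obtain \<rho> where "\<rho> > 0" "summable (\<lambda>n. shifted_moment_sum w (Suc m) n * \<rho> ^ n)"
    "ereal (generator (shifted_moment_sum w (Suc m)) \<rho>) < conv_radius w"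
    "\<rho> * generator (diffs w) (generator (shifted_moment_sum w (Suc m)) \<rho>) = 1" "ereal \<rho> < conv_radius g"
  proof (rule singularity_exists[OF w(1) g _ w(3,4) unb])
    show "shifted_moment_sum w (Suc m) 1 > 0" using w(2) unfolding shifted_moment_sum_1 by simp
    show "Abs_fps (shifted_moment_sum w (Suc m)) = Abs_fps g + fps_X * (Abs_fps w oo Abs_fps (shifted_moment_sum w (Suc m)))"
      unfolding g_def by (rule moment_fps_eq)
    fix x assume "x \<ge> 0" "summable (\<lambda>n. shifted_moment_sum w (Suc m) n * x ^ n)"
      "ereal (generator (shifted_moment_sum w (Suc m)) x) < conv_radius w"
      "x * generator (diffs w) (generator (shifted_moment_sum w (Suc m)) x) \<le> 1"
    then have "x < \<rho>0" by (rule less_singularity[OF w \<rho>0])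
    then have "ereal x < ereal \<rho>0" by simp
    then show "ereal x < conv_radius g" using rad by (rule less_le_trans)
  qed (use w(1) shifted_moment_sum_nonneg in \<open>auto simp: shifted_moment_sum_0\<close>)
  then show ?case unfolding singular_at_def g_def by blast
qed

section \<open>Moments of the number of root subtrees of a simply generated tree\<close>

lemma expectation_root_subtrees:
  assumes w: "\<And>i. w i \<ge> 0" and pos: "partition_fun w n > 0"
  shows "measure_pmf.expectation (simply_generated_tree w n) (\<lambda>T. real (num_root_subtrees T) ^ m)
     = moment_sum w m n / moment_sum w 0 n"
proof -
  have "measure_pmf.expectation (simply_generated_tree w n) (\<lambda>T. real (num_root_subtrees T) ^ m)
     = (\<Sum>T | tree_size T = n. pmf (simply_generated_tree w n) T *\<^sub>R real (num_root_subtrees T) ^ m)"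
    by (rule integral_measure_pmf[OF finite_trees])
       (auto simp: set_pmf_iff pmf_simply_generated_tree[OF w pos] split: if_splits)
  also have "\<dots> = (\<Sum>T | tree_size T = n. tree_weight w T * real (num_root_subtrees T) ^ m / partition_fun w n)"
    by (intro sum.cong refl) (simp add: pmf_simply_generated_tree[OF w pos])
  also have "\<dots> = moment_sum w m n / moment_sum w 0 n"
    by (simp add: moment_sum_def partition_fun_def flip: sum_divide_distrib)
  finally show ?thesis .
qed

lemma admissible_le_residues:
  assumes "\<And>i. w i \<ge> 0"
  shows "admissible_at_top w \<le> admissible_residues w"
proof -
  have "{n. partition_fun w n > 0} \<subseteq> {n. n \<ge> 1 \<and> Gcd {i. w i > 0} dvd n - 1}"
  proof
    fix n assume "n \<in> {n. partition_fun w n > 0}"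
    then have "shifted_moment_sum w 0 n \<noteq> 0" by (simp add: shifted_moment_sum_def partition_fun_def)
    then show "n \<in> {n. n \<ge> 1 \<and> Gcd {i. w i > 0} dvd n - 1}"
      using shifted_moment_sum_support[of w 0 n] assms by simp
  qed
  then show ?thesis
    unfolding admissible_at_top_def admissible_residues_def by (intro inf_mono order_refl) simp
qed

lemma eventually_from_below:
  assumes "R > 0"
  shows "\<forall>\<^sub>F y in from_below R. y \<ge> 0 \<and> ereal y < R" "from_below R \<noteq> bot"
proof -
  show "\<forall>\<^sub>F y in from_below R. y \<ge> 0 \<and> ereal y < R"
  proof (cases R)
    case (real r)
    then have "r > 0" using assms by simp
    then have "\<forall>\<^sub>F y in at_left r. y \<in> {0<..<r}" by (intro eventually_at_leftI[of 0]) auto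
    then show ?thesis unfolding from_below_def using real by (auto elim: eventually_mono)
  next
    case PInf
    then show ?thesis unfolding from_below_def using eventually_ge_at_top[of "0::real"] by simp
  qed (use assms in simp)
  show "from_below R \<noteq> bot" unfolding from_below_def by simp
qed

theorem theorem2p3:
  fixes w :: "nat \<Rightarrow> real" and L :: ereal
  assumes "\<And>i. w i \<ge> 0"
    and "w 0 > 0"
    and "conv_radius w > 0"
    and "((\<lambda>z. ereal (z * deriv (generator w) z / generator w z)) \<longlongrightarrow> L)
           (from_below (conv_radius w))"
    and "L > 1"
    and "filterlim (deriv (generator w)) at_top (from_below (conv_radius w))"
  shows "\<exists>\<gamma> \<tau> :: nat \<Rightarrow> real.
           (\<forall>m\<ge>1. \<gamma> m > 0) \<and> 1 < \<tau> 1 \<and> (\<forall>m\<ge>1. \<tau> m < \<tau> (Suc m)) \<and>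
           (\<forall>m\<ge>1. \<exists>\<epsilon> :: nat \<Rightarrow> real.
              \<epsilon> \<in> O[admissible_at_top w](\<lambda>n. 1 / real n) \<and>
              (\<forall>n. partition_fun w n > 0 \<longrightarrow>
                 measure_pmf.expectation (simply_generated_tree w n)
                   (\<lambda>T. real (num_root_subtrees T) ^ m) = (1 + \<epsilon> n) * \<gamma> m * \<tau> m ^ n))"
proof -
  note w = assms(1,2)
  have unb: "\<exists>y\<ge>0. ereal y < conv_radius w \<and> generator (diffs w) y > B" for B
  proof -
    have "\<forall>\<^sub>F y in from_below (conv_radius w). deriv (generator w) y > B"
      using assms(6) by (simp add: filterlim_at_top_dense)
    then have "\<forall>\<^sub>F y in from_below (conv_radius w). deriv (generator w) y > B \<and> y \<ge> 0 \<and> ereal y < conv_radius w"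
      using eventually_from_below(1)[OF assms(3)] by eventually_elim auto
    then obtain y where y: "deriv (generator w) y > B" "y \<ge> 0" "ereal y < conv_radius w"
      using eventually_happens'[OF eventually_from_below(2)[OF assms(3)]] by blast
    then have "deriv (generator w) y = generator (diffs w) y"
      by (intro DERIV_imp_deriv has_field_derivative_generator) simp
    then show ?thesis using y by auto
  qed
  have "\<exists>i\<ge>2. w i > 0"
  proof (rule ccontr)
    assume no: "\<not> (\<exists>i\<ge>2. w i > 0)"
    have "diffs w n = 0" if "n \<noteq> 0" for n
    proof -
      have "\<not> w (Suc n) > 0" using that no by auto
      then show ?thesis using w(1)[of "Suc n"] by (simp add: diffs_def)
    qed
    then have "generator (diffs w) y = diffs w 0" for y
      unfolding generator_def by (subst suminf_finite[of "{0}"]) auto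
    then show False using unb[of "diffs w 0"] by simp
  qed
  then obtain i where i: "i \<ge> 2" "w i > 0" by blast
  have "\<forall>m. \<exists>\<rho>. singular_at w m \<rho>" using singularities_exist[OF w i unb] by blast
  then obtain \<rho> where \<rho>: "\<And>m. singular_at w m (\<rho> m)" by metis
  have \<rho>_pos: "\<rho> m > 0" for m using \<rho>[of m] by (simp add: singular_at_def)
  have \<rho>_less: "\<rho> (Suc m) < \<rho> m" for m
    by (rule less_singularity[OF w i \<rho>]) (use \<rho>[of "Suc m"] in \<open>auto simp: singular_at_def\<close>)
  have "\<forall>m. \<exists>\<kappa>>0. (\<lambda>n. moment_sum w m n * \<rho> m ^ n - \<kappa> * sqrt_coeff n) \<in> O[admissible_residues w](\<lambda>n. real n powr (-5/2))"
    using \<rho> moment_sum_asymptotics[OF w i] unfolding singular_at_def by blast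
  then obtain \<kappa> where \<kappa>: "\<And>m. \<kappa> m > 0"
    "\<And>m. (\<lambda>n. moment_sum w m n * \<rho> m ^ n - \<kappa> m * sqrt_coeff n) \<in> O[admissible_residues w](\<lambda>n. real n powr (-5/2))"
    by metis
  define F where "F = admissible_at_top w"
  have F: "F \<le> sequentially" "F \<le> admissible_residues w"
    unfolding F_def using admissible_le_residues[OF w(1)] by (simp_all add: admissible_at_top_def)
  obtain c where c: "c > 0" "(\<lambda>n. sqrt_coeff n * real n powr (3/2)) \<longlonglongrightarrow> c"
    using sqrt_coeff_asymptotic by blast
  have "\<forall>\<^sub>F n in sequentially. sqrt_coeff n \<ge> c / 2 * real n powr (-3/2) \<and> n > 0"
  proof -
    have "\<forall>\<^sub>F n in sequentially. sqrt_coeff n * real n powr (3/2) > c / 2"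
      using c by (intro order_tendstoD) auto
    then show ?thesis using eventually_gt_at_top[of 0]
      by eventually_elim (simp add: powr_minus field_simps)
  qed
  then have b_lower: "\<forall>\<^sub>F n in F. sqrt_coeff n \<ge> c / 2 * real n powr (-3/2) \<and> n > 0"
    using F(1) by (rule filter_leD[rotated])
  then have b_pos: "\<forall>\<^sub>F n in F. sqrt_coeff n > 0"
  proof eventually_elim
    case (elim n)
    have "0 < c / 2 * real n powr (-3/2)" using c(1) elim by simp
    then show ?case using elim by linarith
  qed
  have small: "(\<lambda>n. real n powr (-5/2)) \<in> O[F](\<lambda>n. sqrt_coeff n / real n)"
  proof (rule landau_o.bigI[of "2 / c"])
    show "\<forall>\<^sub>F n in F. norm (real n powr (-5/2)) \<le> 2 / c * norm (sqrt_coeff n / real n)"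
      using b_lower b_pos
    proof eventually_elim
      case (elim n)
      have "real n powr (-5/2) = real n powr (-3/2) / real n"
        using elim powr_diff[of "real n" "-3/2" 1] by simp
      also have "\<dots> \<le> (2 / c * sqrt_coeff n) / real n"
        using elim c(1) by (intro divide_right_mono) (auto simp: field_simps)
      finally show ?case using elim by simp
    qed
  qed (use c in simp)
  define u where "u m n = moment_sum w m n * \<rho> m ^ n / \<kappa> m" for m n
  have u: "(\<lambda>n. u m n - sqrt_coeff n) \<in> O[F](\<lambda>n. sqrt_coeff n / real n)" for m
  proof -
    have "(\<lambda>n. moment_sum w m n * \<rho> m ^ n - \<kappa> m * sqrt_coeff n) \<in> O[F](\<lambda>n. sqrt_coeff n / real n)"
      using landau_o.big.filter_mono[OF F(2) \<kappa>(2)] small by (rule landau_o.big_trans)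
    then have "(\<lambda>n. inverse (\<kappa> m) * (moment_sum w m n * \<rho> m ^ n - \<kappa> m * sqrt_coeff n)) \<in> O[F](\<lambda>n. sqrt_coeff n / real n)"
      by simp
    moreover have "inverse (\<kappa> m) * (moment_sum w m n * \<rho> m ^ n - \<kappa> m * sqrt_coeff n) = u m n - sqrt_coeff n" for n
      using \<kappa>(1)[of m] by (simp add: u_def field_simps)
    ultimately show ?thesis by simp
  qed
  define \<gamma> where "\<gamma> m = \<kappa> m / \<kappa> 0" for m
  define \<tau> where "\<tau> m = \<rho> 0 / \<rho> m" for m
  have expectation: "measure_pmf.expectation (simply_generated_tree w n) (\<lambda>T. real (num_root_subtrees T) ^ m)
      = (1 + (u m n / u 0 n - 1)) * \<gamma> m * \<tau> m ^ n" if "partition_fun w n > 0" for m n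
    using \<kappa>(1)[of m] \<kappa>(1)[of 0] \<rho>_pos[of m] \<rho>_pos[of 0]
    by (simp add: expectation_root_subtrees[OF w(1) that] u_def \<gamma>_def \<tau>_def power_divide)
  have "\<tau> m < \<tau> (Suc m)" for m
    unfolding \<tau>_def using \<rho>_less[of m] \<rho>_pos by (intro divide_strict_left_mono mult_pos_pos)
  moreover from this[of 0] have "1 < \<tau> 1" using \<rho>_pos[of 0] by (simp add: \<tau>_def)
  moreover have "\<gamma> m > 0" for m using \<kappa>(1) by (simp add: \<gamma>_def)
  moreover have "(\<lambda>n. u m n / u 0 n - 1) \<in> O[admissible_at_top w](\<lambda>n. 1 / real n)" for m
    using ratio_asymptotics[OF F(1) b_pos u u] by (simp add: F_def)
  ultimately show ?thesis using expectation
    by (intro exI[of _ \<gamma>] exI[of _ \<tau>]) blast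
qed

end
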